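(* Let $Q$ be a finite quiver. (1) The category $\operatorname{Mod}\mathrm{Idem}(Q)$ is equivalent to the category $\mathcal{C}_Q$ of pairs $(M,t)$ defined in the context. (2) Let $T\in\mathbb{Z}^{Q_1}$ and let $\mathbb{C}^\times$ act on $\mathbb{C}Q$ by algebra automorphisms fixing the trivial paths $e_x$ and satisfying $\lambda\cdot a=\lambda^{T_a}a$ for every $a\in Q_1$. Then the category of $\mathbb{C}^\times$-equivariant $\mathbb{C}Q$-modules for this action is equivalent to $\operatorname{Mod}\mathrm{Idem}^T(Q)$.
   Context: A quiver is $Q=(Q_0,Q_1,s,t)$; all modules and representations are finite-dimensional over $\mathbb{C}$, paths are composed right to left, and $\operatorname{Mod}\mathbb{C}Q$ is identified with representations $M=((M_x)_{x\in Q_0},(M_a)_{a\in Q_1})$ of $Q$. $\operatorname{Mod}\mathrm{Idem}(Q)$: an object $N$ is a representation $R(N)=((N_x),(N_a))$ of $Q$ together with linear maps $n_i^x:N_x\to N_x$ for $x\in Q_0$, $i\in\mathbb{Z}$, such that for each $x$ only finitely many $n_i^x$ are non-zero, $n_i^xn_k^x=0$ for $i\ne k$, and $\sum_i n_i^x=\mathrm{Id}_{N_x}$. A morphism $N\to N'$ is a family of linear maps $\phi_x:N_x\to N'_x$ commuting with the maps of all arrows $a\in Q_1$ and with all the idempotents. $\operatorname{Mod}\mathrm{Idem}^T(Q)$, for $T\in\mathbb{Z}^{Q_1}$: the full subcategory of objects $N$ with $n_i^{t(a)}N_an_k^{s(a)}=0$ for all $a\in Q_1$ and all $i,k$ with $i-k\neq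 T_a$. $\mathcal{C}_Q$: objects are pairs $(M,t)$ with $M\in\operatorname{Mod}\mathbb{C}Q$ and $t:\mathbb{C}^\times\to\mathrm{GL}(\bigoplus_{x\in Q_0}M_x)$ a morphism of algebraic groups such that each $M_x$ is $\mathbb{C}^\times$-stable; morphisms are $\mathbb{C}Q$-module morphisms intertwining the $\mathbb{C}^\times$-actions. If an algebraic group $G$ acts rationally on an algebra $A$ and on an $A$-module $M$, then $M$ is a $G$-equivariant $A$-module if $(g\cdot a)\cdot(g\cdot m)=g\cdot(a\cdot m)$ for all $g\in G$, $a\in A$, $m\in M$. Morphisms of equivariant modules are $A$-module morphisms intertwining the $G$-actions. *)

theory Defs
  imports
    "HOL-Algebra.Bij"
    "HOL-Algebra.Multiplicative_Group"
    "HOL-Computational_Algebra.Polynomial"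
    "HOL-Library.Poly_Mapping"
    "Graph_Theory.Arc_Walk"
    "Jordan_Normal_Form.VS_Connect"
begin

section \<open>Categories and equivalences\<close>

text \<open>
  Hom sets of different pairs of objects need not be disjoint, so composition and the action of a
  functor on morphisms take the objects as arguments: \<open>cmp C X Y Z g f\<close> is the composite of
  \<open>f : X \<rightarrow> Y\<close> and \<open>g : Y \<rightarrow> Z\<close>.
\<close>

record ('o, 'm) category =
  obj :: "'o set"
  Hom :: "'o \<Rightarrow> 'o \<Rightarrow> 'm set"
  idn :: "'o \<Rightarrow> 'm"
  cmp :: "'o \<Rightarrow> 'o \<Rightarrow> 'o \<Rightarrow> 'm \<Rightarrow> 'm \<Rightarrow> 'm"

definition is_category :: "('o, 'm) category \<Rightarrow> bool" where
  "is_category C \<longleftrightarrow>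
     (\<forall>X\<in>obj C. idn C X \<in> Hom C X X) \<and>
     (\<forall>X\<in>obj C. \<forall>Y\<in>obj C. \<forall>Z\<in>obj C. \<forall>f\<in>Hom C X Y. \<forall>g\<in>Hom C Y Z. cmp C X Y Z g f \<in> Hom C X Z) \<and>
     (\<forall>X\<in>obj C. \<forall>Y\<in>obj C. \<forall>f\<in>Hom C X Y.
        cmp C X X Y f (idn C X) = f \<and> cmp C X Y Y (idn C Y) f = f) \<and>
     (\<forall>W\<in>obj C. \<forall>X\<in>obj C. \<forall>Y\<in>obj C. \<forall>Z\<in>obj C. \<forall>f\<in>Hom C W X. \<forall>g\<in>Hom C X Y. \<forall>h\<in>Hom C Y Z.
        cmp C W Y Z h (cmp C W X Y g f) = cmp C W X Z (cmp C X Y Z h g) f)"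

record ('o, 'm, 'p, 'n) functor_data =
  on_obj :: "'o \<Rightarrow> 'p"
  on_hom :: "'o \<Rightarrow> 'o \<Rightarrow> 'm \<Rightarrow> 'n"

definition is_functor ::
  "('o, 'm) category \<Rightarrow> ('p, 'n) category \<Rightarrow> ('o, 'm, 'p, 'n) functor_data \<Rightarrow> bool" where
  "is_functor C D F \<longleftrightarrow>
     (\<forall>X\<in>obj C. on_obj F X \<in> obj D) \<and>
     (\<forall>X\<in>obj C. \<forall>Y\<in>obj C. \<forall>f\<in>Hom C X Y. on_hom F X Y f \<in> Hom D (on_obj F X) (on_obj F Y)) \<and>
     (\<forall>X\<in>obj C. on_hom F X X (idn C X) = idn D (on_obj F X)) \<and>
     (\<forall>X\<in>obj C. \<forall>Y\<in>obj C. \<forall>Z\<in>obj C. \<forall>f\<in>Hom C X Y. \<forall>g\<in>Hom C Y Z.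
        on_hom F X Z (cmp C X Y Z g f) =
          cmp D (on_obj F X) (on_obj F Y) (on_obj F Z) (on_hom F Y Z g) (on_hom F X Y f))"

definition id_functor :: "('o, 'm, 'o, 'm) functor_data" where
  "id_functor = \<lparr>on_obj = (\<lambda>X. X), on_hom = (\<lambda>X Y f. f)\<rparr>"

definition comp_functor ::
  "('p, 'n, 'q, 'k) functor_data \<Rightarrow> ('o, 'm, 'p, 'n) functor_data \<Rightarrow> ('o, 'm, 'q, 'k) functor_data" where
  "comp_functor G F =
     \<lparr>on_obj = (\<lambda>X. on_obj G (on_obj F X)),
      on_hom = (\<lambda>X Y f. on_hom G (on_obj F X) (on_obj F Y) (on_hom F X Y f))\<rparr>"

definition is_isomorphism :: "('o, 'm) category \<Rightarrow> 'o \<Rightarrow> 'o \<Rightarrow> 'm \<Rightarrow> bool" where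
  "is_isomorphism C X Y f \<longleftrightarrow>
     f \<in> Hom C X Y \<and> (\<exists>g\<in>Hom C Y X. cmp C X Y X g f = idn C X \<and> cmp C Y X Y f g = idn C Y)"

definition naturally_isomorphic ::
  "('o, 'm) category \<Rightarrow> ('p, 'n) category \<Rightarrow>
     ('o, 'm, 'p, 'n) functor_data \<Rightarrow> ('o, 'm, 'p, 'n) functor_data \<Rightarrow> bool" where
  "naturally_isomorphic C D F G \<longleftrightarrow>
     (\<exists>\<eta>. (\<forall>X\<in>obj C. is_isomorphism D (on_obj F X) (on_obj G X) (\<eta> X)) \<and>
          (\<forall>X\<in>obj C. \<forall>Y\<in>obj C. \<forall>f\<in>Hom C X Y.
             cmp D (on_obj F X) (on_obj F Y) (on_obj G Y) (\<eta> Y) (on_hom F X Y f) =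
             cmp D (on_obj F X) (on_obj G X) (on_obj G Y) (on_hom G X Y f) (\<eta> X)))"

definition equivalent_categories :: "('o, 'm) category \<Rightarrow> ('p, 'n) category \<Rightarrow> bool" where
  "equivalent_categories C D \<longleftrightarrow>
     is_category C \<and> is_category D \<and>
     (\<exists>F G. is_functor C D F \<and> is_functor D C G \<and>
        naturally_isomorphic C C (comp_functor G F) id_functor \<and>
        naturally_isomorphic D D (comp_functor F G) id_functor)"


section \<open>Finite-dimensional complex vector spaces\<close>

text \<open>
  A vector space is given by an arbitrary carrier set inside a type \<open>'v\<close> together with operations,
  so \<open>'v\<close> bounds the size of the spaces considered: as soon as it has at least the cardinality of
  \<open>\<complex>\<close>, every finite-dimensional space is isomorphic to one carried by a subset of \<open>'v\<close>.
  The ring components \<open>mult\<close> and \<open>one\<close> of the module record play no role. Linear maps that serve as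
  morphisms, or as elements of a group, are required to be \<open>undefined\<close> off the carrier, so
  that two of them are equal iff they agree on the carrier. Structure maps that are only part of
  the data of an object need no such restriction: values off the carrier change an object
  only up to a canonical isomorphism.
\<close>

abbreviation CC :: "complex ring" where
  "CC \<equiv> class_ring"

definition CC_mod :: "(complex, complex) module" where
  "CC_mod = \<lparr>carrier = UNIV, mult = (*), one = 1, zero = 0, add = (+), smult = (*)\<rparr>"

definition fd_vectorspace :: "(complex, 'v) module \<Rightarrow> bool" where
  "fd_vectorspace V \<longleftrightarrow> vectorspace CC V \<and> vectorspace.fin_dim CC V"

definition lin :: "(complex, 'v) module \<Rightarrow> (complex, 'w) module \<Rightarrow> ('v \<Rightarrow> 'w) set" where
  "lin V W = module_hom CC V W \<inter> extensional (carrier V)"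

definition GL :: "(complex, 'v) module \<Rightarrow> ('v \<Rightarrow> 'v) monoid" where
  "GL V = BijGroup (carrier V) \<lparr>carrier := module_hom CC V V \<inter> Bij (carrier V)\<rparr>"

definition direct_sum_fam :: "'x set \<Rightarrow> ('x \<Rightarrow> (complex, 'v) module) \<Rightarrow> (complex, 'x \<Rightarrow> 'v) module" where
  "direct_sum_fam I M =
     \<lparr>carrier = (\<Pi>\<^sub>E x\<in>I. carrier (M x)),
      mult = (\<lambda>v w. \<lambda>x\<in>I. \<zero>\<^bsub>M x\<^esub>),
      one = (\<lambda>x\<in>I. \<zero>\<^bsub>M x\<^esub>),
      zero = (\<lambda>x\<in>I. \<zero>\<^bsub>M x\<^esub>),
      add = (\<lambda>v w. \<lambda>x\<in>I. v x \<oplus>\<^bsub>M x\<^esub> w x),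
      smult = (\<lambda>c v. \<lambda>x\<in>I. c \<odot>\<^bsub>M x\<^esub> v x)\<rparr>"

text \<open>The summand \<open>M x\<close>, as a subspace of the direct sum.\<close>

definition summand :: "'x set \<Rightarrow> ('x \<Rightarrow> (complex, 'v) module) \<Rightarrow> 'x \<Rightarrow> ('x \<Rightarrow> 'v) set" where
  "summand I M x = {v \<in> carrier (direct_sum_fam I M). \<forall>y\<in>I - {x}. v y = \<zero>\<^bsub>M y\<^esub>}"


section \<open>Morphisms of algebraic groups from the multiplicative group to \<open>GL(V)\<close>\<close>

text \<open>The coordinate ring of the punctured line is \<open>\<complex>[z, 1/z]\<close>.\<close>

definition regular_on_Gm :: "(complex \<Rightarrow> complex) \<Rightarrow> bool" where
  "regular_on_Gm h \<longleftrightarrow> (\<exists>(p :: complex poly) (n :: nat). \<forall>z. z \<noteq> 0 \<longrightarrow> h z = poly p z / z ^ n)"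

text \<open>
  \<open>GL(V)\<close> is an open subvariety of the affine space \<open>End(V)\<close>, whose coordinate functions are the
  matrix coefficients \<open>g \<mapsto> f (g v)\<close>; hence a map to \<open>GL(V)\<close> is a morphism of
  varieties iff its matrix coefficients are regular.
\<close>

definition algebraic_hom_GL :: "(complex, 'v) module \<Rightarrow> (complex \<Rightarrow> 'v \<Rightarrow> 'v) \<Rightarrow> bool" where
  "algebraic_hom_GL V t \<longleftrightarrow>
     t \<in> hom (mult_of CC) (GL V) \<and>
     (\<forall>v\<in>carrier V. \<forall>f\<in>module_hom CC V CC_mod. regular_on_Gm (\<lambda>z. f (t z v)))"


section \<open>Representations of a quiver\<close>

text \<open>
  A quiver is a \<^typ>\<open>('x, 'e) pre_digraph\<close>; \<open>verts\<close>, \<open>arcs\<close>, \<open>tail\<close>, \<open>head\<close> are the vertices, arrows,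
  source and target maps.
\<close>

record ('x, 'e, 'v) rep =
  space :: "'x \<Rightarrow> (complex, 'v) module"
  arrow :: "'e \<Rightarrow> 'v \<Rightarrow> 'v"

definition is_rep :: "('x, 'e) pre_digraph \<Rightarrow> ('x, 'e, 'v, 'z) rep_scheme \<Rightarrow> bool" where
  "is_rep Q M \<longleftrightarrow>
     (\<forall>x\<in>verts Q. fd_vectorspace (space M x)) \<and>
     (\<forall>a\<in>arcs Q. arrow M a \<in> module_hom CC (space M (tail Q a)) (space M (head Q a)))"

definition rep_hom ::
  "('x, 'e) pre_digraph \<Rightarrow> ('x, 'e, 'v, 'z) rep_scheme \<Rightarrow> ('x, 'e, 'v, 'z) rep_scheme \<Rightarrow>
     ('x \<Rightarrow> 'v \<Rightarrow> 'v) set" where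
  "rep_hom Q M N =
     {\<phi> \<in> (\<Pi>\<^sub>E x\<in>verts Q. lin (space M x) (space N x)).
        \<forall>a\<in>arcs Q. \<forall>v\<in>carrier (space M (tail Q a)).
          \<phi> (head Q a) (arrow M a v) = arrow N a (\<phi> (tail Q a) v)}"

definition rep_id :: "('x, 'e) pre_digraph \<Rightarrow> ('x, 'e, 'v, 'z) rep_scheme \<Rightarrow> 'x \<Rightarrow> 'v \<Rightarrow> 'v" where
  "rep_id Q M = (\<lambda>x\<in>verts Q. \<lambda>v\<in>carrier (space M x). v)"

definition rep_comp ::
  "('x, 'e) pre_digraph \<Rightarrow> ('x, 'e, 'v, 'z) rep_scheme \<Rightarrow>
     ('x \<Rightarrow> 'v \<Rightarrow> 'v) \<Rightarrow> ('x \<Rightarrow> 'v \<Rightarrow> 'v) \<Rightarrow> 'x \<Rightarrow> 'v \<Rightarrow> 'v" where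
  "rep_comp Q M \<psi> \<phi> = (\<lambda>x\<in>verts Q. compose (carrier (space M x)) (\<psi> x) (\<phi> x))"


section \<open>The categories \<open>Mod Idem(Q)\<close> and \<open>Mod Idem\<^sup>T(Q)\<close>\<close>

record ('x, 'e, 'v) idem_rep = "('x, 'e, 'v) rep" +
  idem :: "'x \<Rightarrow> int \<Rightarrow> 'v \<Rightarrow> 'v"

definition idem_support :: "('x, 'e, 'v) idem_rep \<Rightarrow> 'x \<Rightarrow> int set" where
  "idem_support N x = {i. \<exists>v\<in>carrier (space N x). idem N x i v \<noteq> \<zero>\<^bsub>space N x\<^esub>}"

definition is_idem_rep :: "('x, 'e) pre_digraph \<Rightarrow> ('x, 'e, 'v) idem_rep \<Rightarrow> bool" where
  "is_idem_rep Q N \<longleftrightarrow>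
     is_rep Q N \<and>
     (\<forall>x\<in>verts Q.
        (\<forall>i. idem N x i \<in> module_hom CC (space N x) (space N x)) \<and>
        finite (idem_support N x) \<and>
        (\<forall>i k. i \<noteq> k \<longrightarrow> (\<forall>v\<in>carrier (space N x). idem N x i (idem N x k v) = \<zero>\<^bsub>space N x\<^esub>)) \<and>
        (\<forall>v\<in>carrier (space N x). (\<Oplus>\<^bsub>space N x\<^esub>i\<in>idem_support N x. idem N x i v) = v))"

definition idem_rep_hom ::
  "('x, 'e) pre_digraph \<Rightarrow> ('x, 'e, 'v) idem_rep \<Rightarrow> ('x, 'e, 'v) idem_rep \<Rightarrow> ('x \<Rightarrow> 'v \<Rightarrow> 'v) set" where
  "idem_rep_hom Q M N =
     {\<phi> \<in> rep_hom Q M N.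
        \<forall>x\<in>verts Q. \<forall>i. \<forall>v\<in>carrier (space M x). \<phi> x (idem M x i v) = idem N x i (\<phi> x v)}"

definition Mod_Idem ::
  "('x, 'e) pre_digraph \<Rightarrow> (('x, 'e, 'v) idem_rep, 'x \<Rightarrow> 'v \<Rightarrow> 'v) category" where
  "Mod_Idem Q =
     \<lparr>obj = {N. is_idem_rep Q N},
      Hom = idem_rep_hom Q,
      idn = rep_id Q,
      cmp = (\<lambda>X Y Z \<psi> \<phi>. rep_comp Q X \<psi> \<phi>)\<rparr>"

definition Mod_Idem_T ::
  "('x, 'e) pre_digraph \<Rightarrow> ('e \<Rightarrow> int) \<Rightarrow> (('x, 'e, 'v) idem_rep, 'x \<Rightarrow> 'v \<Rightarrow> 'v) category" where
  "Mod_Idem_T Q T =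
     (Mod_Idem Q)
     \<lparr>obj := {N \<in> obj (Mod_Idem Q).
        \<forall>a\<in>arcs Q. \<forall>i k. i - k \<noteq> T a \<longrightarrow>
          (\<forall>v\<in>carrier (space N (tail Q a)).
             idem N (head Q a) i (arrow N a (idem N (tail Q a) k v)) = \<zero>\<^bsub>space N (head Q a)\<^esub>)}\<rparr>"


section \<open>The category \<open>C\<^sub>Q\<close>\<close>

record ('x, 'e, 'v) torus_rep = "('x, 'e, 'v) rep" +
  torus :: "complex \<Rightarrow> ('x \<Rightarrow> 'v) \<Rightarrow> ('x \<Rightarrow> 'v)"

abbreviation total_space :: "('x, 'e) pre_digraph \<Rightarrow> ('x, 'e, 'v, 'z) rep_scheme \<Rightarrow> (complex, 'x \<Rightarrow> 'v) module" where
  "total_space Q M \<equiv> direct_sum_fam (verts Q) (space M)"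

definition is_torus_rep :: "('x, 'e) pre_digraph \<Rightarrow> ('x, 'e, 'v) torus_rep \<Rightarrow> bool" where
  "is_torus_rep Q M \<longleftrightarrow>
     is_rep Q M \<and>
     algebraic_hom_GL (total_space Q M) (torus M) \<and>
     (\<forall>x\<in>verts Q. \<forall>z. z \<noteq> 0 \<longrightarrow>
        torus M z ` summand (verts Q) (space M) x \<subseteq> summand (verts Q) (space M) x)"

definition total_map :: "('x, 'e) pre_digraph \<Rightarrow> ('x \<Rightarrow> 'v \<Rightarrow> 'v) \<Rightarrow> ('x \<Rightarrow> 'v) \<Rightarrow> ('x \<Rightarrow> 'v)" where
  "total_map Q \<phi> v = (\<lambda>x\<in>verts Q. \<phi> x (v x))"

definition torus_rep_hom ::
  "('x, 'e) pre_digraph \<Rightarrow> ('x, 'e, 'v) torus_rep \<Rightarrow> ('x, 'e, 'v) torus_rep \<Rightarrow> ('x \<Rightarrow> 'v \<Rightarrow> 'v) set" where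
  "torus_rep_hom Q M N =
     {\<phi> \<in> rep_hom Q M N.
        \<forall>z. z \<noteq> 0 \<longrightarrow> (\<forall>v\<in>carrier (total_space Q M).
          total_map Q \<phi> (torus M z v) = torus N z (total_map Q \<phi> v))}"

definition C_cat ::
  "('x, 'e) pre_digraph \<Rightarrow> (('x, 'e, 'v) torus_rep, 'x \<Rightarrow> 'v \<Rightarrow> 'v) category" where
  "C_cat Q =
     \<lparr>obj = {M. is_torus_rep Q M},
      Hom = torus_rep_hom Q,
      idn = rep_id Q,
      cmp = (\<lambda>X Y Z \<psi> \<phi>. rep_comp Q X \<psi> \<phi>)\<rparr>"


section \<open>The path algebra\<close>

text \<open>
  A path is a pair \<open>(u, p)\<close> of its source and the list of its arrows in the order in which they are
  traversed; \<open>(u, [])\<close> is the trivial path at \<open>u\<close>. Paths compose right to left, so the product of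
  \<open>(v, q)\<close> and \<open>(u, p)\<close> is \<open>(u, p @ q)\<close> if \<open>p\<close> ends at \<open>v\<close>, and zero otherwise.
\<close>

type_synonym ('x, 'e) path_elt = "('x \<times> 'e list) \<Rightarrow>\<^sub>0 complex"

definition quiver_paths :: "('x, 'e) pre_digraph \<Rightarrow> ('x \<times> 'e list) set" where
  "quiver_paths Q = {(u, p). \<exists>v. pre_digraph.awalk Q u p v}"

definition path_product ::
  "('x, 'e) pre_digraph \<Rightarrow> 'x \<times> 'e list \<Rightarrow> 'x \<times> 'e list \<Rightarrow> complex \<Rightarrow> ('x, 'e) path_elt" where
  "path_product Q = (\<lambda>(v, q) (u, p) c.
     if pre_digraph.awalk Q u p v then Poly_Mapping.single (u, p @ q) c else 0)"

definition trivial_path :: "'x \<Rightarrow> ('x, 'e) path_elt" where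
  "trivial_path x = Poly_Mapping.single (x, []) 1"

definition arrow_path :: "('x, 'e) pre_digraph \<Rightarrow> 'e \<Rightarrow> ('x, 'e) path_elt" where
  "arrow_path Q a = Poly_Mapping.single (tail Q a, [a]) 1"

definition path_algebra :: "('x, 'e) pre_digraph \<Rightarrow> (complex, ('x, 'e) path_elt) module" where
  "path_algebra Q =
     \<lparr>carrier = {f. Poly_Mapping.keys f \<subseteq> quiver_paths Q},
      mult = (\<lambda>f g. \<Sum>q\<in>Poly_Mapping.keys f. \<Sum>p\<in>Poly_Mapping.keys g.
                path_product Q q p (Poly_Mapping.lookup f q * Poly_Mapping.lookup g p)),
      one = (\<Sum>x\<in>verts Q. trivial_path x),
      zero = 0,
      add = (+),
      smult = (\<lambda>c f. Poly_Mapping.map ((*) c) f)\<rparr>"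


section \<open>Equivariant modules\<close>

text \<open>
  An algebra is given by a record with both a ring and a vector space structure. (The locale
  \<open>algebra\<close> of HOL-Algebra covers commutative algebras only, and \<open>module\<close> only modules over
  commutative rings, so neither applies to path algebras.)
\<close>

definition algebra_Aut :: "(complex, 'a) module \<Rightarrow> ('a \<Rightarrow> 'a) monoid" where
  "algebra_Aut A =
     BijGroup (carrier A) \<lparr>carrier := Ring.ring_hom A A \<inter> module_hom CC A A \<inter> Bij (carrier A)\<rparr>"

record ('a, 'v) equiv_module =
  vspace :: "(complex, 'v) module"
  act :: "'a \<Rightarrow> 'v \<Rightarrow> 'v"
  gm_act :: "complex \<Rightarrow> 'v \<Rightarrow> 'v"

definition is_fd_module ::
  "(complex, 'a) module \<Rightarrow> (complex, 'v) module \<Rightarrow> ('a \<Rightarrow> 'v \<Rightarrow> 'v) \<Rightarrow> bool" where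
  "is_fd_module A V \<rho> \<longleftrightarrow>
     fd_vectorspace V \<and>
     (\<forall>a\<in>carrier A. \<rho> a \<in> module_hom CC V V) \<and>
     (\<forall>a\<in>carrier A. \<forall>b\<in>carrier A. \<forall>v\<in>carrier V. \<rho> (a \<oplus>\<^bsub>A\<^esub> b) v = \<rho> a v \<oplus>\<^bsub>V\<^esub> \<rho> b v) \<and>
     (\<forall>c. \<forall>a\<in>carrier A. \<forall>v\<in>carrier V. \<rho> (c \<odot>\<^bsub>A\<^esub> a) v = c \<odot>\<^bsub>V\<^esub> \<rho> a v) \<and>
     (\<forall>a\<in>carrier A. \<forall>b\<in>carrier A. \<forall>v\<in>carrier V. \<rho> (a \<otimes>\<^bsub>A\<^esub> b) v = \<rho> a (\<rho> b v)) \<and>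
     (\<forall>v\<in>carrier V. \<rho> \<one>\<^bsub>A\<^esub> v = v)"

text \<open>
  Here \<open>\<alpha>\<close> is the action of the multiplicative group on \<open>A\<close>. A rational action on a
  finite-dimensional space is a morphism of algebraic groups to its general linear group.
\<close>

definition is_equiv_module ::
  "(complex, 'a) module \<Rightarrow> (complex \<Rightarrow> 'a \<Rightarrow> 'a) \<Rightarrow> ('a, 'v) equiv_module \<Rightarrow> bool" where
  "is_equiv_module A \<alpha> M \<longleftrightarrow>
     is_fd_module A (vspace M) (act M) \<and>
     algebraic_hom_GL (vspace M) (gm_act M) \<and>
     (\<forall>z. z \<noteq> 0 \<longrightarrow> (\<forall>a\<in>carrier A. \<forall>m\<in>carrier (vspace M).
        act M (\<alpha> z a) (gm_act M z m) = gm_act M z (act M a m)))"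

definition equiv_module_hom ::
  "(complex, 'a) module \<Rightarrow> ('a, 'v) equiv_module \<Rightarrow> ('a, 'v) equiv_module \<Rightarrow> ('v \<Rightarrow> 'v) set" where
  "equiv_module_hom A M N =
     {f \<in> lin (vspace M) (vspace N).
        (\<forall>a\<in>carrier A. \<forall>m\<in>carrier (vspace M). f (act M a m) = act N a (f m)) \<and>
        (\<forall>z. z \<noteq> 0 \<longrightarrow> (\<forall>m\<in>carrier (vspace M). f (gm_act M z m) = gm_act N z (f m)))}"

definition Equiv_Mod ::
  "(complex, 'a) module \<Rightarrow> (complex \<Rightarrow> 'a \<Rightarrow> 'a) \<Rightarrow> (('a, 'v) equiv_module, 'v \<Rightarrow> 'v) category" where
  "Equiv_Mod A \<alpha> =
     \<lparr>obj = {M. is_equiv_module A \<alpha> M},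
      Hom = equiv_module_hom A,
      idn = (\<lambda>M. \<lambda>v\<in>carrier (vspace M). v),
      cmp = (\<lambda>X Y Z g f. compose (carrier (vspace X)) g f)\<rparr>"

end

theory Submission
  imports Defs
begin

text \<open>
  Both equivalences rest on one fact: an algebraic action of the multiplicative group on a
  finite-dimensional space \<open>V\<close> is the same as a grading of \<open>V\<close> by the integers, that is, a
  family of orthogonal projections \<open>P i\<close>, almost all zero, with sum the identity. The grading gives
  the action \<open>t z = (\<Sum>i. z\<^sup>i P i)\<close> (\<open>torus_of_algebraic\<close>). Conversely each matrix
  coefficient \<open>f (t z v)\<close> is a Laurent polynomial in \<open>z\<close>, and the coefficients of \<open>z\<^sup>i\<close> are
  the coordinates of \<open>P i v\<close>; that \<open>t\<close> is multiplicative makes the \<open>P i\<close> orthogonal idempotents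
  (\<open>algebraic_grading_exists\<close>). Laurent polynomials that agree off the origin have the same
  coefficients, so identities between torus actions can be read off weight by weight: a linear map
  \<open>h\<close> satisfies \<open>z\<^sup>T h (t z v) = t' z (h v)\<close> for all \<open>z\<close> iff \<open>h (P k v) = P' (k + T) (h v)\<close> for
  all \<open>k\<close> (\<open>intertwine_iff\<close>).

  For the first equivalence, the idempotents at the vertices are replaced by the torus action that
  their direct sum defines; the representation and the morphisms stay as they are. The case \<open>T = 0\<close>
  of \<open>intertwine_iff\<close> says that the two notions of morphism agree (\<open>with_torus_hom\<close>). A torus action
  that preserves every summand of the total space has block diagonal projections, so it comes from
  idempotents at the vertices (\<open>with_torus_surj\<close>).

  For the second equivalence, an equivariant module \<open>M\<close> goes to the spaces \<open>e\<^sub>x M\<close> with the maps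
  induced by the arrows and the projections of the torus action. The path algebra is generated by
  trivial paths and arrows, and the torus acts on it by algebra automorphisms, so equivariance need
  be tested on these generators only. There it says that the \<open>e\<^sub>x\<close> commute with the projections and
  that the arrow \<open>a\<close> raises weights by \<open>T a\<close> (\<open>equivariance_iff\<close>), and the latter is the condition
  that cuts out the subcategory (\<open>shift_intertwine\<close>). A morphism is determined by its restrictions
  to the \<open>e\<^sub>x M\<close>, and any compatible family of maps extends (\<open>rep_of_faithful\<close>, \<open>rep_of_full\<close>). In
  the other direction a representation gives its direct sum, on which paths act as compositions of
  arrows (\<open>rep_of_surj\<close>). That direct sum has to be carried by the same type as its summands, and it
  can be: if the type is infinite it contains a copy of each of its finite powers, and if it is
  finite every complex vector space in it is zero (\<open>direct_sum_inj\<close>).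

  Equations between vectors are mostly verified after applying an arbitrary linear functional
  (\<open>dual_ext\<close>), which turns sums in a vector space into sums of complex numbers.
\<close>

section \<open>Finite-dimensional vector spaces\<close>

lemma vs_closed:
  assumes "vectorspace CC V"
  shows vs_zero: "\<zero>\<^bsub>V\<^esub> \<in> carrier V"
    and vs_add: "v \<in> carrier V \<Longrightarrow> w \<in> carrier V \<Longrightarrow> v \<oplus>\<^bsub>V\<^esub> w \<in> carrier V"
    and vs_smult: "v \<in> carrier V \<Longrightarrow> c \<odot>\<^bsub>V\<^esub> v \<in> carrier V"
    and vs_finsum: "(\<And>i. i \<in> I \<Longrightarrow> g i \<in> carrier V) \<Longrightarrow> finsum V g I \<in> carrier V"
proof -
  interpret vectorspace CC V by fact
  show "\<zero>\<^bsub>V\<^esub> \<in> carrier V" by simp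
  show "v \<in> carrier V \<Longrightarrow> w \<in> carrier V \<Longrightarrow> v \<oplus>\<^bsub>V\<^esub> w \<in> carrier V" by simp
  show "v \<in> carrier V \<Longrightarrow> c \<odot>\<^bsub>V\<^esub> v \<in> carrier V" by (rule smult_closed) auto
  show "(\<And>i. i \<in> I \<Longrightarrow> g i \<in> carrier V) \<Longrightarrow> finsum V g I \<in> carrier V" by (rule M.finsum_closed) auto
qed

lemma vectorspaceI:
  assumes "\<zero>\<^bsub>V\<^esub> \<in> carrier V"
    and "\<And>v w. v \<in> carrier V \<Longrightarrow> w \<in> carrier V \<Longrightarrow> v \<oplus>\<^bsub>V\<^esub> w \<in> carrier V"
    and "\<And>c v. v \<in> carrier V \<Longrightarrow> c \<odot>\<^bsub>V\<^esub> v \<in> carrier V"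
    and "\<And>v w. v \<in> carrier V \<Longrightarrow> w \<in> carrier V \<Longrightarrow> v \<oplus>\<^bsub>V\<^esub> w = w \<oplus>\<^bsub>V\<^esub> v"
    and "\<And>u v w. u \<in> carrier V \<Longrightarrow> v \<in> carrier V \<Longrightarrow> w \<in> carrier V \<Longrightarrow>
           (u \<oplus>\<^bsub>V\<^esub> v) \<oplus>\<^bsub>V\<^esub> w = u \<oplus>\<^bsub>V\<^esub> (v \<oplus>\<^bsub>V\<^esub> w)"
    and "\<And>v. v \<in> carrier V \<Longrightarrow> v \<oplus>\<^bsub>V\<^esub> \<zero>\<^bsub>V\<^esub> = v"
    and "\<And>v. v \<in> carrier V \<Longrightarrow> v \<oplus>\<^bsub>V\<^esub> (- 1) \<odot>\<^bsub>V\<^esub> v = \<zero>\<^bsub>V\<^esub>"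
    and "\<And>a b v. v \<in> carrier V \<Longrightarrow> (a * b) \<odot>\<^bsub>V\<^esub> v = a \<odot>\<^bsub>V\<^esub> (b \<odot>\<^bsub>V\<^esub> v)"
    and "\<And>v. v \<in> carrier V \<Longrightarrow> 1 \<odot>\<^bsub>V\<^esub> v = v"
    and "\<And>a b v. v \<in> carrier V \<Longrightarrow> (a + b) \<odot>\<^bsub>V\<^esub> v = a \<odot>\<^bsub>V\<^esub> v \<oplus>\<^bsub>V\<^esub> b \<odot>\<^bsub>V\<^esub> v"
    and "\<And>a v w. v \<in> carrier V \<Longrightarrow> w \<in> carrier V \<Longrightarrow>
           a \<odot>\<^bsub>V\<^esub> (v \<oplus>\<^bsub>V\<^esub> w) = a \<odot>\<^bsub>V\<^esub> v \<oplus>\<^bsub>V\<^esub> a \<odot>\<^bsub>V\<^esub> w"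
  shows "vectorspace CC V"
proof (rule vs_criteria)
  show "field CC" by (rule class_field)
  show "\<forall>v\<in>carrier V. \<exists>w\<in>carrier V. v \<oplus>\<^bsub>V\<^esub> w = \<zero>\<^bsub>V\<^esub>"
    using assms(3,7) by blast
qed (use assms in auto)

lemma vs_laws:
  assumes "vectorspace CC V"
  shows vs_add_comm: "v \<in> carrier V \<Longrightarrow> w \<in> carrier V \<Longrightarrow> v \<oplus>\<^bsub>V\<^esub> w = w \<oplus>\<^bsub>V\<^esub> v"
    and vs_add_assoc: "u \<in> carrier V \<Longrightarrow> v \<in> carrier V \<Longrightarrow> w \<in> carrier V \<Longrightarrow>
           (u \<oplus>\<^bsub>V\<^esub> v) \<oplus>\<^bsub>V\<^esub> w = u \<oplus>\<^bsub>V\<^esub> (v \<oplus>\<^bsub>V\<^esub> w)"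
    and vs_add_zero: "v \<in> carrier V \<Longrightarrow> v \<oplus>\<^bsub>V\<^esub> \<zero>\<^bsub>V\<^esub> = v"
    and vs_add_neg: "v \<in> carrier V \<Longrightarrow> v \<oplus>\<^bsub>V\<^esub> (- 1) \<odot>\<^bsub>V\<^esub> v = \<zero>\<^bsub>V\<^esub>"
    and vs_smult_assoc: "v \<in> carrier V \<Longrightarrow> (a * b) \<odot>\<^bsub>V\<^esub> v = a \<odot>\<^bsub>V\<^esub> (b \<odot>\<^bsub>V\<^esub> v)"
    and vs_smult_one: "v \<in> carrier V \<Longrightarrow> 1 \<odot>\<^bsub>V\<^esub> v = v"
    and vs_smult_zero: "v \<in> carrier V \<Longrightarrow> 0 \<odot>\<^bsub>V\<^esub> v = \<zero>\<^bsub>V\<^esub>"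
    and vs_smult_of_zero: "c \<odot>\<^bsub>V\<^esub> \<zero>\<^bsub>V\<^esub> = \<zero>\<^bsub>V\<^esub>"
    and vs_smult_ldistr: "v \<in> carrier V \<Longrightarrow> (a + b) \<odot>\<^bsub>V\<^esub> v = a \<odot>\<^bsub>V\<^esub> v \<oplus>\<^bsub>V\<^esub> b \<odot>\<^bsub>V\<^esub> v"
    and vs_smult_rdistr: "v \<in> carrier V \<Longrightarrow> w \<in> carrier V \<Longrightarrow>
           a \<odot>\<^bsub>V\<^esub> (v \<oplus>\<^bsub>V\<^esub> w) = a \<odot>\<^bsub>V\<^esub> v \<oplus>\<^bsub>V\<^esub> a \<odot>\<^bsub>V\<^esub> w"
proof -
  interpret vectorspace CC V by fact
  show "v \<in> carrier V \<Longrightarrow> w \<in> carrier V \<Longrightarrow> v \<oplus>\<^bsub>V\<^esub> w = w \<oplus>\<^bsub>V\<^esub> v" by (rule M.a_comm)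
  show "u \<in> carrier V \<Longrightarrow> v \<in> carrier V \<Longrightarrow> w \<in> carrier V \<Longrightarrow>
           (u \<oplus>\<^bsub>V\<^esub> v) \<oplus>\<^bsub>V\<^esub> w = u \<oplus>\<^bsub>V\<^esub> (v \<oplus>\<^bsub>V\<^esub> w)" by (rule M.a_assoc)
  show "v \<in> carrier V \<Longrightarrow> v \<oplus>\<^bsub>V\<^esub> \<zero>\<^bsub>V\<^esub> = v" by simp
  show ass: "(a * b) \<odot>\<^bsub>V\<^esub> v = a \<odot>\<^bsub>V\<^esub> (b \<odot>\<^bsub>V\<^esub> v)" if "v \<in> carrier V" for a b v
    using smult_assoc1[of a b v] that by simp
  show one: "1 \<odot>\<^bsub>V\<^esub> v = v" if "v \<in> carrier V" for v using smult_one[OF that] by simp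
  show zero: "0 \<odot>\<^bsub>V\<^esub> v = \<zero>\<^bsub>V\<^esub>" if "v \<in> carrier V" for v using smult_l_null[OF that] by simp
  show "c \<odot>\<^bsub>V\<^esub> \<zero>\<^bsub>V\<^esub> = \<zero>\<^bsub>V\<^esub>" by (rule smult_r_null) auto
  show ld: "(a + b) \<odot>\<^bsub>V\<^esub> v = a \<odot>\<^bsub>V\<^esub> v \<oplus>\<^bsub>V\<^esub> b \<odot>\<^bsub>V\<^esub> v" if "v \<in> carrier V" for a b v
    using smult_l_distr[of a b v] that by simp
  show "v \<in> carrier V \<Longrightarrow> w \<in> carrier V \<Longrightarrow>
           a \<odot>\<^bsub>V\<^esub> (v \<oplus>\<^bsub>V\<^esub> w) = a \<odot>\<^bsub>V\<^esub> v \<oplus>\<^bsub>V\<^esub> a \<odot>\<^bsub>V\<^esub> w" by (rule smult_r_distr) auto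
  show "v \<oplus>\<^bsub>V\<^esub> (- 1) \<odot>\<^bsub>V\<^esub> v = \<zero>\<^bsub>V\<^esub>" if v: "v \<in> carrier V"
    using ld[OF v, of 1 "-1"] zero[OF v] one[OF v] by simp
qed

lemma vectorspace_CC_mod: "vectorspace CC CC_mod"
  by (rule vectorspaceI) (auto simp: CC_mod_def algebra_simps)

lemma finsum_CC_mod: "finsum CC_mod g I = sum g I"
proof -
  interpret vectorspace CC CC_mod by (rule vectorspace_CC_mod)
  show ?thesis
  proof (induction I rule: infinite_finite_induct)
    case (insert x F)
    then show ?case by (subst M.finsum_insert) (auto simp: CC_mod_def)
  next
    case (infinite A)
    then show ?case by (simp add: M.finsum_infinite) (simp add: CC_mod_def)
  next
    case empty
    show ?case by (simp add: M.finsum_empty) (simp add: CC_mod_def)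
  qed
qed

lemma hom_closed: "h \<in> module_hom CC V W \<Longrightarrow> v \<in> carrier V \<Longrightarrow> h v \<in> carrier W"
  unfolding module_hom_def by auto

lemma hom_add: "h \<in> module_hom CC V W \<Longrightarrow> v \<in> carrier V \<Longrightarrow> w \<in> carrier V \<Longrightarrow>
    h (v \<oplus>\<^bsub>V\<^esub> w) = h v \<oplus>\<^bsub>W\<^esub> h w"
  unfolding module_hom_def by auto

lemma hom_smult: "h \<in> module_hom CC V W \<Longrightarrow> v \<in> carrier V \<Longrightarrow> h (c \<odot>\<^bsub>V\<^esub> v) = c \<odot>\<^bsub>W\<^esub> h v"
  unfolding module_hom_def by auto

lemma homI:
  assumes "\<And>v. v \<in> carrier V \<Longrightarrow> h v \<in> carrier W"
    and "\<And>v w. v \<in> carrier V \<Longrightarrow> w \<in> carrier V \<Longrightarrow> h (v \<oplus>\<^bsub>V\<^esub> w) = h v \<oplus>\<^bsub>W\<^esub> h w"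
    and "\<And>c v. v \<in> carrier V \<Longrightarrow> h (c \<odot>\<^bsub>V\<^esub> v) = c \<odot>\<^bsub>W\<^esub> h v"
  shows "h \<in> module_hom CC V W"
  using assms unfolding module_hom_def by auto

lemma hom_cong:
  assumes "h \<in> module_hom CC V W" "\<And>v. v \<in> carrier V \<Longrightarrow> h v = h' v" "vectorspace CC V"
  shows "h' \<in> module_hom CC V W"
proof (rule homI)
  note a = assms(1) and e = assms(2)[symmetric] and V = assms(3)
  show "h' v \<in> carrier W" if "v \<in> carrier V" for v using that hom_closed[OF a that] e[OF that] by simp
  show "h' (v \<oplus>\<^bsub>V\<^esub> w) = h' v \<oplus>\<^bsub>W\<^esub> h' w" if "v \<in> carrier V" "w \<in> carrier V" for v w
    using that hom_add[OF a that] e vs_add[OF V] by simp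
  show "h' (c \<odot>\<^bsub>V\<^esub> v) = c \<odot>\<^bsub>W\<^esub> h' v" if "v \<in> carrier V" for c v
    using that hom_smult[OF a that] e vs_smult[OF V] by simp
qed

lemma hom_comp:
  assumes "g \<in> module_hom CC U V" "h \<in> module_hom CC V W"
  shows "(\<lambda>u. h (g u)) \<in> module_hom CC U W"
  using assms by (intro homI) (simp_all add: hom_closed hom_add hom_smult)

lemma hom_zero:
  assumes "vectorspace CC V" "vectorspace CC W" "h \<in> module_hom CC V W"
  shows "h \<zero>\<^bsub>V\<^esub> = \<zero>\<^bsub>W\<^esub>"
  using hom_smult[OF assms(3) vs_zero[OF assms(1)], of 0]
  by (simp add: vs_smult_zero assms vs_zero hom_closed[OF assms(3)])

lemma hom_finsum:
  assumes V: "vectorspace CC V" and W: "vectorspace CC W" and h: "h \<in> module_hom CC V W"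
    and g: "\<And>i. i \<in> I \<Longrightarrow> g i \<in> carrier V"
  shows "h (finsum V g I) = finsum W (\<lambda>i. h (g i)) I"
proof -
  interpret V: vectorspace CC V by fact
  interpret W: vectorspace CC W by fact
  show ?thesis
    using g
  proof (induction I rule: infinite_finite_induct)
    case (infinite A)
    then show ?case by (simp add: V.M.finsum_infinite W.M.finsum_infinite hom_zero[OF V W h])
  next
    case empty
    then show ?case by (simp add: hom_zero[OF V W h])
  next
    case (insert x F)
    then have "finsum V g (insert x F) = g x \<oplus>\<^bsub>V\<^esub> finsum V g F"
      by (subst V.M.finsum_insert) auto
    moreover have "finsum W (\<lambda>i. h (g i)) (insert x F) = h (g x) \<oplus>\<^bsub>W\<^esub> finsum W (\<lambda>i. h (g i)) F"
      using insert hom_closed[OF h] by (subst W.M.finsum_insert) auto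
    moreover have "finsum V g F \<in> carrier V"
      using insert by (intro vs_finsum[OF V]) auto
    ultimately show ?case using insert hom_add[OF h] by simp
  qed
qed

abbreviation dual :: "(complex, 'v) module \<Rightarrow> ('v \<Rightarrow> complex) set" where
  "dual V \<equiv> module_hom CC V CC_mod"

lemma dual_add: "f \<in> dual V \<Longrightarrow> v \<in> carrier V \<Longrightarrow> w \<in> carrier V \<Longrightarrow> f (v \<oplus>\<^bsub>V\<^esub> w) = f v + f w"
  using hom_add[of f V CC_mod] by (simp add: CC_mod_def)

lemma dual_smult: "f \<in> dual V \<Longrightarrow> v \<in> carrier V \<Longrightarrow> f (c \<odot>\<^bsub>V\<^esub> v) = c * f v"
  using hom_smult[of f V CC_mod] by (simp add: CC_mod_def)

lemma dual_zero: "vectorspace CC V \<Longrightarrow> f \<in> dual V \<Longrightarrow> f \<zero>\<^bsub>V\<^esub> = 0"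
  using hom_zero[of V CC_mod f] vectorspace_CC_mod by (simp add: CC_mod_def)

lemma dual_finsum:
  "vectorspace CC V \<Longrightarrow> f \<in> dual V \<Longrightarrow> (\<And>i. i \<in> I \<Longrightarrow> g i \<in> carrier V) \<Longrightarrow>
     f (finsum V g I) = (\<Sum>i\<in>I. f (g i))"
  using hom_finsum[of V CC_mod f I g] vectorspace_CC_mod by (simp add: finsum_CC_mod)

lemma dualI:
  assumes "\<And>v w. v \<in> carrier V \<Longrightarrow> w \<in> carrier V \<Longrightarrow> f (v \<oplus>\<^bsub>V\<^esub> w) = f v + f w"
    and "\<And>c v. v \<in> carrier V \<Longrightarrow> f (c \<odot>\<^bsub>V\<^esub> v) = c * f v"
  shows "f \<in> dual V"
  using assms by (intro homI) (auto simp: CC_mod_def)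

lemma fd_vs: "fd_vectorspace V \<Longrightarrow> vectorspace CC V"
  by (simp add: fd_vectorspace_def)

text \<open>
  The dual basis of a finite basis \<open>B\<close>, indexed by \<open>B\<close> itself.
\<close>

lemma fd_coordinates:
  assumes "fd_vectorspace V"
  obtains B f where "finite B" "B \<subseteq> carrier V" "\<And>b. b \<in> B \<Longrightarrow> f b \<in> dual V"
    "\<And>v. v \<in> carrier V \<Longrightarrow> v = (\<Oplus>\<^bsub>V\<^esub>b\<in>B. f b v \<odot>\<^bsub>V\<^esub> b)"
proof -
  have V: "vectorspace CC V" by (rule fd_vs[OF assms])
  interpret vectorspace CC V by (rule V)
  have "fin_dim" using assms by (simp add: fd_vectorspace_def)
  then obtain B where B: "finite B" "basis B" using finite_basis_exists by blast
  then have BV: "B \<subseteq> carrier V" by (simp add: basis_def)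
  have ex: "\<exists>!a. a \<in> B \<rightarrow>\<^sub>E UNIV \<and> lincomb a B = v" if "v \<in> carrier V" for v
    using basis_criterion[OF B(1) BV] B(2) that by simp
  define c where "c v = (THE a. a \<in> B \<rightarrow>\<^sub>E UNIV \<and> lincomb a B = v)" for v
  have c: "c v \<in> B \<rightarrow>\<^sub>E UNIV" "lincomb (c v) B = v" if "v \<in> carrier V" for v
    using theI'[OF ex[OF that]] by (auto simp: c_def)
  have eq: "a b = c v b" if "b \<in> B" "lincomb a B = v" "v \<in> carrier V" for a b v
  proof -
    have "lincomb (restrict a B) B = lincomb a B"
      by (rule lincomb_cong) (use BV in auto)
    then have "restrict a B = c v"
      using ex[OF that(3)] c[OF that(3)] that by auto
    then show ?thesis using that(1) by (metis restrict_apply')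
  qed
  show thesis
  proof
    show "finite B" "B \<subseteq> carrier V" by fact+
    show "v = (\<Oplus>\<^bsub>V\<^esub>b\<in>B. c v b \<odot>\<^bsub>V\<^esub> b)" if "v \<in> carrier V" for v
      using c(2)[OF that] by (simp add: lincomb_def)
    show "(\<lambda>v. c v b) \<in> dual V" if b: "b \<in> B" for b
    proof (rule dualI)
      fix v w assume vw: "v \<in> carrier V" "w \<in> carrier V"
      have "lincomb (\<lambda>b. c v b + c w b) B = lincomb (c v) B \<oplus>\<^bsub>V\<^esub> lincomb (c w) B"
        using lincomb_sum[OF B(1) BV, of "c v" "c w"] by simp
      then show "c (v \<oplus>\<^bsub>V\<^esub> w) b = c v b + c w b"
        using eq[OF b, of "\<lambda>b. c v b + c w b" "v \<oplus>\<^bsub>V\<^esub> w"] c(2) vw by simp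
    next
      fix k v assume v: "v \<in> carrier V"
      have "lincomb (\<lambda>b. k * c v b) B = k \<odot>\<^bsub>V\<^esub> lincomb (c v) B"
        using lincomb_smult[OF BV, of "c v" k] by simp
      then show "c (k \<odot>\<^bsub>V\<^esub> v) b = k * c v b"
        using eq[OF b, of "\<lambda>b. k * c v b" "k \<odot>\<^bsub>V\<^esub> v"] c(2) v vs_smult[OF V v] by simp
    qed
  qed
qed

text \<open>
  Functionals separate points, since the coordinates with respect to a basis are functionals.
\<close>

lemma dual_ext:
  assumes "fd_vectorspace V" "v \<in> carrier V" "w \<in> carrier V" "\<And>f. f \<in> dual V \<Longrightarrow> f v = f w"
  shows "v = w"
proof -
  obtain B f where B: "finite B" "B \<subseteq> carrier V" "\<And>b. b \<in> B \<Longrightarrow> f b \<in> dual V"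
    "\<And>v. v \<in> carrier V \<Longrightarrow> v = (\<Oplus>\<^bsub>V\<^esub>b\<in>B. f b v \<odot>\<^bsub>V\<^esub> b)"
    by (rule fd_coordinates[OF assms(1)]) blast
  interpret vectorspace CC V by (rule fd_vs[OF assms(1)])
  have "(\<Oplus>\<^bsub>V\<^esub>b\<in>B. f b v \<odot>\<^bsub>V\<^esub> b) = (\<Oplus>\<^bsub>V\<^esub>b\<in>B. f b w \<odot>\<^bsub>V\<^esub> b)"
    using B(2) vs_smult[OF fd_vs[OF assms(1)]] assms(4)[OF B(3)]
    by (intro M.finsum_cong') auto
  then show ?thesis using B(4) assms by metis
qed

lemma submodule_finsum:
  assumes V: "vectorspace CC V" and N: "submodule CC N V" and g: "\<And>i. i \<in> I \<Longrightarrow> g i \<in> N"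
  shows "finsum V g I \<in> N"
proof -
  interpret vectorspace CC V by (rule V)
  have NV: "N \<subseteq> carrier V" using submodule.subset[OF N] .
  have z: "\<zero>\<^bsub>V\<^esub> \<in> N" using submodule.zero_closed[OF N] by simp
  show ?thesis using g
  proof (induction I rule: infinite_finite_induct)
    case (insert x F)
    moreover have "finsum V g (insert x F) = g x \<oplus>\<^bsub>V\<^esub> finsum V g F"
      using insert NV by (subst M.finsum_insert) auto
    ultimately show ?case using submodule.m_closed[OF N] by simp
  qed (simp_all add: M.finsum_infinite z)
qed

text \<open>
  To check that \<open>S\<close> spans it suffices to look at the submodules containing \<open>S\<close>, the span being one
  of them; so no explicit linear combinations are needed.
\<close>

lemma fdI:
  assumes V: "vectorspace CC V" and S: "finite S" "S \<subseteq> carrier V"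
    and gen: "\<And>v N. v \<in> carrier V \<Longrightarrow> submodule CC N V \<Longrightarrow> S \<subseteq> N \<Longrightarrow> v \<in> N"
  shows "fd_vectorspace V"
proof -
  interpret vectorspace CC V by (rule V)
  have "v \<in> span S" if "v \<in> carrier V" for v
    using gen[OF that span_is_submodule[OF S(2)]] in_own_span[OF S(2)] by auto
  then have "gen_set S" using span_is_subset2[OF S(2)] by auto
  then have fin_dim unfolding fin_dim_def using S by blast
  then show ?thesis using V by (simp add: fd_vectorspace_def)
qed

text \<open>
  The image of a finite generating set generates the image.
\<close>

lemma fd_surj:
  assumes V: "fd_vectorspace V" and W: "vectorspace CC W" and h: "h \<in> module_hom CC V W"
    and surj: "carrier W \<subseteq> h ` carrier V"
  shows "fd_vectorspace W"
proof -
  obtain B f where B: "finite B" "B \<subseteq> carrier V" "\<And>b. b \<in> B \<Longrightarrow> f b \<in> dual V"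
    "\<And>v. v \<in> carrier V \<Longrightarrow> v = (\<Oplus>\<^bsub>V\<^esub>b\<in>B. f b v \<odot>\<^bsub>V\<^esub> b)"
    by (rule fd_coordinates[OF V]) blast
  interpret W: vectorspace CC W by (rule W)
  define g where "g w = (SOME v. v \<in> carrier V \<and> h v = w)" for w
  have g: "g w \<in> carrier V \<and> h (g w) = w" if "w \<in> carrier W" for w
    unfolding g_def by (rule someI_ex) (use surj that in auto)
  show ?thesis
  proof (rule fdI[OF W, of "h ` B"])
    show "finite (h ` B)" using B(1) by simp
    show "h ` B \<subseteq> carrier W" using B(2) hom_closed[OF h] by auto
    fix w N assume w: "w \<in> carrier W" and N: "submodule CC N W" "h ` B \<subseteq> N"
    have "w = h (g w)" using g[OF w] by simp
    also have "\<dots> = h (\<Oplus>\<^bsub>V\<^esub>b\<in>B. f b (g w) \<odot>\<^bsub>V\<^esub> b)" using B(4) g[OF w] by metis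
    also have "\<dots> = (\<Oplus>\<^bsub>W\<^esub>b\<in>B. h (f b (g w) \<odot>\<^bsub>V\<^esub> b))"
      using B(2) by (intro hom_finsum[OF fd_vs[OF V] W h] vs_smult[OF fd_vs[OF V]]) auto
    also have "\<dots> \<in> N"
    proof (rule submodule_finsum[OF W N(1)])
      fix b assume "b \<in> B"
      then have "b \<in> carrier V" "h b \<in> N" using B(2) N(2) by auto
      then show "h (f b (g w) \<odot>\<^bsub>V\<^esub> b) \<in> N"
        using submodule.smult_closed[OF N(1)] by (simp add: hom_smult[OF h])
    qed
    finally show "w \<in> N" .
  qed
qed

lemma finsum_single:
  assumes W: "vectorspace CC W" and I: "finite I" "y \<in> I" and c: "g y \<in> carrier W"
    and zero: "\<And>x. x \<in> I \<Longrightarrow> x \<noteq> y \<Longrightarrow> g x = \<zero>\<^bsub>W\<^esub>"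
  shows "finsum W g I = g y"
proof -
  interpret W: vectorspace CC W by (rule W)
  have "finsum W g I = (\<Oplus>\<^bsub>W\<^esub>x\<in>I. if y = x then g y else \<zero>\<^bsub>W\<^esub>)"
    using zero c by (intro W.M.finsum_cong') auto
  also have "\<dots> = g y" using W.M.finsum_singleton[OF I(2,1), of "\<lambda>_. g y"] c by simp
  finally show ?thesis .
qed

definition coord_inj :: "'x set \<Rightarrow> ('x \<Rightarrow> (complex, 'v) module) \<Rightarrow> 'x \<Rightarrow> 'v \<Rightarrow> 'x \<Rightarrow> 'v" where
  "coord_inj I M x v = (\<lambda>y\<in>I. if y = x then v else \<zero>\<^bsub>M y\<^esub>)"

lemma carrier_direct_sum: "carrier (direct_sum_fam I M) = (\<Pi>\<^sub>E x\<in>I. carrier (M x))"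
  and add_direct_sum: "v \<oplus>\<^bsub>direct_sum_fam I M\<^esub> w = (\<lambda>x\<in>I. v x \<oplus>\<^bsub>M x\<^esub> w x)"
  and smult_direct_sum: "c \<odot>\<^bsub>direct_sum_fam I M\<^esub> v = (\<lambda>x\<in>I. c \<odot>\<^bsub>M x\<^esub> v x)"
  and zero_direct_sum: "\<zero>\<^bsub>direct_sum_fam I M\<^esub> = (\<lambda>x\<in>I. \<zero>\<^bsub>M x\<^esub>)"
  by (simp_all add: direct_sum_fam_def)

lemmas direct_sum_simps = carrier_direct_sum add_direct_sum smult_direct_sum zero_direct_sum

lemma direct_sum_vs:
  assumes "\<And>x. x \<in> I \<Longrightarrow> vectorspace CC (M x)"
  shows "vectorspace CC (direct_sum_fam I M)"
proof (rule vectorspaceI)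
  fix v w assume "v \<in> carrier (direct_sum_fam I M)" "w \<in> carrier (direct_sum_fam I M)"
  then show "v \<oplus>\<^bsub>direct_sum_fam I M\<^esub> w = w \<oplus>\<^bsub>direct_sum_fam I M\<^esub> v"
    by (auto simp: direct_sum_simps fun_eq_iff intro: vs_add_comm[OF assms])
next
  have in_carrier: "v x \<in> carrier (M x)" if "v \<in> (\<Pi>\<^sub>E x\<in>I. carrier (M x))" "x \<in> I" for v x
    using that by auto
  have eqI: "v = w" if "v \<in> (\<Pi>\<^sub>E x\<in>I. carrier (M x))" "w \<in> (\<Pi>\<^sub>E x\<in>I. carrier (M x))"
    "\<And>x. x \<in> I \<Longrightarrow> v x = w x" for v w using that by (intro PiE_ext)
  note closed = in_carrier vs_zero[OF assms] vs_add[OF assms] vs_smult[OF assms]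
  note laws = vs_add_zero[OF assms] vs_add_assoc[OF assms] vs_add_neg[OF assms]
    vs_smult_one[OF assms] vs_smult_ldistr[OF assms] vs_smult_rdistr[OF assms]
  let ?D = "direct_sum_fam I M"
  show "\<zero>\<^bsub>?D\<^esub> \<in> carrier ?D" by (simp add: direct_sum_simps closed)
  show "v \<oplus>\<^bsub>?D\<^esub> w \<in> carrier ?D" if "v \<in> carrier ?D" "w \<in> carrier ?D" for v w
    using that by (simp add: direct_sum_simps closed)
  show "c \<odot>\<^bsub>?D\<^esub> v \<in> carrier ?D" if "v \<in> carrier ?D" for c v
    using that by (simp add: direct_sum_simps closed)
  show "u \<oplus>\<^bsub>?D\<^esub> v \<oplus>\<^bsub>?D\<^esub> w = u \<oplus>\<^bsub>?D\<^esub> (v \<oplus>\<^bsub>?D\<^esub> w)"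
    if "u \<in> carrier ?D" "v \<in> carrier ?D" "w \<in> carrier ?D" for u v w
    using that by (intro eqI) (simp_all add: direct_sum_simps closed laws)
  show "v \<oplus>\<^bsub>?D\<^esub> \<zero>\<^bsub>?D\<^esub> = v" if "v \<in> carrier ?D" for v
    using that by (intro eqI) (simp_all add: direct_sum_simps closed laws)
  show "v \<oplus>\<^bsub>?D\<^esub> - 1 \<odot>\<^bsub>?D\<^esub> v = \<zero>\<^bsub>?D\<^esub>" if "v \<in> carrier ?D" for v
    using that by (intro eqI) (simp_all add: direct_sum_simps closed laws)
  show "(a * b) \<odot>\<^bsub>?D\<^esub> v = a \<odot>\<^bsub>?D\<^esub> (b \<odot>\<^bsub>?D\<^esub> v)" if "v \<in> carrier ?D" for a b v
    using that by (intro eqI) (simp_all add: direct_sum_simps closed vs_smult_assoc[OF assms])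
  show "1 \<odot>\<^bsub>?D\<^esub> v = v" if "v \<in> carrier ?D" for v
    using that by (intro eqI) (simp_all add: direct_sum_simps closed laws)
  show "(a + b) \<odot>\<^bsub>?D\<^esub> v = a \<odot>\<^bsub>?D\<^esub> v \<oplus>\<^bsub>?D\<^esub> b \<odot>\<^bsub>?D\<^esub> v" if "v \<in> carrier ?D" for a b v
    using that by (intro eqI) (simp_all add: direct_sum_simps closed laws)
  show "a \<odot>\<^bsub>?D\<^esub> (v \<oplus>\<^bsub>?D\<^esub> w) = a \<odot>\<^bsub>?D\<^esub> v \<oplus>\<^bsub>?D\<^esub> a \<odot>\<^bsub>?D\<^esub> w"
    if "v \<in> carrier ?D" "w \<in> carrier ?D" for a v w
    using that by (intro eqI) (simp_all add: direct_sum_simps closed laws)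
qed

lemma coord_hom: "x \<in> I \<Longrightarrow> (\<lambda>v. v x) \<in> module_hom CC (direct_sum_fam I M) (M x)"
  by (rule homI) (auto simp: direct_sum_simps)

lemma coord_inj_hom:
  assumes "\<And>x. x \<in> I \<Longrightarrow> vectorspace CC (M x)" "x \<in> I"
  shows "coord_inj I M x \<in> module_hom CC (M x) (direct_sum_fam I M)"
  by (rule homI) (use assms in \<open>auto simp: direct_sum_simps coord_inj_def fun_eq_iff vs_zero vs_add_zero
      vs_smult_of_zero\<close>)

lemma coord_inj_apply: "y \<in> I \<Longrightarrow> coord_inj I M x v y = (if y = x then v else \<zero>\<^bsub>M y\<^esub>)"
  by (simp add: coord_inj_def)

lemma direct_sum_decomp:
  assumes M: "\<And>x. x \<in> I \<Longrightarrow> vectorspace CC (M x)" and I: "finite I"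
    and v: "v \<in> carrier (direct_sum_fam I M)"
  shows "v = (\<Oplus>\<^bsub>direct_sum_fam I M\<^esub>x\<in>I. coord_inj I M x (v x))"
proof -
  let ?D = "direct_sum_fam I M"
  have D: "vectorspace CC ?D" by (rule direct_sum_vs[OF M])
  have vx: "v x \<in> carrier (M x)" if "x \<in> I" for x using v that by (auto simp: direct_sum_simps)
  have c: "coord_inj I M x (v x) \<in> carrier ?D" if "x \<in> I" for x
    using hom_closed[OF coord_inj_hom[of I M x, OF M that] vx[OF that]] that by blast
  let ?s = "\<Oplus>\<^bsub>?D\<^esub>x\<in>I. coord_inj I M x (v x)"
  have s: "?s \<in> carrier ?D" by (rule vs_finsum[OF D c])
  have "v y = ?s y" if y: "y \<in> I" for y
  proof -
    have "?s y = (\<Oplus>\<^bsub>M y\<^esub>x\<in>I. coord_inj I M x (v x) y)"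
      by (rule hom_finsum[OF D M[OF y] coord_hom[OF y] c])
    also have "\<dots> = coord_inj I M y (v y) y"
      by (rule finsum_single[OF M[OF y] I y]) (use y vx in \<open>auto simp: coord_inj_apply\<close>)
    also have "\<dots> = v y" using y by (simp add: coord_inj_apply)
    finally show ?thesis by simp
  qed
  then show ?thesis using v s unfolding carrier_direct_sum by (intro PiE_ext)
qed

text \<open>
  The bases of the summands together generate the direct sum.
\<close>

lemma direct_sum_fd:
  assumes M: "\<And>x. x \<in> I \<Longrightarrow> fd_vectorspace (M x)" and I: "finite I"
  shows "fd_vectorspace (direct_sum_fam I M)"
proof -
  let ?D = "direct_sum_fam I M"
  have Mv: "\<And>x. x \<in> I \<Longrightarrow> vectorspace CC (M x)" using M fd_vs by blast
  have D: "vectorspace CC ?D" by (rule direct_sum_vs[OF Mv])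
  have "\<exists>B. finite B \<and> B \<subseteq> carrier (M x) \<and> (\<exists>f. \<forall>v\<in>carrier (M x). v = (\<Oplus>\<^bsub>M x\<^esub>b\<in>B. f b v \<odot>\<^bsub>M x\<^esub> b))"
    if "x \<in> I" for x
    by (rule fd_coordinates[OF M[OF that]]) blast
  then obtain B where B: "\<And>x. x \<in> I \<Longrightarrow> finite (B x)" "\<And>x. x \<in> I \<Longrightarrow> B x \<subseteq> carrier (M x)"
    "\<And>x. x \<in> I \<Longrightarrow> \<exists>f. \<forall>v\<in>carrier (M x). v = (\<Oplus>\<^bsub>M x\<^esub>b\<in>B x. f b v \<odot>\<^bsub>M x\<^esub> b)"
    by (metis (no_types))
  show ?thesis
  proof (rule fdI[OF D, of "\<Union>x\<in>I. coord_inj I M x ` B x"])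
    show "finite (\<Union>x\<in>I. coord_inj I M x ` B x)" using I B(1) by auto
    show "(\<Union>x\<in>I. coord_inj I M x ` B x) \<subseteq> carrier ?D"
      using B(2) hom_closed[OF coord_inj_hom[of I M, OF Mv]] by blast
    fix v N assume v: "v \<in> carrier ?D" and N: "submodule CC N ?D"
      and sub: "(\<Union>x\<in>I. coord_inj I M x ` B x) \<subseteq> N"
    have "coord_inj I M x (v x) \<in> N" if x: "x \<in> I" for x
    proof -
      let ?i = "coord_inj I M x"
      have i: "?i \<in> module_hom CC (M x) ?D" using coord_inj_hom[of I M x] Mv x by blast
      have vx: "v x \<in> carrier (M x)" using v x by (auto simp: direct_sum_simps)
      obtain f where f: "\<And>v. v \<in> carrier (M x) \<Longrightarrow> v = (\<Oplus>\<^bsub>M x\<^esub>b\<in>B x. f b v \<odot>\<^bsub>M x\<^esub> b)"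
        using B(3)[OF x] by blast
      have "?i (v x) = ?i (\<Oplus>\<^bsub>M x\<^esub>b\<in>B x. f b (v x) \<odot>\<^bsub>M x\<^esub> b)" using f[OF vx] by simp
      also have "\<dots> = (\<Oplus>\<^bsub>?D\<^esub>b\<in>B x. ?i (f b (v x) \<odot>\<^bsub>M x\<^esub> b))"
        using B(2)[OF x] by (intro hom_finsum[OF Mv[OF x] D i] vs_smult[OF Mv[OF x]]) auto
      also have "\<dots> \<in> N"
      proof (rule submodule_finsum[OF D N])
        fix b assume b: "b \<in> B x"
        then have "b \<in> carrier (M x)" "?i b \<in> N" using B(2)[OF x] sub x by auto
        then show "?i (f b (v x) \<odot>\<^bsub>M x\<^esub> b) \<in> N"
          using submodule.smult_closed[OF N] by (simp add: hom_smult[OF i])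
      qed
      finally show ?thesis .
    qed
    then have "(\<Oplus>\<^bsub>?D\<^esub>x\<in>I. coord_inj I M x (v x)) \<in> N"
      by (rule submodule_finsum[OF D N])
    then show "v \<in> N" using direct_sum_decomp[of I M v] Mv I v by simp
  qed
qed

text \<open>
  The vector space structure for which the injection \<open>\<beta>\<close> becomes an isomorphism onto its range.
\<close>

definition transport :: "(complex, 'u) module \<Rightarrow> ('u \<Rightarrow> 'v) \<Rightarrow> (complex, 'v) module" where
  "transport V \<beta> =
     (let r = inv_into (carrier V) \<beta> in
     \<lparr>carrier = \<beta> ` carrier V,
      mult = (\<lambda>v w. \<beta> \<zero>\<^bsub>V\<^esub>), one = \<beta> \<zero>\<^bsub>V\<^esub>, zero = \<beta> \<zero>\<^bsub>V\<^esub>,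
      add = (\<lambda>v w. \<beta> (r v \<oplus>\<^bsub>V\<^esub> r w)),
      smult = (\<lambda>c v. \<beta> (c \<odot>\<^bsub>V\<^esub> r v))\<rparr>)"

lemma transport_vs:
  assumes V: "vectorspace CC V" and inj: "inj_on \<beta> (carrier V)"
  shows "vectorspace CC (transport V \<beta>)"
    and "\<beta> \<in> module_hom CC V (transport V \<beta>)"
    and "inv_into (carrier V) \<beta> \<in> module_hom CC (transport V \<beta>) V"
proof -
  have r: "inv_into (carrier V) \<beta> (\<beta> v) = v" if "v \<in> carrier V" for v using inj that by simp
  note laws = transport_def Let_def r vs_closed[OF V] vs_add_zero[OF V] vs_add_neg[OF V]
    vs_smult_one[OF V] vs_smult_ldistr[OF V] vs_smult_rdistr[OF V]
  show "vectorspace CC (transport V \<beta>)"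
  proof (rule vectorspaceI)
    fix v w assume "v \<in> carrier (transport V \<beta>)" "w \<in> carrier (transport V \<beta>)"
    then show "v \<oplus>\<^bsub>transport V \<beta>\<^esub> w = w \<oplus>\<^bsub>transport V \<beta>\<^esub> v"
      using vs_add_comm[OF V] by (auto simp: transport_def Let_def r)
  next
    fix u v w
    assume "u \<in> carrier (transport V \<beta>)" "v \<in> carrier (transport V \<beta>)" "w \<in> carrier (transport V \<beta>)"
    then show "u \<oplus>\<^bsub>transport V \<beta>\<^esub> v \<oplus>\<^bsub>transport V \<beta>\<^esub> w =
        u \<oplus>\<^bsub>transport V \<beta>\<^esub> (v \<oplus>\<^bsub>transport V \<beta>\<^esub> w)"
      using vs_add_assoc[OF V] by (auto simp: transport_def Let_def r vs_add[OF V])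
  next
    fix a b v assume "v \<in> carrier (transport V \<beta>)"
    then show "(a * b) \<odot>\<^bsub>transport V \<beta>\<^esub> v = a \<odot>\<^bsub>transport V \<beta>\<^esub> (b \<odot>\<^bsub>transport V \<beta>\<^esub> v)"
      using vs_smult_assoc[OF V] by (auto simp: transport_def Let_def r vs_smult[OF V])
  qed (auto simp: laws)
  show "\<beta> \<in> module_hom CC V (transport V \<beta>)"
    by (rule homI) (auto simp: transport_def Let_def r vs_closed[OF V])
  show "inv_into (carrier V) \<beta> \<in> module_hom CC (transport V \<beta>) V"
    by (rule homI) (auto simp: transport_def Let_def r vs_closed[OF V])
qed

text \<open>
  An endomorphism with smaller codomain: when \<open>h\<close> is idempotent this is the splitting of \<open>h\<close> through
  the subspace that it projects onto.
\<close>

lemma image_vs: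
  assumes V: "fd_vectorspace V" and h: "h \<in> module_hom CC V V"
  shows image_fd: "fd_vectorspace (V\<lparr>carrier := h ` carrier V\<rparr>)"
    and image_hom: "h \<in> module_hom CC V (V\<lparr>carrier := h ` carrier V\<rparr>)"
    and image_inclusion: "(\<lambda>w. w) \<in> module_hom CC (V\<lparr>carrier := h ` carrier V\<rparr>) V"
proof -
  let ?W = "V\<lparr>carrier := h ` carrier V\<rparr>"
  note Vv = fd_vs[OF V]
  have sub: "w \<in> carrier V" if "w \<in> carrier ?W" for w using that hom_closed[OF h] by auto
  have add: "v \<oplus>\<^bsub>V\<^esub> w \<in> h ` carrier V" if "v \<in> h ` carrier V" "w \<in> h ` carrier V" for v w
    using that by (auto simp: hom_add[OF h, symmetric] vs_add[OF Vv])
  have smult: "c \<odot>\<^bsub>V\<^esub> w \<in> h ` carrier V" if "w \<in> h ` carrier V" for c w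
    using that by (auto simp: hom_smult[OF h, symmetric] vs_smult[OF Vv])
  have W: "vectorspace CC ?W"
  proof (rule vectorspaceI)
    show "\<zero>\<^bsub>?W\<^esub> \<in> carrier ?W"
      using imageI[OF vs_zero[OF Vv], of h] by (simp add: hom_zero[OF Vv Vv h])
    show "v \<oplus>\<^bsub>?W\<^esub> w = w \<oplus>\<^bsub>?W\<^esub> v" if "v \<in> carrier ?W" "w \<in> carrier ?W" for v w
      using vs_add_comm[OF Vv sub[OF that(1)] sub[OF that(2)]] by simp
    show "u \<oplus>\<^bsub>?W\<^esub> v \<oplus>\<^bsub>?W\<^esub> w = u \<oplus>\<^bsub>?W\<^esub> (v \<oplus>\<^bsub>?W\<^esub> w)"
      if "u \<in> carrier ?W" "v \<in> carrier ?W" "w \<in> carrier ?W" for u v w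
      using vs_add_assoc[OF Vv sub[OF that(1)] sub[OF that(2)] sub[OF that(3)]] by simp
    show "v \<oplus>\<^bsub>?W\<^esub> \<zero>\<^bsub>?W\<^esub> = v" "v \<oplus>\<^bsub>?W\<^esub> - 1 \<odot>\<^bsub>?W\<^esub> v = \<zero>\<^bsub>?W\<^esub>" "1 \<odot>\<^bsub>?W\<^esub> v = v"
      if "v \<in> carrier ?W" for v
      using vs_add_zero[OF Vv sub[OF that]] vs_add_neg[OF Vv sub[OF that]]
        vs_smult_one[OF Vv sub[OF that]] by simp_all
    show "(a * b) \<odot>\<^bsub>?W\<^esub> v = a \<odot>\<^bsub>?W\<^esub> (b \<odot>\<^bsub>?W\<^esub> v)" if "v \<in> carrier ?W" for a b v
      using vs_smult_assoc[OF Vv sub[OF that], of a b] by simp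
    show "(a + b) \<odot>\<^bsub>?W\<^esub> v = a \<odot>\<^bsub>?W\<^esub> v \<oplus>\<^bsub>?W\<^esub> b \<odot>\<^bsub>?W\<^esub> v" if "v \<in> carrier ?W" for a b v
      using vs_smult_ldistr[OF Vv sub[OF that], of a b] by simp
    show "a \<odot>\<^bsub>?W\<^esub> (v \<oplus>\<^bsub>?W\<^esub> w) = a \<odot>\<^bsub>?W\<^esub> v \<oplus>\<^bsub>?W\<^esub> a \<odot>\<^bsub>?W\<^esub> w"
      if "v \<in> carrier ?W" "w \<in> carrier ?W" for a v w
      using vs_smult_rdistr[OF Vv sub[OF that(1)] sub[OF that(2)], of a] by simp
  qed (use add smult in auto)
  show hW: "h \<in> module_hom CC V ?W"
    by (rule homI) (auto simp: hom_add[OF h] hom_smult[OF h])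
  show "fd_vectorspace ?W" by (rule fd_surj[OF V W hW]) simp
  show "(\<lambda>w. w) \<in> module_hom CC ?W V" by (rule homI) (use sub in auto)
qed

text \<open>
  Induction on the index set, absorbing one factor at a time by an injection \<open>'v \<times> 'v \<rightarrow> 'v\<close>.
\<close>

lemma infinite_product_inj:
  assumes inf: "infinite (UNIV :: 'v set)" and I: "finite I"
  shows "\<exists>\<beta> :: ('x \<Rightarrow> 'v) \<Rightarrow> 'v. inj_on \<beta> (Pi\<^sub>E I F)"
  using I
proof induction
  case empty
  show ?case by (auto simp: inj_on_def)
next
  case (insert x I)
  then obtain \<beta> :: "('x \<Rightarrow> 'v) \<Rightarrow> 'v" where \<beta>: "inj_on \<beta> (Pi\<^sub>E I F)" by blast
  obtain p :: "'v \<times> 'v \<Rightarrow> 'v" where p: "inj p"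
    using card_of_Times_same_infinite[OF inf] unfolding card_of_ordIso[symmetric]
    by (auto simp: bij_betw_def)
  have "inj_on (\<lambda>v. p (v x, \<beta> (restrict v I))) (Pi\<^sub>E (insert x I) F)"
  proof (rule inj_onI)
    fix v w assume v: "v \<in> Pi\<^sub>E (insert x I) F" and w: "w \<in> Pi\<^sub>E (insert x I) F"
      and eq: "p (v x, \<beta> (restrict v I)) = p (w x, \<beta> (restrict w I))"
    then have x: "v x = w x" and "\<beta> (restrict v I) = \<beta> (restrict w I)" using p by (auto dest: injD)
    moreover have "restrict v I \<in> Pi\<^sub>E I F" "restrict w I \<in> Pi\<^sub>E I F" using v w by auto
    ultimately have "restrict v I = restrict w I" using \<beta> unfolding inj_on_def by blast
    then have "v y = w y" if "y \<in> I" for y using that by (metis restrict_apply')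
    then show "v = w" using v w x by (auto intro: PiE_ext)
  qed
  then show ?case by blast
qed

text \<open>
  A nonzero vector has as many multiples as there are complex numbers.
\<close>

lemma finite_vectorspace_trivial:
  assumes V: "vectorspace CC V" and fin: "finite (carrier V)" and v: "v \<in> carrier V"
  shows "v = \<zero>\<^bsub>V\<^esub>"
proof (rule ccontr)
  assume nz: "v \<noteq> \<zero>\<^bsub>V\<^esub>"
  have "inj (\<lambda>c. c \<odot>\<^bsub>V\<^esub> v)"
  proof (rule injI, rule ccontr)
    fix c d assume eq: "c \<odot>\<^bsub>V\<^esub> v = d \<odot>\<^bsub>V\<^esub> v" and ne: "c \<noteq> d"
    have "(c - d) \<odot>\<^bsub>V\<^esub> v = c \<odot>\<^bsub>V\<^esub> v \<oplus>\<^bsub>V\<^esub> (- 1 * d) \<odot>\<^bsub>V\<^esub> v"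
      using vs_smult_ldistr[OF V v, of c "- d"] by simp
    also have "\<dots> = d \<odot>\<^bsub>V\<^esub> v \<oplus>\<^bsub>V\<^esub> - 1 \<odot>\<^bsub>V\<^esub> (d \<odot>\<^bsub>V\<^esub> v)"
      unfolding eq vs_smult_assoc[OF V v] ..
    also have "\<dots> = \<zero>\<^bsub>V\<^esub>" by (rule vs_add_neg[OF V vs_smult[OF V v]])
    finally have "inverse (c - d) \<odot>\<^bsub>V\<^esub> ((c - d) \<odot>\<^bsub>V\<^esub> v) = \<zero>\<^bsub>V\<^esub>"
      by (simp add: vs_smult_of_zero[OF V])
    then have "v = \<zero>\<^bsub>V\<^esub>"
      using ne by (simp add: vs_smult_assoc[OF V v, symmetric] vs_smult_one[OF V v])
    then show False using nz by simp
  qed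
  moreover have "range (\<lambda>c. c \<odot>\<^bsub>V\<^esub> v) \<subseteq> carrier V" using vs_smult[OF V v] by auto
  ultimately have "finite (UNIV :: complex set)" using fin finite_imageD finite_subset by blast
  then show False using infinite_UNIV_char_0 by blast
qed

text \<open>
  Finite direct sums of spaces inside a type \<open>'v\<close> fit into \<open>'v\<close> again. This is what allows the direct
  sum of a representation to be an object of the same category of modules.
\<close>

lemma direct_sum_inj:
  fixes M :: "'x \<Rightarrow> (complex, 'v) module"
  assumes M: "\<And>x. x \<in> I \<Longrightarrow> vectorspace CC (M x)" and I: "finite I"
  shows "\<exists>\<beta> :: ('x \<Rightarrow> 'v) \<Rightarrow> 'v. inj_on \<beta> (carrier (direct_sum_fam I M))"
proof (cases "finite (UNIV :: 'v set)")
  case False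
  then show ?thesis unfolding carrier_direct_sum by (rule infinite_product_inj[OF _ I])
next
  case True
  then have fin: "finite S" for S :: "'v set" by (rule rev_finite_subset) simp
  have "v = w" if v: "v \<in> (\<Pi>\<^sub>E x\<in>I. carrier (M x))" and w: "w \<in> (\<Pi>\<^sub>E x\<in>I. carrier (M x))" for v w
  proof (rule PiE_ext[OF v w])
    fix x assume x: "x \<in> I"
    then show "v x = w x"
      using finite_vectorspace_trivial[OF M[OF x] fin] PiE_mem[OF v x] PiE_mem[OF w x] by metis
  qed
  then show ?thesis unfolding carrier_direct_sum inj_on_def by blast
qed

section \<open>Actions of the multiplicative group as gradings\<close>

text \<open>
  Multiplying a Laurent polynomial by a high power of \<open>z\<close> clears its negative exponents.
\<close>

lemma sum_monom_eq:
  fixes z :: complex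
  assumes S: "finite S" "\<And>i. i \<in> S \<Longrightarrow> - int n \<le> i" and z: "z \<noteq> 0"
  shows "poly (\<Sum>i\<in>S. monom (c i) (nat (i + int n))) z = z ^ n * (\<Sum>i\<in>S. c i * z powi i)"
proof -
  have "poly (\<Sum>i\<in>S. monom (c i) (nat (i + int n))) z = (\<Sum>i\<in>S. c i * z ^ nat (i + int n))"
    by (simp add: poly_sum poly_monom)
  also have "\<dots> = (\<Sum>i\<in>S. z ^ n * (c i * z powi i))"
  proof (rule sum.cong)
    fix i assume "i \<in> S"
    then have "0 \<le> i + int n" using S(2)[of i] by simp
    then have "z ^ nat (i + int n) = z powi (i + int n)" by (simp add: power_int_def)
    also have "\<dots> = z powi i * z ^ n" using z by (simp add: power_int_add)
    finally show "c i * z ^ nat (i + int n) = z ^ n * (c i * z powi i)" by simp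
  qed simp
  finally show ?thesis by (simp add: sum_distrib_left)
qed

lemma int_set_lower_bound:
  assumes "finite (S :: int set)"
  obtains n :: nat where "\<And>i. i \<in> S \<Longrightarrow> - int n \<le> i"
proof -
  obtain b where "\<forall>i\<in>S. b \<le> i"
    using bdd_below_finite[OF assms] by (auto simp: bdd_below_def)
  then have "\<And>i. i \<in> S \<Longrightarrow> - int (nat (- b)) \<le> i" by (smt (verit) int_nat_eq)
  then show thesis by (rule that)
qed

text \<open>
  Once denominators are cleared, this is the fact that a nonzero polynomial has finitely many zeros.
\<close>

lemma laurent_zero:
  fixes c :: "int \<Rightarrow> complex"
  assumes S: "finite S" and eq: "\<And>z. z \<noteq> 0 \<Longrightarrow> (\<Sum>i\<in>S. c i * z powi i) = 0" and k: "k \<in> S"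
  shows "c k = 0"
proof -
  obtain n :: nat where n: "\<And>i. i \<in> S \<Longrightarrow> - int n \<le> i" using int_set_lower_bound[OF S] by blast
  define p where "p = (\<Sum>i\<in>S. monom (c i) (nat (i + int n)))"
  have "poly p z = 0" if "z \<noteq> 0" for z
    using sum_monom_eq[OF S n that, of c] eq[OF that] by (simp add: p_def)
  then have "UNIV - {0} \<subseteq> {z. poly p z = 0}" by auto
  moreover have "infinite (UNIV - {0::complex})" by (simp add: infinite_UNIV_char_0)
  ultimately have "p = 0" using poly_roots_finite[of p] finite_subset by blast
  then have "coeff p (nat (k + int n)) = 0" by simp
  moreover have "coeff p (nat (k + int n)) = (\<Sum>i\<in>S. if i = k then c i else 0)"
    unfolding p_def coeff_sum
  proof (rule sum.cong)
    fix i assume "i \<in> S"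
    then show "coeff (monom (c i) (nat (i + int n))) (nat (k + int n)) = (if i = k then c i else 0)"
      using n[of i] n[OF k] by (auto simp: nat_eq_iff)
  qed simp
  ultimately show ?thesis using S k by simp
qed

definition laurent_rep :: "(complex \<Rightarrow> complex) \<Rightarrow> int set \<Rightarrow> (int \<Rightarrow> complex) \<Rightarrow> bool" where
  "laurent_rep h S c \<longleftrightarrow> finite S \<and> (\<forall>i. i \<notin> S \<longrightarrow> c i = 0) \<and> (\<forall>z. z \<noteq> 0 \<longrightarrow> h z = (\<Sum>i\<in>S. c i * z powi i))"

text \<open>
  The coefficients of a Laurent polynomial, as a function of its values; they are well defined by
  \<open>lcoef_eqI\<close>.
\<close>

definition lcoef :: "(complex \<Rightarrow> complex) \<Rightarrow> int \<Rightarrow> complex" where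
  "lcoef h = (SOME c. \<exists>S. laurent_rep h S c)"

lemma laurent_rep_mono:
  assumes "laurent_rep h S c" "finite S'" "S \<subseteq> S'"
  shows "laurent_rep h S' c"
proof -
  have "(\<Sum>i\<in>S. c i * z powi i) = (\<Sum>i\<in>S'. c i * z powi i)" for z
    by (rule sum.mono_neutral_left) (use assms in \<open>auto simp: laurent_rep_def\<close>)
  then show ?thesis using assms by (auto simp: laurent_rep_def)
qed

lemma lcoef_eqI:
  assumes "laurent_rep h S c"
  shows "lcoef h = c"
proof -
  have "\<exists>S. laurent_rep h S (lcoef h)"
    unfolding lcoef_def by (rule someI_ex[of "\<lambda>c. \<exists>S. laurent_rep h S c"]) (use assms in blast)
  then obtain R where R: "laurent_rep h R (lcoef h)" by blast
  let ?U = "R \<union> S"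
  have U: "laurent_rep h ?U (lcoef h)" "laurent_rep h ?U c"
    using laurent_rep_mono[OF R] laurent_rep_mono[OF assms] assms R by (auto simp: laurent_rep_def)
  show ?thesis
  proof
    fix k
    show "lcoef h k = c k"
    proof (cases "k \<in> ?U")
      case True
      have "lcoef h k - c k = 0"
        by (rule laurent_zero[of ?U])
          (use U True in \<open>auto simp: laurent_rep_def algebra_simps sum_subtractf\<close>)
      then show ?thesis by simp
    qed (use U in \<open>auto simp: laurent_rep_def\<close>)
  qed
qed

lemma regular_on_Gm_iff: "regular_on_Gm h \<longleftrightarrow> (\<exists>S c. laurent_rep h S c)"
proof
  assume "regular_on_Gm h"
  then obtain p n where h: "\<And>z. z \<noteq> 0 \<Longrightarrow> h z = poly p z / z ^ n"
    by (auto simp: regular_on_Gm_def)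
  let ?S = "(\<lambda>k. int k - int n) ` {..degree p}"
  let ?c = "\<lambda>i. if i \<in> ?S then coeff p (nat (i + int n)) else 0"
  have "h z = (\<Sum>i\<in>?S. ?c i * z powi i)" if z: "z \<noteq> 0" for z
  proof -
    have "(\<Sum>i\<in>?S. ?c i * z powi i) = (\<Sum>k\<le>degree p. coeff p k * z powi (int k - int n))"
      by (subst sum.reindex) (auto simp: inj_on_def intro!: sum.cong)
    also have "\<dots> = (\<Sum>k\<le>degree p. coeff p k * z ^ k / z ^ n)"
      using z by (intro sum.cong) (auto simp: power_int_diff)
    also have "\<dots> = h z" using h[OF z] by (simp add: poly_altdef sum_divide_distrib)
    finally show ?thesis by simp
  qed
  then have "laurent_rep h ?S ?c" by (auto simp: laurent_rep_def)
  then show "\<exists>S c. laurent_rep h S c" by blast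
next
  assume "\<exists>S c. laurent_rep h S c"
  then obtain S c where S: "finite S" and h: "\<And>z. z \<noteq> 0 \<Longrightarrow> h z = (\<Sum>i\<in>S. c i * z powi i)"
    by (auto simp: laurent_rep_def)
  obtain n :: nat where n: "\<And>i. i \<in> S \<Longrightarrow> - int n \<le> i" using int_set_lower_bound[OF S] by blast
  have "h z = poly (\<Sum>i\<in>S. monom (c i) (nat (i + int n))) z / z ^ n" if "z \<noteq> 0" for z
    using sum_monom_eq[OF S n that, of c] h[OF that] that by simp
  then show "regular_on_Gm h" unfolding regular_on_Gm_def by blast
qed

lemma regular_laurent_rep:
  assumes "regular_on_Gm h"
  obtains S where "laurent_rep h S (lcoef h)"
  using assms lcoef_eqI unfolding regular_on_Gm_iff by metis

lemma lcoef_lincomb: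
  assumes J: "finite J" and h: "\<And>j. j \<in> J \<Longrightarrow> regular_on_Gm (h j)"
    and g: "\<And>z. z \<noteq> 0 \<Longrightarrow> g z = (\<Sum>j\<in>J. a j * h j z)"
  shows "lcoef g i = (\<Sum>j\<in>J. a j * lcoef (h j) i)"
proof -
  have "\<exists>S. laurent_rep (h j) S (lcoef (h j))" if "j \<in> J" for j
    using regular_laurent_rep[OF h[OF that]] by blast
  then obtain S where S: "\<And>j. j \<in> J \<Longrightarrow> laurent_rep (h j) (S j) (lcoef (h j))" by metis
  let ?U = "\<Union>j\<in>J. S j"
  have fin: "finite ?U" using J S by (auto simp: laurent_rep_def)
  have U: "laurent_rep (h j) ?U (lcoef (h j))" if "j \<in> J" for j
    using laurent_rep_mono[OF S[OF that] fin] that by blast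
  have "laurent_rep g ?U (\<lambda>i. \<Sum>j\<in>J. a j * lcoef (h j) i)"
    unfolding laurent_rep_def
  proof (intro conjI allI impI fin)
    fix i assume "i \<notin> ?U"
    then show "(\<Sum>j\<in>J. a j * lcoef (h j) i) = 0"
      using U by (intro sum.neutral) (auto simp: laurent_rep_def)
  next
    fix z :: complex assume z: "z \<noteq> 0"
    have "g z = (\<Sum>j\<in>J. a j * (\<Sum>i\<in>?U. lcoef (h j) i * z powi i))"
      unfolding g[OF z] using U z by (intro sum.cong) (auto simp: laurent_rep_def)
    also have "\<dots> = (\<Sum>j\<in>J. \<Sum>i\<in>?U. a j * lcoef (h j) i * z powi i)"
      by (simp add: sum_distrib_left mult.assoc)
    also have "\<dots> = (\<Sum>i\<in>?U. \<Sum>j\<in>J. a j * lcoef (h j) i * z powi i)" by (rule sum.swap)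
    finally show "g z = (\<Sum>i\<in>?U. (\<Sum>j\<in>J. a j * lcoef (h j) i) * z powi i)"
      by (simp add: sum_distrib_right)
  qed
  then show ?thesis by (simp add: lcoef_eqI)
qed

definition weight_support :: "(complex, 'v) module \<Rightarrow> (int \<Rightarrow> 'v \<Rightarrow> 'v) \<Rightarrow> int set" where
  "weight_support V P = {i. \<exists>v\<in>carrier V. P i v \<noteq> \<zero>\<^bsub>V\<^esub>}"

text \<open>
  A decomposition of \<open>V\<close> into weight spaces, given by the projections onto them. This is exactly what the
  idempotents of an object of \<open>Mod Idem(Q)\<close> provide at each vertex.
\<close>

definition grading :: "(complex, 'v) module \<Rightarrow> (int \<Rightarrow> 'v \<Rightarrow> 'v) \<Rightarrow> bool" where
  "grading V P \<longleftrightarrow>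
     (\<forall>i. P i \<in> module_hom CC V V) \<and> finite (weight_support V P) \<and>
     (\<forall>i k. i \<noteq> k \<longrightarrow> (\<forall>v\<in>carrier V. P i (P k v) = \<zero>\<^bsub>V\<^esub>)) \<and>
     (\<forall>v\<in>carrier V. (\<Oplus>\<^bsub>V\<^esub>i\<in>weight_support V P. P i v) = v)"

lemma gradingD:
  assumes "grading V P"
  shows grading_hom: "P i \<in> module_hom CC V V"
    and grading_finite: "finite (weight_support V P)"
    and grading_orth: "i \<noteq> k \<Longrightarrow> v \<in> carrier V \<Longrightarrow> P i (P k v) = \<zero>\<^bsub>V\<^esub>"
    and grading_sum: "v \<in> carrier V \<Longrightarrow> (\<Oplus>\<^bsub>V\<^esub>i\<in>weight_support V P. P i v) = v"
    and grading_closed: "v \<in> carrier V \<Longrightarrow> P i v \<in> carrier V"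
  using assms hom_closed[of "P i" V V] by (auto simp: grading_def)

lemma weight_support_zero: "i \<notin> weight_support V P \<Longrightarrow> v \<in> carrier V \<Longrightarrow> P i v = \<zero>\<^bsub>V\<^esub>"
  by (auto simp: weight_support_def)

lemma grading_dual_sum:
  assumes V: "vectorspace CC V" and P: "grading V P" and f: "f \<in> dual V" and v: "v \<in> carrier V"
    and S: "finite S" "weight_support V P \<subseteq> S"
  shows "(\<Sum>i\<in>S. f (P i v)) = f v"
proof -
  have "f v = f (\<Oplus>\<^bsub>V\<^esub>i\<in>weight_support V P. P i v)" using grading_sum[OF P v] by simp
  also have "\<dots> = (\<Sum>i\<in>weight_support V P. f (P i v))"
    by (rule dual_finsum[OF V f grading_closed[OF P v]])
  also have "\<dots> = (\<Sum>i\<in>S. f (P i v))"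
    by (rule sum.mono_neutral_left)
      (use S weight_support_zero[of _ V P] v in \<open>auto simp: dual_zero[OF V f]\<close>)
  finally show ?thesis by simp
qed

text \<open>
  The finite set \<open>S\<close> may contain more than the weights that occur, and the projections have to add up to
  the identity only under functionals.
\<close>

lemma gradingI:
  assumes V: "fd_vectorspace V" and P: "\<And>i. P i \<in> module_hom CC V V"
    and S: "finite S" "\<And>i v. i \<notin> S \<Longrightarrow> v \<in> carrier V \<Longrightarrow> P i v = \<zero>\<^bsub>V\<^esub>"
    and orth: "\<And>i k v. i \<noteq> k \<Longrightarrow> v \<in> carrier V \<Longrightarrow> P i (P k v) = \<zero>\<^bsub>V\<^esub>"
    and sum: "\<And>f v. f \<in> dual V \<Longrightarrow> v \<in> carrier V \<Longrightarrow> (\<Sum>i\<in>S. f (P i v)) = f v"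
  shows "grading V P"
proof -
  have Vv: "vectorspace CC V" by (rule fd_vs[OF V])
  have sub: "weight_support V P \<subseteq> S" using S(2) by (auto simp: weight_support_def)
  have fin: "finite (weight_support V P)" using finite_subset[OF sub S(1)] .
  have "(\<Oplus>\<^bsub>V\<^esub>i\<in>weight_support V P. P i v) = v" if v: "v \<in> carrier V" for v
  proof (rule dual_ext[OF V _ v])
    show "(\<Oplus>\<^bsub>V\<^esub>i\<in>weight_support V P. P i v) \<in> carrier V"
      by (rule vs_finsum[OF Vv hom_closed[OF P v]])
    fix f assume f: "f \<in> dual V"
    have "f (\<Oplus>\<^bsub>V\<^esub>i\<in>weight_support V P. P i v) = (\<Sum>i\<in>weight_support V P. f (P i v))"
      by (rule dual_finsum[OF Vv f hom_closed[OF P v]])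
    also have "\<dots> = (\<Sum>i\<in>S. f (P i v))"
      by (rule sum.mono_neutral_left)
        (use S sub v weight_support_zero[of _ V P] in \<open>auto simp: dual_zero[OF Vv f]\<close>)
    finally show "f (\<Oplus>\<^bsub>V\<^esub>i\<in>weight_support V P. P i v) = f v" using sum[OF f v] by simp
  qed
  then show ?thesis using P orth fin by (auto simp: grading_def)
qed

text \<open>
  Apply \<open>P i\<close> to \<open>v = (\<Sum>k. P k v)\<close>: by orthogonality only the term \<open>k = i\<close> survives.
\<close>

lemma grading_idem:
  assumes V: "fd_vectorspace V" and P: "grading V P" and v: "v \<in> carrier V"
  shows "P i (P i v) = P i v"
proof (rule dual_ext[OF V])
  note Vv = fd_vs[OF V]
  show "P i (P i v) \<in> carrier V" "P i v \<in> carrier V" using grading_closed[OF P] v by auto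
  fix f assume f: "f \<in> dual V"
  let ?S = "insert i (weight_support V P)"
  have S: "finite ?S" using grading_finite[OF P] by simp
  have "f (P i v) = (\<Sum>k\<in>?S. f (P i (P k v)))"
    using grading_dual_sum[OF Vv P hom_comp[OF grading_hom[OF P, of i] f] v S subset_insertI] by simp
  also have "\<dots> = (\<Sum>k\<in>?S. if k = i then f (P i (P i v)) else 0)"
    by (rule sum.cong) (auto simp: grading_orth[OF P _ v] dual_zero[OF Vv f])
  also have "\<dots> = f (P i (P i v))" using S by simp
  finally show "f (P i (P i v)) = f (P i v)" by simp
qed

text \<open>
  The action for which \<open>P i\<close> is the projection onto the vectors of weight \<open>i\<close>.
\<close>

definition torus_of :: "(complex, 'v) module \<Rightarrow> (int \<Rightarrow> 'v \<Rightarrow> 'v) \<Rightarrow> complex \<Rightarrow> 'v \<Rightarrow> 'v" where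
  "torus_of V P z = (\<lambda>v\<in>carrier V. \<Oplus>\<^bsub>V\<^esub>i\<in>weight_support V P. z powi i \<odot>\<^bsub>V\<^esub> P i v)"

lemma torus_of_closed:
  assumes V: "vectorspace CC V" and P: "grading V P" and v: "v \<in> carrier V"
  shows "torus_of V P z v \<in> carrier V"
  using v vs_finsum[OF V vs_smult[OF V grading_closed[OF P v]]] by (simp add: torus_of_def)

lemma dual_torus_of:
  assumes V: "vectorspace CC V" and P: "grading V P" and f: "f \<in> dual V" and v: "v \<in> carrier V"
    and S: "finite S" "weight_support V P \<subseteq> S"
  shows "f (torus_of V P z v) = (\<Sum>i\<in>S. z powi i * f (P i v))"
proof -
  have "f (torus_of V P z v) = (\<Sum>i\<in>weight_support V P. f (z powi i \<odot>\<^bsub>V\<^esub> P i v))"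
    using v dual_finsum[OF V f vs_smult[OF V grading_closed[OF P v]]] by (simp add: torus_of_def)
  also have "\<dots> = (\<Sum>i\<in>weight_support V P. z powi i * f (P i v))"
    using dual_smult[OF f grading_closed[OF P v]] by simp
  also have "\<dots> = (\<Sum>i\<in>S. z powi i * f (P i v))"
    by (rule sum.mono_neutral_left)
      (use S weight_support_zero[of _ V P] v in \<open>auto simp: dual_zero[OF V f]\<close>)
  finally show ?thesis .
qed

lemma torus_of_hom:
  assumes V: "fd_vectorspace V" and P: "grading V P"
  shows "torus_of V P z \<in> module_hom CC V V"
proof -
  note Vv = fd_vs[OF V]
  note closed = torus_of_closed[OF Vv P] vs_add[OF Vv] vs_smult[OF Vv] grading_closed[OF P]
  note dual = dual_torus_of[OF Vv P _ _ grading_finite[OF P] subset_refl]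
  show ?thesis
  proof (rule homI)
    fix v w assume vw: "v \<in> carrier V" "w \<in> carrier V"
    show "torus_of V P z (v \<oplus>\<^bsub>V\<^esub> w) = torus_of V P z v \<oplus>\<^bsub>V\<^esub> torus_of V P z w"
      by (rule dual_ext[OF V])
        (use vw in \<open>simp_all add: closed dual dual_add hom_add[OF grading_hom[OF P]]
            algebra_simps sum.distrib\<close>)
  next
    fix c v assume v: "v \<in> carrier V"
    show "torus_of V P z (c \<odot>\<^bsub>V\<^esub> v) = c \<odot>\<^bsub>V\<^esub> torus_of V P z v"
      by (rule dual_ext[OF V])
        (use v in \<open>simp_all add: closed dual dual_smult hom_smult[OF grading_hom[OF P]]
            algebra_simps sum_distrib_left\<close>)
  qed (simp add: closed)
qed

lemma grading_torus_of:
  assumes V: "fd_vectorspace V" and P: "grading V P" and v: "v \<in> carrier V"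
  shows "P i (torus_of V P z v) = z powi i \<odot>\<^bsub>V\<^esub> P i v"
proof (rule dual_ext[OF V])
  note Vv = fd_vs[OF V]
  show "P i (torus_of V P z v) \<in> carrier V" "z powi i \<odot>\<^bsub>V\<^esub> P i v \<in> carrier V"
    using v by (auto intro!: grading_closed[OF P] torus_of_closed[OF Vv P] vs_smult[OF Vv])
  fix f assume f: "f \<in> dual V"
  let ?S = "insert i (weight_support V P)"
  have S: "finite ?S" using grading_finite[OF P] by simp
  have "f (P i (torus_of V P z v)) = (\<Sum>k\<in>?S. z powi k * f (P i (P k v)))"
    using dual_torus_of[OF Vv P hom_comp[OF grading_hom[OF P, of i] f] v S subset_insertI] by simp
  also have "\<dots> = (\<Sum>k\<in>?S. if k = i then z powi i * f (P i (P i v)) else 0)"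
    by (rule sum.cong) (auto simp: grading_orth[OF P _ v] dual_zero[OF Vv f])
  also have "\<dots> = z powi i * f (P i (P i v))" using S by simp
  finally show "f (P i (torus_of V P z v)) = f (z powi i \<odot>\<^bsub>V\<^esub> P i v)"
    by (simp add: grading_idem[OF V P v] dual_smult[OF f grading_closed[OF P v]])
qed

text \<open>
  The vector \<open>P i v\<close> has weight \<open>i\<close> by \<open>grading_torus_of\<close>, so both sides multiply it by \<open>(z w)\<^sup>i\<close>.
\<close>

lemma torus_of_mult:
  assumes V: "fd_vectorspace V" and P: "grading V P" and v: "v \<in> carrier V"
    and z: "z \<noteq> 0" "w \<noteq> 0"
  shows "torus_of V P (z * w) v = torus_of V P z (torus_of V P w v)"
proof (rule dual_ext[OF V])
  note Vv = fd_vs[OF V]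
  note dual = dual_torus_of[OF Vv P _ _ grading_finite[OF P] subset_refl]
  show "torus_of V P (z * w) v \<in> carrier V" "torus_of V P z (torus_of V P w v) \<in> carrier V"
    using v by (auto intro!: torus_of_closed[OF Vv P])
  fix f assume f: "f \<in> dual V"
  show "f (torus_of V P (z * w) v) = f (torus_of V P z (torus_of V P w v))"
    using v z f by (simp add: dual torus_of_closed[OF Vv P] grading_torus_of[OF V P]
        dual_smult grading_closed[OF P] power_int_mult_distrib mult.assoc)
qed

lemma torus_of_one:
  assumes V: "fd_vectorspace V" and P: "grading V P" and v: "v \<in> carrier V"
  shows "torus_of V P 1 v = v"
proof (rule dual_ext[OF V _ v])
  note Vv = fd_vs[OF V]
  show "torus_of V P 1 v \<in> carrier V" by (rule torus_of_closed[OF Vv P v])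
  fix f assume f: "f \<in> dual V"
  show "f (torus_of V P 1 v) = f v"
    using dual_torus_of[OF Vv P f v grading_finite[OF P] subset_refl, of 1]
      grading_dual_sum[OF Vv P f v grading_finite[OF P] subset_refl] by simp
qed

lemma torus_of_algebraic:
  assumes V: "fd_vectorspace V" and P: "grading V P"
  shows "algebraic_hom_GL V (torus_of V P)"
proof -
  note Vv = fd_vs[OF V]
  let ?t = "torus_of V P"
  note closed = torus_of_closed[OF Vv P]
  have inv: "?t z (?t (inverse z) v) = v" "?t (inverse z) (?t z v) = v"
    if "z \<noteq> 0" "v \<in> carrier V" for z v
    using torus_of_mult[OF V P that(2), of z "inverse z"] torus_of_mult[OF V P that(2), of "inverse z" z]
      torus_of_one[OF V P that(2)] that(1) by auto
  have bij: "?t z \<in> Bij (carrier V)" if "z \<noteq> 0" for z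
  proof -
    have "bij_betw (?t z) (carrier V) (carrier V)"
      by (rule bij_betwI[where g = "?t (inverse z)"]) (use closed inv[OF that] in auto)
    then show ?thesis by (simp add: Bij_def torus_of_def)
  qed
  have "?t (z * w) = compose (carrier V) (?t z) (?t w)" if "z \<noteq> 0" "w \<noteq> 0" for z w
    using torus_of_mult[OF V P _ that] by (auto simp: compose_def fun_eq_iff torus_of_def)
  then have "?t \<in> hom (mult_of CC) (GL V)"
    using bij torus_of_hom[OF V P] by (auto simp: hom_def GL_def BijGroup_def)
  moreover have "regular_on_Gm (\<lambda>z. f (?t z v))" if v: "v \<in> carrier V" and f: "f \<in> dual V" for v f
  proof -
    have "laurent_rep (\<lambda>z. f (?t z v)) (weight_support V P) (\<lambda>i. f (P i v))"
      unfolding laurent_rep_def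
      using dual_torus_of[OF Vv P f v grading_finite[OF P] subset_refl] grading_finite[OF P]
        weight_support_zero[of _ V P, OF _ v] dual_zero[OF Vv f]
      by (auto simp: mult.commute)
    then show ?thesis unfolding regular_on_Gm_iff by blast
  qed
  ultimately show ?thesis by (auto simp: algebraic_hom_GL_def)
qed

lemma algebraic_hom_GLD:
  assumes "algebraic_hom_GL V t"
  shows algebraic_hom: "z \<noteq> 0 \<Longrightarrow> t z \<in> module_hom CC V V"
    and algebraic_mult: "z \<noteq> 0 \<Longrightarrow> w \<noteq> 0 \<Longrightarrow> v \<in> carrier V \<Longrightarrow> t (z * w) v = t z (t w v)"
    and algebraic_regular: "v \<in> carrier V \<Longrightarrow> f \<in> dual V \<Longrightarrow> regular_on_Gm (\<lambda>z. f (t z v))"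
    and algebraic_one: "v \<in> carrier V \<Longrightarrow> t 1 v = v"
proof -
  have t: "t z \<in> module_hom CC V V \<inter> Bij (carrier V)" if "z \<noteq> 0" for z
    using assms that by (auto simp: algebraic_hom_GL_def hom_def GL_def)
  show "t z \<in> module_hom CC V V" if "z \<noteq> 0" for z using t[OF that] by simp
  have bij: "bij_betw (t z) (carrier V) (carrier V)" if "z \<noteq> 0" for z
    using t[OF that] by (simp add: Bij_def)
  show mult: "t (z * w) v = t z (t w v)" if "z \<noteq> 0" "w \<noteq> 0" "v \<in> carrier V" for z w v
  proof -
    have "t (z * w) = compose (carrier V) (t z) (t w)"
      using assms t[OF that(1)] t[OF that(2)] that
      by (auto simp: algebraic_hom_GL_def hom_def GL_def BijGroup_def)
    then show ?thesis using that(3) by (simp add: compose_def)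
  qed
  show "v \<in> carrier V \<Longrightarrow> f \<in> dual V \<Longrightarrow> regular_on_Gm (\<lambda>z. f (t z v))"
    using assms by (auto simp: algebraic_hom_GL_def)
  show "t 1 v = v" if v: "v \<in> carrier V" for v
  proof -
    have "t 1 v \<in> carrier V" using bij[of 1] v by (auto simp: bij_betw_def)
    moreover have "t 1 (t 1 v) = t 1 v" using mult[of 1 1 v] v by simp
    ultimately show ?thesis using bij[of 1] v by (auto simp: bij_betw_def inj_on_def)
  qed
qed

text \<open>
  The vector \<open>P i v\<close> is the coefficient of \<open>z\<^sup>i\<close> in \<open>t z v\<close>, taken coordinatewise in a basis. By linearity the
  same description \<open>g (P i v) = lcoef (\<lambda>z. g (t z v)) i\<close> is valid for every functional \<open>g\<close>, and this
  makes all properties of \<open>P\<close> statements about Laurent coefficients. Comparing coefficients of \<open>w\<^sup>k\<close> in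
  \<open>t z (t w v) = t (z w) v\<close> shows that \<open>P k v\<close> has weight \<open>k\<close>, so that its Laurent expansion has a single term;
  hence orthogonality. Evaluation at \<open>z = 1\<close> shows that the \<open>P i\<close> add up to the identity.
\<close>

lemma algebraic_grading_exists:
  assumes V: "fd_vectorspace V" and t: "algebraic_hom_GL V t"
  shows "\<exists>P. grading V P \<and> (\<forall>z v. z \<noteq> 0 \<longrightarrow> v \<in> carrier V \<longrightarrow> t z v = torus_of V P z v)"
proof -
  note Vv = fd_vs[OF V]
  note thom = algebraic_hom[OF t] and treg = algebraic_regular[OF t]
  note tclosed = hom_closed[OF thom]
  obtain B f where B: "finite B" "B \<subseteq> carrier V" and f: "\<And>b. b \<in> B \<Longrightarrow> f b \<in> dual V"
    and coord: "\<And>v. v \<in> carrier V \<Longrightarrow> v = (\<Oplus>\<^bsub>V\<^esub>b\<in>B. f b v \<odot>\<^bsub>V\<^esub> b)"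
    by (rule fd_coordinates[OF V]) blast
  have dual_coord: "g v = (\<Sum>b\<in>B. f b v * g b)" if "g \<in> dual V" "v \<in> carrier V" for g v
  proof -
    have "g v = g (\<Oplus>\<^bsub>V\<^esub>b\<in>B. f b v \<odot>\<^bsub>V\<^esub> b)" using coord[OF that(2)] by simp
    also have "\<dots> = (\<Sum>b\<in>B. g (f b v \<odot>\<^bsub>V\<^esub> b))"
      using B(2) by (intro dual_finsum[OF Vv that(1)] vs_smult[OF Vv]) auto
    also have "\<dots> = (\<Sum>b\<in>B. f b v * g b)"
      using B(2) by (intro sum.cong) (auto simp: dual_smult[OF that(1)])
    finally show ?thesis .
  qed
  define P where "P i v = (\<Oplus>\<^bsub>V\<^esub>b\<in>B. lcoef (\<lambda>z. f b (t z v)) i \<odot>\<^bsub>V\<^esub> b)" for i v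
  have Pclosed: "P i v \<in> carrier V" for i v
    unfolding P_def using B(2) by (intro vs_finsum[OF Vv] vs_smult[OF Vv]) auto
  have dualP: "g (P i v) = lcoef (\<lambda>z. g (t z v)) i" if g: "g \<in> dual V" and v: "v \<in> carrier V" for g i v
  proof -
    have "lcoef (\<lambda>z. g (t z v)) i = (\<Sum>b\<in>B. g b * lcoef (\<lambda>z. f b (t z v)) i)"
    proof (rule lcoef_lincomb[OF B(1)])
      show "regular_on_Gm (\<lambda>z. f b (t z v))" if "b \<in> B" for b using treg[OF v f[OF that]] .
      show "g (t z v) = (\<Sum>b\<in>B. g b * f b (t z v))" if "z \<noteq> 0" for z
        using dual_coord[OF g tclosed[OF that v]] by (simp add: mult.commute)
    qed
    also have "\<dots> = (\<Sum>b\<in>B. g (lcoef (\<lambda>z. f b (t z v)) i \<odot>\<^bsub>V\<^esub> b))"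
      using B(2) by (intro sum.cong) (auto simp: dual_smult[OF g])
    also have "\<dots> = g (P i v)" unfolding P_def
      using B(2) by (intro dual_finsum[symmetric, OF Vv g] vs_smult[OF Vv]) auto
    finally show ?thesis by simp
  qed
  have Phom: "P i \<in> module_hom CC V V" for i
  proof (rule homI)
    show "P i v \<in> carrier V" for v by (rule Pclosed)
    show "P i (v \<oplus>\<^bsub>V\<^esub> w) = P i v \<oplus>\<^bsub>V\<^esub> P i w" if vw: "v \<in> carrier V" "w \<in> carrier V" for v w
    proof (rule dual_ext[OF V])
      fix g assume g: "g \<in> dual V"
      have "lcoef (\<lambda>z. g (t z (v \<oplus>\<^bsub>V\<^esub> w))) i =
          (\<Sum>b\<in>{True, False}. 1 * lcoef (\<lambda>z. g (t z (if b then v else w))) i)"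
        by (rule lcoef_lincomb)
          (use vw in \<open>auto simp: treg[OF _ g] hom_add[OF thom] dual_add[OF g] tclosed\<close>)
      then show "g (P i (v \<oplus>\<^bsub>V\<^esub> w)) = g (P i v \<oplus>\<^bsub>V\<^esub> P i w)"
        using vw g by (simp add: dualP vs_add[OF Vv] dual_add Pclosed)
    qed (auto intro!: Pclosed vs_add[OF Vv])
    show "P i (c \<odot>\<^bsub>V\<^esub> v) = c \<odot>\<^bsub>V\<^esub> P i v" if v: "v \<in> carrier V" for c v
    proof (rule dual_ext[OF V])
      fix g assume g: "g \<in> dual V"
      have "lcoef (\<lambda>z. g (t z (c \<odot>\<^bsub>V\<^esub> v))) i = (\<Sum>b\<in>{()}. c * lcoef (\<lambda>z. g (t z v)) i)"
        by (rule lcoef_lincomb)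
          (use v in \<open>auto simp: treg[OF _ g] hom_smult[OF thom] dual_smult[OF g] tclosed\<close>)
      then show "g (P i (c \<odot>\<^bsub>V\<^esub> v)) = g (c \<odot>\<^bsub>V\<^esub> P i v)"
        using v g by (simp add: dualP vs_smult[OF Vv] dual_smult Pclosed)
    qed (auto intro!: Pclosed vs_smult[OF Vv])
  qed
  have "\<exists>S. laurent_rep (\<lambda>z. f b (t z c)) S (lcoef (\<lambda>z. f b (t z c)))" if "b \<in> B" "c \<in> B" for b c
    using regular_laurent_rep[OF treg[OF _ f]] that B(2) by (metis subsetD)
  then obtain S where S: "\<And>b c. b \<in> B \<Longrightarrow> c \<in> B \<Longrightarrow> laurent_rep (\<lambda>z. f b (t z c)) (S b c) (lcoef (\<lambda>z. f b (t z c)))"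
    by metis
  let ?U = "\<Union>b\<in>B. \<Union>c\<in>B. S b c"
  have fin: "finite ?U" using B(1) S by (auto simp: laurent_rep_def)
  have out: "P i v = \<zero>\<^bsub>V\<^esub>" if i: "i \<notin> ?U" and v: "v \<in> carrier V" for i v
  proof (rule dual_ext[OF V Pclosed vs_zero[OF Vv]])
    fix g assume g: "g \<in> dual V"
    have fP: "f b (P i c) = 0" if "b \<in> B" "c \<in> B" for b c
      using dualP[OF f[OF that(1)], of c i] S[OF that] i that B(2) by (auto simp: laurent_rep_def)
    have "f b (P i v) = 0" if b: "b \<in> B" for b
      using dual_coord[OF hom_comp[OF Phom f[OF b]] v] fP[OF b] by simp
    then show "g (P i v) = g \<zero>\<^bsub>V\<^esub>"
      using dual_coord[OF g Pclosed, of i v] by (simp add: dual_zero[OF Vv g])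
  qed
  have expand: "g (t z v) = (\<Sum>i\<in>?U. z powi i * g (P i v))" if g: "g \<in> dual V" and v: "v \<in> carrier V" and z: "z \<noteq> 0" for g z v
  proof -
    obtain R where R: "laurent_rep (\<lambda>z. g (t z v)) R (lcoef (\<lambda>z. g (t z v)))"
      using regular_laurent_rep[OF treg[OF v g]] .
    then have R': "laurent_rep (\<lambda>z. g (t z v)) (R \<union> ?U) (lcoef (\<lambda>z. g (t z v)))"
      by (rule laurent_rep_mono) (use R fin in \<open>auto simp: laurent_rep_def\<close>)
    have "g (t z v) = (\<Sum>i\<in>R \<union> ?U. g (P i v) * z powi i)"
      using R' z by (simp add: laurent_rep_def dualP[OF g v])
    also have "\<dots> = (\<Sum>i\<in>?U. g (P i v) * z powi i)"
      by (rule sum.mono_neutral_right)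
        (use R fin out v in \<open>auto simp: laurent_rep_def dual_zero[OF Vv g]\<close>)
    finally show ?thesis by (simp add: mult.commute)
  qed
  have eigen: "t z (P k v) = z powi k \<odot>\<^bsub>V\<^esub> P k v" if v: "v \<in> carrier V" and z: "z \<noteq> 0" for z k v
  proof (rule dual_ext[OF V])
    show "t z (P k v) \<in> carrier V" "z powi k \<odot>\<^bsub>V\<^esub> P k v \<in> carrier V"
      using tclosed[OF z Pclosed] vs_smult[OF Vv Pclosed] by auto
    fix g assume g: "g \<in> dual V"
    have g': "(\<lambda>v. g (t z v)) \<in> dual V" by (rule hom_comp[OF thom[OF z] g])
    have "laurent_rep (\<lambda>w. g (t z (t w v))) ?U (\<lambda>i. z powi i * g (P i v))"
      unfolding laurent_rep_def
    proof (intro conjI allI impI fin)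
      show "z powi i * g (P i v) = 0" if "i \<notin> ?U" for i
        using out[OF that v] dual_zero[OF Vv g] by simp
      fix w :: complex assume w: "w \<noteq> 0"
      show "g (t z (t w v)) = (\<Sum>i\<in>?U. z powi i * g (P i v) * w powi i)"
        using expand[OF g v, of "z * w"] algebraic_mult[OF t z w v] z w
        by (simp add: power_int_mult_distrib ac_simps)
    qed
    then show "g (t z (P k v)) = g (z powi k \<odot>\<^bsub>V\<^esub> P k v)"
      using dualP[OF g' v, of k] by (simp add: lcoef_eqI dual_smult[OF g Pclosed])
  qed
  have orth: "P i (P k v) = \<zero>\<^bsub>V\<^esub>" if ik: "i \<noteq> k" and v: "v \<in> carrier V" for i k v
  proof (rule dual_ext[OF V Pclosed vs_zero[OF Vv]])
    fix g assume g: "g \<in> dual V"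
    have "laurent_rep (\<lambda>z. g (t z (P k v))) {k} (\<lambda>i. if i = k then g (P k v) else 0)"
      using eigen[OF v] by (auto simp: laurent_rep_def dual_smult[OF g Pclosed])
    then show "g (P i (P k v)) = g \<zero>\<^bsub>V\<^esub>"
      using dualP[OF g Pclosed, of i k v] ik by (simp add: lcoef_eqI dual_zero[OF Vv g])
  qed
  have gr: "grading V P"
  proof (rule gradingI[OF V Phom fin out orth])
    fix g v assume g: "g \<in> dual V" and v: "v \<in> carrier V"
    show "(\<Sum>i\<in>?U. g (P i v)) = g v"
      using expand[OF g v, of 1] algebraic_one[OF t v] by simp
  qed
  have sub: "weight_support V P \<subseteq> ?U" unfolding weight_support_def using out by blast
  have "t z v = torus_of V P z v" if z: "z \<noteq> 0" and v: "v \<in> carrier V" for z v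
    by (rule dual_ext[OF V tclosed[OF z v] torus_of_closed[OF Vv gr v]])
      (simp add: expand[OF _ v z] dual_torus_of[OF Vv gr _ v fin sub])
  then show ?thesis using gr by blast
qed

text \<open>
  Both sides are vector-valued Laurent polynomials in \<open>z\<close>; compare coefficients of \<open>z\<^sup>k\<^sup>+\<^sup>T\<close>. The statement
  is about one pair of vectors \<open>v\<close>, \<open>w\<close> rather than about \<open>w = h v\<close> only: with \<open>w = 0\<close> it says that a linear
  condition satisfied along the orbit of \<open>v\<close> is satisfied by each weight component of \<open>v\<close>.
\<close>

lemma intertwine_iff:
  assumes V: "vectorspace CC V" and P: "grading V P" and W: "fd_vectorspace W" and P': "grading W P'"
    and h: "h \<in> module_hom CC V W" and v: "v \<in> carrier V" and w: "w \<in> carrier W"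
  shows "(\<forall>z. z \<noteq> 0 \<longrightarrow> z powi T \<odot>\<^bsub>W\<^esub> h (torus_of V P z v) = torus_of W P' z w) \<longleftrightarrow>
     (\<forall>k. h (P k v) = P' (k + T) w)"
proof -
  note Wv = fd_vs[OF W]
  let ?S = "weight_support V P \<union> (\<lambda>i. i - T) ` weight_support W P'"
  have S: "finite ?S" using grading_finite[OF P] grading_finite[OF P'] by simp
  have S': "finite ((\<lambda>k. k + T) ` ?S)" "weight_support W P' \<subseteq> (\<lambda>k. k + T) ` ?S"
    using S by (auto simp: image_iff intro!: bexI[of _ "_ - T"])
  have hc: "h (torus_of V P z v) \<in> carrier W" for z
    using hom_closed[OF h torus_of_closed[OF V P v]] .
  have L: "f (z powi T \<odot>\<^bsub>W\<^esub> h (torus_of V P z v)) = (\<Sum>k\<in>?S. z powi (k + T) * f (h (P k v)))"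
    if f: "f \<in> dual W" and z: "z \<noteq> 0" for f z
    using dual_torus_of[OF V P hom_comp[OF h f] v S, of z] z
    by (simp add: dual_smult[OF f hc] sum_distrib_left power_int_add ac_simps)
  have R: "f (torus_of W P' z w) = (\<Sum>k\<in>?S. z powi (k + T) * f (P' (k + T) w))"
    if f: "f \<in> dual W" for f z
    using dual_torus_of[OF Wv P' f w S', of z] by (simp add: sum.reindex inj_on_def)
  show ?thesis
  proof
    assume eq: "\<forall>z. z \<noteq> 0 \<longrightarrow> z powi T \<odot>\<^bsub>W\<^esub> h (torus_of V P z v) = torus_of W P' z w"
    show "\<forall>k. h (P k v) = P' (k + T) w"
    proof
      fix k
      show "h (P k v) = P' (k + T) w"
      proof (cases "k \<in> ?S")
        case False
        then have "P k v = \<zero>\<^bsub>V\<^esub>" using weight_support_zero[of k V P v] v by auto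
        moreover have "k + T \<notin> weight_support W P'" using False by (force simp: image_iff)
        ultimately show ?thesis
          using weight_support_zero[of "k + T" W P' w] w hom_zero[OF V Wv h] by simp
      next
        case True
        show ?thesis
        proof (rule dual_ext[OF W hom_closed[OF h grading_closed[OF P v]] grading_closed[OF P' w]])
          fix f assume f: "f \<in> dual W"
          have "f (h (P k v)) - f (P' (k + T) w) = 0"
          proof (rule laurent_zero[OF S _ True])
            fix z :: complex assume z: "z \<noteq> 0"
            have "(\<Sum>k\<in>?S. z powi (k + T) * f (h (P k v))) = (\<Sum>k\<in>?S. z powi (k + T) * f (P' (k + T) w))"
              using eq z L[OF f z] R[OF f, of z] by simp
            then have "z powi T * (\<Sum>k\<in>?S. (f (h (P k v)) - f (P' (k + T) w)) * z powi k) = 0"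
              using z by (simp add: sum_distrib_left sum_subtractf power_int_add algebra_simps)
            then show "(\<Sum>k\<in>?S. (f (h (P k v)) - f (P' (k + T) w)) * z powi k) = 0"
              using z by simp
          qed
          then show "f (h (P k v)) = f (P' (k + T) w)" by simp
        qed
      qed
    qed
  next
    assume eq: "\<forall>k. h (P k v) = P' (k + T) w"
    show "\<forall>z. z \<noteq> 0 \<longrightarrow> z powi T \<odot>\<^bsub>W\<^esub> h (torus_of V P z v) = torus_of W P' z w"
    proof (intro allI impI)
      fix z :: complex assume z: "z \<noteq> 0"
      show "z powi T \<odot>\<^bsub>W\<^esub> h (torus_of V P z v) = torus_of W P' z w"
        by (rule dual_ext[OF W vs_smult[OF Wv hc] torus_of_closed[OF Wv P' w]])
          (simp add: L z R eq)
    qed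
  qed
qed

lemma intertwine0_iff:
  assumes "vectorspace CC V" "grading V P" "fd_vectorspace W" "grading W P'"
    "h \<in> module_hom CC V W" "v \<in> carrier V" "w \<in> carrier W"
  shows "(\<forall>z. z \<noteq> 0 \<longrightarrow> h (torus_of V P z v) = torus_of W P' z w) \<longleftrightarrow> (\<forall>k. h (P k v) = P' k w)"
proof -
  have "h (torus_of V P z v) \<in> carrier W" for z
    using assms by (intro hom_closed[OF assms(5)] torus_of_closed)
  then show ?thesis
    using intertwine_iff[OF assms, of 0] by (simp add: vs_smult_one[OF fd_vs[OF assms(3)]])
qed

text \<open>
  A map all of whose blocks from weight \<open>k\<close> to weight \<open>i \<noteq> k + T\<close> are zero raises weights by \<open>T\<close>: both
  \<open>h (P k v)\<close> and \<open>P' (k + T) (h v)\<close> are equal to the remaining block \<open>P' (k + T) (h (P k v))\<close>.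
\<close>

lemma shift_intertwine:
  assumes V: "vectorspace CC V" and P: "grading V P" and W: "fd_vectorspace W" and P': "grading W P'"
    and h: "h \<in> module_hom CC V W" and v: "v \<in> carrier V"
    and off: "\<And>i k v. i - k \<noteq> T \<Longrightarrow> v \<in> carrier V \<Longrightarrow> P' i (h (P k v)) = \<zero>\<^bsub>W\<^esub>"
  shows "h (P k v) = P' (k + T) (h v)"
proof (rule dual_ext[OF W])
  note Wv = fd_vs[OF W]
  have c: "h (P j v) \<in> carrier W" for j by (rule hom_closed[OF h grading_closed[OF P v]])
  show "h (P k v) \<in> carrier W" "P' (k + T) (h v) \<in> carrier W"
    using c grading_closed[OF P' hom_closed[OF h v]] by auto
  fix f assume f: "f \<in> dual W"
  let ?S = "insert (k + T) (weight_support W P')" and ?R = "insert k (weight_support V P)"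
  have S: "finite ?S" "weight_support W P' \<subseteq> ?S" and R: "finite ?R" "weight_support V P \<subseteq> ?R"
    using grading_finite[OF P] grading_finite[OF P'] by auto
  have "f (h (P k v)) = (\<Sum>i\<in>?S. f (P' i (h (P k v))))"
    using grading_dual_sum[OF Wv P' f c S] by simp
  also have "\<dots> = (\<Sum>i\<in>?S. if i = k + T then f (P' (k + T) (h (P k v))) else 0)"
    by (rule sum.cong) (auto simp: off[OF _ v] dual_zero[OF Wv f])
  also have "\<dots> = f (P' (k + T) (h (P k v)))" using S(1) by simp
  also have "\<dots> = (\<Sum>j\<in>?R. if j = k then f (P' (k + T) (h (P k v))) else 0)" using R(1) by simp
  also have "\<dots> = (\<Sum>j\<in>?R. f (P' (k + T) (h (P j v))))"
    by (rule sum.cong) (auto simp: off[OF _ v] dual_zero[OF Wv f])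
  also have "\<dots> = f (P' (k + T) (h v))"
    by (rule grading_dual_sum[OF V P hom_comp[OF h hom_comp[OF grading_hom[OF P', of "k + T"] f]] v R])
  finally show "f (h (P k v)) = f (P' (k + T) (h v))" .
qed

text \<open>
  A grading that induces the action \<open>t\<close>. The action determines it on the carrier of \<open>V\<close>
  (\<open>weights_torus_of\<close>), so the choice affects only values outside it.
\<close>

definition weights :: "(complex, 'v) module \<Rightarrow> (complex \<Rightarrow> 'v \<Rightarrow> 'v) \<Rightarrow> int \<Rightarrow> 'v \<Rightarrow> 'v" where
  "weights V t = (SOME P. grading V P \<and> (\<forall>z v. z \<noteq> 0 \<longrightarrow> v \<in> carrier V \<longrightarrow> t z v = torus_of V P z v))"

lemma weights:
  assumes "fd_vectorspace V" "algebraic_hom_GL V t"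
  shows weights_grading: "grading V (weights V t)"
    and weights_torus: "z \<noteq> 0 \<Longrightarrow> v \<in> carrier V \<Longrightarrow> t z v = torus_of V (weights V t) z v"
  using someI_ex[OF algebraic_grading_exists[OF assms]] unfolding weights_def by blast+

lemma weights_torus_of:
  assumes V: "fd_vectorspace V" and P: "grading V P" and v: "v \<in> carrier V"
  shows "weights V (torus_of V P) k v = P k v"
proof -
  let ?t = "torus_of V P"
  note a = torus_of_algebraic[OF V P]
  have h: "(\<lambda>v. v) \<in> module_hom CC V V" by (rule homI) auto
  show ?thesis
    using intertwine0_iff[OF fd_vs[OF V] weights_grading[OF V a] V P h v v] weights_torus[OF V a _ v] by simp
qed

text \<open>
  A grading restricts to a direct summand \<open>W\<close> of \<open>V\<close> that is stable under the projections; the inclusion \<open>j\<close>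
  and the retraction \<open>r\<close> exhibit the summand.
\<close>

lemma grading_split:
  assumes V: "vectorspace CC V" and P: "grading V P" and W: "fd_vectorspace W"
    and j: "j \<in> module_hom CC W V" and r: "r \<in> module_hom CC V W"
    and rj: "\<And>w. w \<in> carrier W \<Longrightarrow> r (j w) = w"
    and stable: "\<And>i w. w \<in> carrier W \<Longrightarrow> j (r (P i (j w))) = P i (j w)"
  shows "grading W (\<lambda>i w. r (P i (j w)))"
proof (rule gradingI[OF W, of _ "weight_support V P"])
  note Wv = fd_vs[OF W]
  note jc = hom_closed[OF j]
  show "(\<lambda>w. r (P i (j w))) \<in> module_hom CC W W" for i
    by (intro hom_comp[OF _ r] hom_comp[OF j] grading_hom[OF P])
  show "finite (weight_support V P)" by (rule grading_finite[OF P])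
  show "r (P i (j w)) = \<zero>\<^bsub>W\<^esub>" if "i \<notin> weight_support V P" "w \<in> carrier W" for i w
    using weight_support_zero[OF that(1) jc[OF that(2)]] hom_zero[OF V Wv r] by simp
  show "r (P i (j (r (P k (j w))))) = \<zero>\<^bsub>W\<^esub>" if "i \<noteq> k" "w \<in> carrier W" for i k w
    using stable[OF that(2)] grading_orth[OF P that(1) jc[OF that(2)]] hom_zero[OF V Wv r] by simp
  show "(\<Sum>i\<in>weight_support V P. f (r (P i (j w)))) = f w" if "f \<in> dual W" "w \<in> carrier W" for f w
    using grading_dual_sum[OF V P hom_comp[OF r that(1)] jc[OF that(2)] grading_finite[OF P] subset_refl]
      rj[OF that(2)] by simp
qed

lemma grading_direct_sum:
  assumes M: "\<And>x. x \<in> I \<Longrightarrow> fd_vectorspace (M x)" and I: "finite I"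
    and P: "\<And>x. x \<in> I \<Longrightarrow> grading (M x) (P x)"
  shows "grading (direct_sum_fam I M) (\<lambda>i v. \<lambda>x\<in>I. P x i (v x))"
proof (rule gradingI[OF direct_sum_fd[OF M I], where S = "\<Union>x\<in>I. weight_support (M x) (P x)"])
  let ?D = "direct_sum_fam I M" and ?S = "\<Union>x\<in>I. weight_support (M x) (P x)"
  let ?P = "\<lambda>i v. \<lambda>x\<in>I. P x i (v x)"
  have Mv: "\<And>x. x \<in> I \<Longrightarrow> vectorspace CC (M x)" using M fd_vs by blast
  have D: "vectorspace CC ?D" by (rule direct_sum_vs[OF Mv])
  have coordI: "v x \<in> carrier (M x)" if "v \<in> (\<Pi>\<^sub>E x\<in>I. carrier (M x))" "x \<in> I" for v x
    using that by auto
  show hom: "?P i \<in> module_hom CC ?D ?D" for i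
    by (rule homI) (auto simp: direct_sum_simps fun_eq_iff coordI grading_closed[OF P]
        hom_add[OF grading_hom[OF P]] hom_smult[OF grading_hom[OF P]])
  show fin: "finite ?S" using I grading_finite[OF P] by auto
  show "?P i v = \<zero>\<^bsub>?D\<^esub>" if "i \<notin> ?S" "v \<in> carrier ?D" for i v
  proof -
    have "P x i (v x) = \<zero>\<^bsub>M x\<^esub>" if "x \<in> I" for x
      using weight_support_zero[of i "M x" "P x" "v x"] \<open>i \<notin> ?S\<close> \<open>v \<in> carrier ?D\<close> that
      by (auto simp: direct_sum_simps coordI)
    then show ?thesis by (auto simp: direct_sum_simps fun_eq_iff)
  qed
  show "?P i (?P k v) = \<zero>\<^bsub>?D\<^esub>" if "i \<noteq> k" "v \<in> carrier ?D" for i k v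
    using that by (auto simp: direct_sum_simps fun_eq_iff coordI grading_orth[OF P])
  show "(\<Sum>i\<in>?S. f (?P i v)) = f v" if f: "f \<in> dual ?D" and v: "v \<in> carrier ?D" for f v
  proof -
    let ?i = "coord_inj I M"
    have vx: "v x \<in> carrier (M x)" if "x \<in> I" for x using v that by (auto simp: direct_sum_simps)
    have ih: "?i x \<in> module_hom CC (M x) ?D" if "x \<in> I" for x
      using coord_inj_hom[of I M x] Mv that by blast
    have decomp: "f u = (\<Sum>x\<in>I. f (?i x (u x)))" if u: "u \<in> carrier ?D" for u
    proof -
      have ux: "u x \<in> carrier (M x)" if "x \<in> I" for x using u that by (auto simp: direct_sum_simps)
      have "f u = f (\<Oplus>\<^bsub>?D\<^esub>x\<in>I. ?i x (u x))" using direct_sum_decomp[of I M u] Mv I u by simp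
      also have "\<dots> = (\<Sum>x\<in>I. f (?i x (u x)))"
        by (intro dual_finsum[OF D f] hom_closed[OF ih ux])
      finally show ?thesis .
    qed
    have "(\<Sum>i\<in>?S. f (?P i v)) = (\<Sum>i\<in>?S. \<Sum>x\<in>I. f (?i x (P x i (v x))))"
    proof (rule sum.cong)
      fix i
      have "f (?P i v) = (\<Sum>x\<in>I. f (?i x (?P i v x)))" by (rule decomp[OF hom_closed[OF hom v]])
      then show "f (?P i v) = (\<Sum>x\<in>I. f (?i x (P x i (v x))))" by simp
    qed simp
    also have "\<dots> = (\<Sum>x\<in>I. \<Sum>i\<in>?S. f (?i x (P x i (v x))))" by (rule sum.swap)
    also have "\<dots> = (\<Sum>x\<in>I. f (?i x (v x)))"
      using fin by (intro sum.cong refl grading_dual_sum[OF Mv P hom_comp[OF ih f] vx]) auto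
    also have "\<dots> = f v" using decomp[OF v] by simp
    finally show ?thesis .
  qed
qed

section \<open>Fully faithful and essentially surjective functors\<close>

lemma categoryD:
  assumes "is_category C"
  shows cat_id: "X \<in> obj C \<Longrightarrow> idn C X \<in> Hom C X X"
    and cat_comp: "X \<in> obj C \<Longrightarrow> Y \<in> obj C \<Longrightarrow> Z \<in> obj C \<Longrightarrow> f \<in> Hom C X Y \<Longrightarrow> g \<in> Hom C Y Z \<Longrightarrow>
      cmp C X Y Z g f \<in> Hom C X Z"
    and cat_id_left: "X \<in> obj C \<Longrightarrow> Y \<in> obj C \<Longrightarrow> f \<in> Hom C X Y \<Longrightarrow> cmp C X Y Y (idn C Y) f = f"
    and cat_assoc: "W \<in> obj C \<Longrightarrow> X \<in> obj C \<Longrightarrow> Y \<in> obj C \<Longrightarrow> Z \<in> obj C \<Longrightarrow>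
      f \<in> Hom C W X \<Longrightarrow> g \<in> Hom C X Y \<Longrightarrow> h \<in> Hom C Y Z \<Longrightarrow>
      cmp C W X Z (cmp C X Y Z h g) f = cmp C W Y Z h (cmp C W X Y g f)"
  using assms unfolding is_category_def by simp_all

lemma functorD:
  assumes "is_functor C D F"
  shows fun_obj: "X \<in> obj C \<Longrightarrow> on_obj F X \<in> obj D"
    and fun_hom: "X \<in> obj C \<Longrightarrow> Y \<in> obj C \<Longrightarrow> f \<in> Hom C X Y \<Longrightarrow>
      on_hom F X Y f \<in> Hom D (on_obj F X) (on_obj F Y)"
    and fun_id: "X \<in> obj C \<Longrightarrow> on_hom F X X (idn C X) = idn D (on_obj F X)"
    and fun_comp: "X \<in> obj C \<Longrightarrow> Y \<in> obj C \<Longrightarrow> Z \<in> obj C \<Longrightarrow> f \<in> Hom C X Y \<Longrightarrow> g \<in> Hom C Y Z \<Longrightarrow>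
      on_hom F X Z (cmp C X Y Z g f) =
        cmp D (on_obj F X) (on_obj F Y) (on_obj F Z) (on_hom F Y Z g) (on_hom F X Y f)"
  using assms unfolding is_functor_def by simp_all

text \<open>
  The quasi-inverse picks for each object \<open>Y\<close> an object \<open>G0 Y\<close> with an isomorphism \<open>e Y\<close> from its image to \<open>Y\<close>,
  and sends a morphism \<open>g\<close> to the unique preimage of its conjugate by these isomorphisms. All equations
  in the source category are checked after applying the faithful functor.
\<close>

lemma equivalent_categoriesI:
  assumes C: "is_category C" and D: "is_category D" and F: "is_functor C D F"
    and full: "\<And>X Y g. X \<in> obj C \<Longrightarrow> Y \<in> obj C \<Longrightarrow> g \<in> Hom D (on_obj F X) (on_obj F Y) \<Longrightarrow>
        \<exists>f\<in>Hom C X Y. on_hom F X Y f = g"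
    and faithful: "\<And>X Y f f'. X \<in> obj C \<Longrightarrow> Y \<in> obj C \<Longrightarrow> f \<in> Hom C X Y \<Longrightarrow> f' \<in> Hom C X Y \<Longrightarrow>
        on_hom F X Y f = on_hom F X Y f' \<Longrightarrow> f = f'"
    and surj: "\<And>Y. Y \<in> obj D \<Longrightarrow> \<exists>X\<in>obj C. \<exists>e. is_isomorphism D (on_obj F X) Y e"
  shows "equivalent_categories C D"
proof -
  let ?F = "on_obj F"
  note F0 = fun_obj[OF F] and F1 = fun_hom[OF F] and Fid = fun_id[OF F] and Fc = fun_comp[OF F]
  note Cc = cat_comp[OF C] and Dc = cat_comp[OF D]
  obtain G0 where G0: "\<And>Y. Y \<in> obj D \<Longrightarrow> G0 Y \<in> obj C"
    and G0e: "\<And>Y. Y \<in> obj D \<Longrightarrow> \<exists>e. is_isomorphism D (?F (G0 Y)) Y e"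
    using surj by metis
  from G0e obtain e where e': "\<And>Y. Y \<in> obj D \<Longrightarrow> is_isomorphism D (?F (G0 Y)) Y (e Y)" by metis
  have e: "e Y \<in> Hom D (?F (G0 Y)) Y" if "Y \<in> obj D" for Y
    using e'[OF that] by (simp add: is_isomorphism_def)
  have "\<exists>i\<in>Hom D Y (?F (G0 Y)). cmp D (?F (G0 Y)) Y (?F (G0 Y)) i (e Y) = idn D (?F (G0 Y)) \<and>
      cmp D Y (?F (G0 Y)) Y (e Y) i = idn D Y" if "Y \<in> obj D" for Y
    using e'[OF that] by (simp add: is_isomorphism_def)
  then obtain i where i: "\<And>Y. Y \<in> obj D \<Longrightarrow> i Y \<in> Hom D Y (?F (G0 Y))"
    and ie: "\<And>Y. Y \<in> obj D \<Longrightarrow> cmp D (?F (G0 Y)) Y (?F (G0 Y)) (i Y) (e Y) = idn D (?F (G0 Y))"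
    and ei: "\<And>Y. Y \<in> obj D \<Longrightarrow> cmp D Y (?F (G0 Y)) Y (e Y) (i Y) = idn D Y"
    by metis
  define pre where "pre X Y g = (SOME f. f \<in> Hom C X Y \<and> on_hom F X Y f = g)" for X Y g
  have pre: "pre X Y g \<in> Hom C X Y" "on_hom F X Y (pre X Y g) = g"
    if "X \<in> obj C" "Y \<in> obj C" "g \<in> Hom D (?F X) (?F Y)" for X Y g
    using someI_ex[of "\<lambda>f. f \<in> Hom C X Y \<and> on_hom F X Y f = g"] full[OF that]
    unfolding pre_def by blast+
  define conj where "conj Y Z g =
     cmp D (?F (G0 Y)) Z (?F (G0 Z)) (i Z) (cmp D (?F (G0 Y)) Y Z g (e Y))" for Y Z g
  have conj: "conj Y Z g \<in> Hom D (?F (G0 Y)) (?F (G0 Z))"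
    if "Y \<in> obj D" "Z \<in> obj D" "g \<in> Hom D Y Z" for Y Z g
    unfolding conj_def using that by (intro Dc[of _ Z] Dc[of _ Y] F0 G0 e i)
  \<comment> \<open>This is the naturality of the isomorphisms \<open>e\<close>.\<close>
  have e_conj: "cmp D (?F (G0 Y)) (?F (G0 Z)) Z (e Z) (conj Y Z g) = cmp D (?F (G0 Y)) Y Z g (e Y)"
    if Y: "Y \<in> obj D" and Z: "Z \<in> obj D" and g: "g \<in> Hom D Y Z" for Y Z g
  proof -
    let ?ge = "cmp D (?F (G0 Y)) Y Z g (e Y)"
    have ge: "?ge \<in> Hom D (?F (G0 Y)) Z" by (intro Dc[of _ Y] F0 G0 e Y Z g)
    have "cmp D (?F (G0 Y)) (?F (G0 Z)) Z (e Z) (conj Y Z g) =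
        cmp D (?F (G0 Y)) Z Z (cmp D Z (?F (G0 Z)) Z (e Z) (i Z)) ?ge"
      unfolding conj_def by (rule cat_assoc[OF D, symmetric]) (intro F0 G0 e i Y Z ge)+
    also have "\<dots> = ?ge" unfolding ei[OF Z] by (rule cat_id_left[OF D]) (intro F0 G0 Y Z ge)+
    finally show ?thesis .
  qed
  have e_cancel: "g = g'" if "W \<in> obj D" "Y \<in> obj D" "g \<in> Hom D W (?F (G0 Y))" "g' \<in> Hom D W (?F (G0 Y))"
    "cmp D W (?F (G0 Y)) Y (e Y) g = cmp D W (?F (G0 Y)) Y (e Y) g'" for W Y g g'
  proof -
    have "g = cmp D W Y (?F (G0 Y)) (i Y) (cmp D W (?F (G0 Y)) Y (e Y) g)"
      if "g \<in> Hom D W (?F (G0 Y))" for g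
      using cat_assoc[OF D \<open>W \<in> obj D\<close> F0[OF G0[OF \<open>Y \<in> obj D\<close>]] \<open>Y \<in> obj D\<close>
          F0[OF G0[OF \<open>Y \<in> obj D\<close>]] that e[OF \<open>Y \<in> obj D\<close>] i[OF \<open>Y \<in> obj D\<close>]]
        ie[OF \<open>Y \<in> obj D\<close>] cat_id_left[OF D \<open>W \<in> obj D\<close> F0[OF G0[OF \<open>Y \<in> obj D\<close>]] that] by simp
    then show ?thesis using that by metis
  qed
  define G where "G = \<lparr>on_obj = G0, on_hom = (\<lambda>Y Z g. pre (G0 Y) (G0 Z) (conj Y Z g))\<rparr>"
  have G1: "on_hom G Y Z g \<in> Hom C (G0 Y) (G0 Z)" "on_hom F (G0 Y) (G0 Z) (on_hom G Y Z g) = conj Y Z g"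
    if "Y \<in> obj D" "Z \<in> obj D" "g \<in> Hom D Y Z" for Y Z g
    using pre[OF G0[OF that(1)] G0[OF that(2)] conj[OF that]] by (simp_all add: G_def)
  have Gobj: "on_obj G Y = G0 Y" for Y by (simp add: G_def)
  have "is_functor D C G"
    unfolding is_functor_def Gobj
  proof (intro conjI ballI)
    fix Y assume Y: "Y \<in> obj D"
    show "G0 Y \<in> obj C" by (rule G0[OF Y])
    have idY: "idn D Y \<in> Hom D Y Y" by (rule cat_id[OF D Y])
    have "conj Y Y (idn D Y) = idn D (?F (G0 Y))"
      unfolding conj_def using cat_id_left[OF D F0[OF G0[OF Y]] Y e[OF Y]] ie[OF Y] by simp
    then have "on_hom F (G0 Y) (G0 Y) (on_hom G Y Y (idn D Y)) = on_hom F (G0 Y) (G0 Y) (idn C (G0 Y))"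
      using G1[OF Y Y idY] Fid[OF G0[OF Y]] by simp
    then show "on_hom G Y Y (idn D Y) = idn C (G0 Y)"
      by (rule faithful[OF G0[OF Y] G0[OF Y] G1(1)[OF Y Y idY] cat_id[OF C G0[OF Y]]])
  next
    fix Y Z g assume "Y \<in> obj D" "Z \<in> obj D" "g \<in> Hom D Y Z"
    then show "on_hom G Y Z g \<in> Hom C (G0 Y) (G0 Z)" by (rule G1(1))
  next
    fix X Y Z f g assume X: "X \<in> obj D" and Y: "Y \<in> obj D" and Z: "Z \<in> obj D"
      and f: "f \<in> Hom D X Y" and g: "g \<in> Hom D Y Z"
    note O = X Y Z F0[OF G0[OF X]] F0[OF G0[OF Y]] F0[OF G0[OF Z]]
    have gf: "cmp D X Y Z g f \<in> Hom D X Z" by (rule Dc[OF X Y Z f g])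
    let ?FX = "?F (G0 X)" and ?FY = "?F (G0 Y)" and ?FZ = "?F (G0 Z)"
    have "conj X Z (cmp D X Y Z g f) = cmp D ?FX ?FY ?FZ (conj Y Z g) (conj X Y f)"
    proof (rule e_cancel[OF O(4) Z])
      show "conj X Z (cmp D X Y Z g f) \<in> Hom D ?FX ?FZ" by (rule conj[OF X Z gf])
      show "cmp D ?FX ?FY ?FZ (conj Y Z g) (conj X Y f) \<in> Hom D ?FX ?FZ"
        by (rule Dc[OF O(4,5,6) conj[OF X Y f] conj[OF Y Z g]])
      have "cmp D ?FX ?FZ Z (e Z) (cmp D ?FX ?FY ?FZ (conj Y Z g) (conj X Y f)) =
          cmp D ?FX ?FY Z (cmp D ?FY ?FZ Z (e Z) (conj Y Z g)) (conj X Y f)"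
        by (rule cat_assoc[OF D O(4,5,6) Z conj[OF X Y f] conj[OF Y Z g] e[OF Z], symmetric])
      also have "\<dots> = cmp D ?FX ?FY Z (cmp D ?FY Y Z g (e Y)) (conj X Y f)"
        by (simp only: e_conj[OF Y Z g])
      also have "\<dots> = cmp D ?FX Y Z g (cmp D ?FX ?FY Y (e Y) (conj X Y f))"
        by (rule cat_assoc[OF D O(4,5) Y Z conj[OF X Y f] e[OF Y] g])
      also have "\<dots> = cmp D ?FX Y Z g (cmp D ?FX X Y f (e X))"
        by (simp only: e_conj[OF X Y f])
      also have "\<dots> = cmp D ?FX X Z (cmp D X Y Z g f) (e X)"
        by (rule cat_assoc[OF D O(4) X Y Z e[OF X] f g, symmetric])
      also have "\<dots> = cmp D ?FX ?FZ Z (e Z) (conj X Z (cmp D X Y Z g f))"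
        by (rule e_conj[OF X Z gf, symmetric])
      finally show "cmp D ?FX ?FZ Z (e Z) (conj X Z (cmp D X Y Z g f)) =
          cmp D ?FX ?FZ Z (e Z) (cmp D ?FX ?FY ?FZ (conj Y Z g) (conj X Y f))" by simp
    qed
    then have eq: "on_hom F (G0 X) (G0 Z) (on_hom G X Z (cmp D X Y Z g f)) =
        on_hom F (G0 X) (G0 Z) (cmp C (G0 X) (G0 Y) (G0 Z) (on_hom G Y Z g) (on_hom G X Y f))"
      using G1[OF X Z gf] G1[OF X Y f] G1[OF Y Z g] Fc[OF G0[OF X] G0[OF Y] G0[OF Z]] by simp
    show "on_hom G X Z (cmp D X Y Z g f) =
        cmp C (G0 X) (G0 Y) (G0 Z) (on_hom G Y Z g) (on_hom G X Y f)"
      by (rule faithful[OF G0[OF X] G0[OF Z] G1(1)[OF X Z gf] _ eq])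
        (rule Cc[OF G0[OF X] G0[OF Y] G0[OF Z] G1(1)[OF X Y f] G1(1)[OF Y Z g]])
  qed
  moreover have "naturally_isomorphic D D (comp_functor F G) id_functor"
    unfolding naturally_isomorphic_def
  proof (intro exI[of _ e] conjI ballI)
    fix Y assume "Y \<in> obj D"
    then show "is_isomorphism D (on_obj (comp_functor F G) Y) (on_obj id_functor Y) (e Y)"
      using e' by (simp add: comp_functor_def id_functor_def Gobj)
  next
    fix Y Z g assume "Y \<in> obj D" "Z \<in> obj D" "g \<in> Hom D Y Z"
    then show "cmp D (on_obj (comp_functor F G) Y) (on_obj (comp_functor F G) Z) (on_obj id_functor Z)
        (e Z) (on_hom (comp_functor F G) Y Z g) =
       cmp D (on_obj (comp_functor F G) Y) (on_obj id_functor Y) (on_obj id_functor Z)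
        (on_hom id_functor Y Z g) (e Y)"
      using e_conj G1 by (simp add: comp_functor_def id_functor_def Gobj)
  qed
  moreover have "naturally_isomorphic C C (comp_functor G F) id_functor"
    unfolding naturally_isomorphic_def
  proof (intro exI[of _ "\<lambda>X. pre (G0 (?F X)) X (e (?F X))"] conjI ballI)
    fix X assume X: "X \<in> obj C"
    let ?G = "G0 (?F X)" and ?a = "pre (G0 (?F X)) X (e (?F X))" and ?b = "pre X (G0 (?F X)) (i (?F X))"
    note FX = F0[OF X] and GX = G0[OF F0[OF X]]
    note a = pre[OF GX X e[OF FX]] and b = pre[OF X GX i[OF FX]]
    have "cmp C ?G X ?G ?b ?a = idn C ?G"
      by (rule faithful[OF GX GX Cc[OF GX X GX a(1) b(1)] cat_id[OF C GX]])
        (simp add: Fc[OF GX X GX a(1) b(1)] a b Fid[OF GX] ie[OF FX])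
    moreover have "cmp C X ?G X ?a ?b = idn C X"
      by (rule faithful[OF X X Cc[OF X GX X b(1) a(1)] cat_id[OF C X]])
        (simp add: Fc[OF X GX X b(1) a(1)] a b Fid[OF X] ei[OF FX])
    ultimately show "is_isomorphism C (on_obj (comp_functor G F) X) (on_obj id_functor X) ?a"
      using a(1) b(1) by (auto simp: is_isomorphism_def comp_functor_def id_functor_def Gobj)
  next
    fix X Y f assume X: "X \<in> obj C" and Y: "Y \<in> obj C" and f: "f \<in> Hom C X Y"
    note FX = F0[OF X] and GX = G0[OF F0[OF X]] and FY = F0[OF Y] and GY = G0[OF F0[OF Y]]
    note Ff = F1[OF X Y f]
    note a = pre[OF GX X e[OF FX]] and b = pre[OF GY Y e[OF FY]] and c = G1[OF FX FY Ff]
    let ?a = "pre (G0 (?F X)) X (e (?F X))" and ?b = "pre (G0 (?F Y)) Y (e (?F Y))"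
    let ?c = "on_hom G (?F X) (?F Y) (on_hom F X Y f)"
    have "cmp C (G0 (?F X)) (G0 (?F Y)) Y ?b ?c = cmp C (G0 (?F X)) X Y f ?a"
      by (rule faithful[OF GX Y Cc[OF GX GY Y c(1) b(1)] Cc[OF GX X Y a(1) f]])
        (simp add: Fc[OF GX GY Y c(1) b(1)] Fc[OF GX X Y a(1) f] a b c e_conj[OF FX FY Ff])
    then show "cmp C (on_obj (comp_functor G F) X) (on_obj (comp_functor G F) Y) (on_obj id_functor Y)
        ?b (on_hom (comp_functor G F) X Y f) =
       cmp C (on_obj (comp_functor G F) X) (on_obj id_functor X) (on_obj id_functor Y)
        (on_hom id_functor X Y f) ?a"
      by (simp add: comp_functor_def id_functor_def Gobj)
  qed
  ultimately show ?thesis using C D F unfolding equivalent_categories_def by blast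
qed

section \<open>Representations, equivariant modules and the path algebra\<close>

lemma repD:
  assumes "is_rep Q M"
  shows rep_fd: "x \<in> verts Q \<Longrightarrow> fd_vectorspace (space M x)"
    and rep_arrow: "a \<in> arcs Q \<Longrightarrow> arrow M a \<in> module_hom CC (space M (tail Q a)) (space M (head Q a))"
  using assms by (auto simp: is_rep_def)

lemma lin_hom: "f \<in> lin V W \<Longrightarrow> f \<in> module_hom CC V W"
  and lin_ext: "f \<in> lin V W \<Longrightarrow> f \<in> extensional (carrier V)"
  by (simp_all add: lin_def)

lemma restrict_lin:
  assumes "vectorspace CC V" "f \<in> module_hom CC V W"
  shows "restrict f (carrier V) \<in> lin V W"
  using hom_cong[OF assms(2) _ assms(1), of "restrict f (carrier V)"] by (simp add: lin_def)

lemma compose_lin: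
  assumes "vectorspace CC U" "f \<in> lin U V" "g \<in> lin V W"
  shows "compose (carrier U) g f \<in> lin U W"
  using restrict_lin[OF assms(1) hom_comp[OF lin_hom[OF assms(2)] lin_hom[OF assms(3)]]]
  by (simp add: compose_def)

lemma rep_homD:
  assumes "\<phi> \<in> rep_hom Q M N"
  shows rep_hom_lin: "x \<in> verts Q \<Longrightarrow> \<phi> x \<in> lin (space M x) (space N x)"
    and rep_hom_arrow: "a \<in> arcs Q \<Longrightarrow> v \<in> carrier (space M (tail Q a)) \<Longrightarrow>
      \<phi> (head Q a) (arrow M a v) = arrow N a (\<phi> (tail Q a) v)"
    and rep_hom_PiE: "\<phi> \<in> (\<Pi>\<^sub>E x\<in>verts Q. lin (space M x) (space N x))"
    and rep_hom_closed: "x \<in> verts Q \<Longrightarrow> v \<in> carrier (space M x) \<Longrightarrow> \<phi> x v \<in> carrier (space N x)"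
  using assms by (auto simp: rep_hom_def lin_def dest!: PiE_mem intro: hom_closed)

lemma rep_hom_eqI:
  assumes "\<phi> \<in> rep_hom Q M N" "\<psi> \<in> rep_hom Q M N"
    and "\<And>x v. x \<in> verts Q \<Longrightarrow> v \<in> carrier (space M x) \<Longrightarrow> \<phi> x v = \<psi> x v"
  shows "\<phi> = \<psi>"
proof (rule PiE_ext[OF rep_hom_PiE[OF assms(1)] rep_hom_PiE[OF assms(2)]])
  fix x assume x: "x \<in> verts Q"
  show "\<phi> x = \<psi> x"
    by (rule extensionalityI[OF lin_ext[OF rep_hom_lin[OF assms(1) x]] lin_ext[OF rep_hom_lin[OF assms(2) x]]])
      (rule assms(3)[OF x])
qed

abbreviation single :: "'a \<Rightarrow> complex \<Rightarrow> ('a \<Rightarrow>\<^sub>0 complex)" where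
  "single \<equiv> Poly_Mapping.single"

lemma path_algebra_simps:
  "carrier (path_algebra Q) = {f. Poly_Mapping.keys f \<subseteq> quiver_paths Q}"
  "f \<oplus>\<^bsub>path_algebra Q\<^esub> g = f + g"
  "c \<odot>\<^bsub>path_algebra Q\<^esub> f = Poly_Mapping.map ((*) c) f"
  "\<one>\<^bsub>path_algebra Q\<^esub> = (\<Sum>x\<in>verts Q. trivial_path x)"
  "\<zero>\<^bsub>path_algebra Q\<^esub> = 0"
  by (simp_all add: path_algebra_def)

lemma path_algebra_mult:
  "f \<otimes>\<^bsub>path_algebra Q\<^esub> g = (\<Sum>q\<in>Poly_Mapping.keys f. \<Sum>p\<in>Poly_Mapping.keys g.
     path_product Q q p (Poly_Mapping.lookup f q * Poly_Mapping.lookup g p))"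
  by (simp add: path_algebra_def)

lemma smult_single: "c \<odot>\<^bsub>path_algebra Q\<^esub> single p d = single p (c * d)"
  by (simp add: path_algebra_simps)

lemma lookup_smult:
  "Poly_Mapping.lookup (c \<odot>\<^bsub>path_algebra Q\<^esub> f) p = c * Poly_Mapping.lookup f p"
  by (simp add: path_algebra_simps Poly_Mapping.map.rep_eq when_def)

lemma mult_single:
  "single q c \<otimes>\<^bsub>path_algebra Q\<^esub> single p d = path_product Q q p (c * d)"
proof -
  have "path_product Q q p 0 = 0" by (cases p; cases q) (simp add: path_product_def)
  then show ?thesis by (cases "c = 0"; cases "d = 0") (simp_all add: path_algebra_mult)
qed

lemma fd_moduleD:
  assumes "is_fd_module A V \<rho>"
  shows fdm_fd: "fd_vectorspace V"
    and fdm_hom: "a \<in> carrier A \<Longrightarrow> \<rho> a \<in> module_hom CC V V"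
    and fdm_add: "a \<in> carrier A \<Longrightarrow> b \<in> carrier A \<Longrightarrow> v \<in> carrier V \<Longrightarrow> \<rho> (a \<oplus>\<^bsub>A\<^esub> b) v = \<rho> a v \<oplus>\<^bsub>V\<^esub> \<rho> b v"
    and fdm_smult: "a \<in> carrier A \<Longrightarrow> v \<in> carrier V \<Longrightarrow> \<rho> (c \<odot>\<^bsub>A\<^esub> a) v = c \<odot>\<^bsub>V\<^esub> \<rho> a v"
    and fdm_mult: "a \<in> carrier A \<Longrightarrow> b \<in> carrier A \<Longrightarrow> v \<in> carrier V \<Longrightarrow> \<rho> (a \<otimes>\<^bsub>A\<^esub> b) v = \<rho> a (\<rho> b v)"
    and fdm_one: "v \<in> carrier V \<Longrightarrow> \<rho> \<one>\<^bsub>A\<^esub> v = v"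
  using assms by (simp_all add: is_fd_module_def)

lemma equiv_moduleD:
  assumes "is_equiv_module A \<alpha> M"
  shows eqm_module: "is_fd_module A (vspace M) (act M)"
    and eqm_algebraic: "algebraic_hom_GL (vspace M) (gm_act M)"
    and eqm_equivariant: "z \<noteq> 0 \<Longrightarrow> a \<in> carrier A \<Longrightarrow> m \<in> carrier (vspace M) \<Longrightarrow>
      act M (\<alpha> z a) (gm_act M z m) = gm_act M z (act M a m)"
  using assms by (simp_all add: is_equiv_module_def)

lemma equiv_homD:
  assumes "f \<in> equiv_module_hom A M N"
  shows eqh_lin: "f \<in> lin (vspace M) (vspace N)"
    and eqh_act: "a \<in> carrier A \<Longrightarrow> m \<in> carrier (vspace M) \<Longrightarrow> f (act M a m) = act N a (f m)"
    and eqh_gm: "z \<noteq> 0 \<Longrightarrow> m \<in> carrier (vspace M) \<Longrightarrow> f (gm_act M z m) = gm_act N z (f m)"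
  using assms by (simp_all add: equiv_module_hom_def)

lemma Equiv_Mod_category: "is_category (Equiv_Mod A \<alpha>)"
proof -
  have ext: "f \<in> extensional (carrier (vspace X)) \<and> f \<in> carrier (vspace X) \<rightarrow> carrier (vspace Y)"
    if "f \<in> equiv_module_hom A X Y" for f X Y
    using eqh_lin[OF that] hom_closed[OF lin_hom[OF eqh_lin[OF that]]] lin_ext[OF eqh_lin[OF that]] by auto
  have V: "vectorspace CC (vspace X)" if "is_equiv_module A \<alpha> X" for X
    by (rule fd_vs[OF fdm_fd[OF eqm_module[OF that]]])
  have act: "act X a m \<in> carrier (vspace X)"
    if "is_equiv_module A \<alpha> X" "a \<in> carrier A" "m \<in> carrier (vspace X)" for X a m
    using hom_closed[OF fdm_hom[OF eqm_module[OF that(1)] that(2)] that(3)] .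
  have gm: "gm_act X z m \<in> carrier (vspace X)"
    if "is_equiv_module A \<alpha> X" "z \<noteq> 0" "m \<in> carrier (vspace X)" for X z m
    using hom_closed[OF algebraic_hom[OF eqm_algebraic[OF that(1)] that(2)] that(3)] .
  have id: "(\<lambda>v\<in>carrier (vspace X). v) \<in> equiv_module_hom A X X" if X: "is_equiv_module A \<alpha> X" for X
  proof -
    have "(\<lambda>v\<in>carrier (vspace X). v) \<in> lin (vspace X) (vspace X)"
      by (rule restrict_lin[OF V[OF X]]) (rule homI, auto)
    then show ?thesis using act[OF X] gm[OF X] by (simp add: equiv_module_hom_def)
  qed
  have comp: "compose (carrier (vspace X)) g f \<in> equiv_module_hom A X Z"
    if X: "is_equiv_module A \<alpha> X" and f: "f \<in> equiv_module_hom A X Y" and g: "g \<in> equiv_module_hom A Y Z" for X Y Z f g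
    using compose_lin[OF V[OF X] eqh_lin[OF f] eqh_lin[OF g]] act[OF X] gm[OF X]
      hom_closed[OF lin_hom[OF eqh_lin[OF f]]] eqh_act[OF f] eqh_act[OF g] eqh_gm[OF f] eqh_gm[OF g]
    by (simp add: equiv_module_hom_def compose_def)
  show ?thesis
    unfolding is_category_def Equiv_Mod_def
  proof (simp, intro conjI ballI allI impI)
    fix X Y f assume "f \<in> equiv_module_hom A X Y"
    then have f: "f \<in> carrier (vspace X) \<rightarrow> carrier (vspace Y)" "f \<in> extensional (carrier (vspace X))"
      using ext by blast+
    show "compose (carrier (vspace X)) f (\<lambda>v\<in>carrier (vspace X). v) = f"
      by (rule compose_Id[OF f])
    show "compose (carrier (vspace X)) (\<lambda>v\<in>carrier (vspace Y). v) f = f"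
      by (rule Id_compose[OF f])
  next
    fix W X Y Z f g h
    assume "f \<in> equiv_module_hom A W X"
    then have "f \<in> carrier (vspace W) \<rightarrow> carrier (vspace X)" using ext by blast
    then show "compose (carrier (vspace W)) h (compose (carrier (vspace W)) g f) =
        compose (carrier (vspace W)) (compose (carrier (vspace X)) h g) f"
      by (rule compose_assoc)
  qed (use id comp in auto)
qed

section \<open>Graded representations and representations with a torus action\<close>

context
  fixes Q :: "('x, 'e) pre_digraph"
  assumes Q: "fin_digraph Q"
begin

interpretation Q: fin_digraph Q by (rule Q)

lemma fin_verts: "finite (verts Q)"
  by (rule Q.finite_verts)

lemma rep_id_hom:
  assumes M: "is_rep Q M" and sp: "space N = space M" and ar: "arrow N = arrow M"
  shows "rep_id Q M \<in> rep_hom Q M N"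
proof -
  have "(\<lambda>v\<in>carrier (space M x). v) \<in> lin (space M x) (space N x)" if "x \<in> verts Q" for x
    unfolding sp by (rule restrict_lin[OF fd_vs[OF rep_fd[OF M that]]]) (rule homI, auto)
  then show ?thesis
    using Q.tail_in_verts Q.head_in_verts hom_closed[OF rep_arrow[OF M]]
    by (auto simp: rep_hom_def rep_id_def ar)
qed

lemma rep_comp_hom:
  assumes M: "is_rep Q L" and f: "\<phi> \<in> rep_hom Q L M" and g: "\<psi> \<in> rep_hom Q M N"
  shows "rep_comp Q L \<psi> \<phi> \<in> rep_hom Q L N"
proof -
  have "compose (carrier (space L x)) (\<psi> x) (\<phi> x) \<in> lin (space L x) (space N x)" if "x \<in> verts Q" for x
    by (rule compose_lin[OF fd_vs[OF rep_fd[OF M that]] rep_hom_lin[OF f that] rep_hom_lin[OF g that]])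
  moreover have "compose (carrier (space L (head Q a))) (\<psi> (head Q a)) (\<phi> (head Q a)) (arrow L a v) =
      arrow N a (compose (carrier (space L (tail Q a))) (\<psi> (tail Q a)) (\<phi> (tail Q a)) v)"
    if "a \<in> arcs Q" "v \<in> carrier (space L (tail Q a))" for a v
    using that hom_closed[OF rep_arrow[OF M that(1)] that(2)] rep_hom_arrow[OF f that]
      rep_hom_arrow[OF g that(1) rep_hom_closed[OF f Q.tail_in_verts[OF that(1)] that(2)]]
    by (simp add: compose_def)
  ultimately show ?thesis using Q.tail_in_verts Q.head_in_verts by (auto simp: rep_hom_def rep_comp_def)
qed

lemma rep_id_apply: "x \<in> verts Q \<Longrightarrow> v \<in> carrier (space M x) \<Longrightarrow> rep_id Q M x v = v"
  by (simp add: rep_id_def)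

lemma rep_comp_apply: "x \<in> verts Q \<Longrightarrow> v \<in> carrier (space M x) \<Longrightarrow> rep_comp Q M \<psi> \<phi> x v = \<psi> x (\<phi> x v)"
  by (simp add: rep_comp_def compose_def)

text \<open>
  Both categories of the first equivalence have morphisms of representations subject to a further
  condition, so the category laws are those of representations.
\<close>

lemma rep_category:
  assumes obj: "\<And>M. M \<in> Ob \<Longrightarrow> is_rep Q M"
    and sub: "\<And>M N. M \<in> Ob \<Longrightarrow> N \<in> Ob \<Longrightarrow> H M N \<subseteq> rep_hom Q M N"
    and id: "\<And>M. M \<in> Ob \<Longrightarrow> rep_id Q M \<in> H M M"
    and comp: "\<And>L M N \<phi> \<psi>. L \<in> Ob \<Longrightarrow> M \<in> Ob \<Longrightarrow> N \<in> Ob \<Longrightarrow> \<phi> \<in> H L M \<Longrightarrow> \<psi> \<in> H M N \<Longrightarrow>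
        rep_comp Q L \<psi> \<phi> \<in> H L N"
  shows "is_category \<lparr>obj = Ob, Hom = H, idn = rep_id Q, cmp = (\<lambda>X Y Z \<psi> \<phi>. rep_comp Q X \<psi> \<phi>)\<rparr>"
  unfolding is_category_def
proof (simp, intro conjI ballI)
  fix X assume X: "X \<in> Ob"
  show "rep_id Q X \<in> H X X" by (rule id[OF X])
next
  fix X Y Z f g assume "X \<in> Ob" "Y \<in> Ob" "Z \<in> Ob" "f \<in> H X Y" "g \<in> H Y Z"
  then show "rep_comp Q X g f \<in> H X Z" by (rule comp)
next
  fix X Y f assume X: "X \<in> Ob" and Y: "Y \<in> Ob" and f: "f \<in> H X Y"
  have fr: "f \<in> rep_hom Q X Y" using sub[OF X Y] f by blast
  note idX = subsetD[OF sub[OF X X] id[OF X]] and idY = subsetD[OF sub[OF Y Y] id[OF Y]]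
  show "rep_comp Q X f (rep_id Q X) = f"
    by (rule rep_hom_eqI[OF rep_comp_hom[OF obj[OF X] idX fr] fr])
      (simp add: rep_comp_apply rep_id_apply)
  show "rep_comp Q X (rep_id Q Y) f = f"
    by (rule rep_hom_eqI[OF rep_comp_hom[OF obj[OF X] fr idY] fr])
      (simp add: rep_comp_apply rep_id_apply rep_hom_closed[OF fr])
next
  fix W X Y Z f g h
  assume W: "W \<in> Ob" and X: "X \<in> Ob" and Y: "Y \<in> Ob" and Z: "Z \<in> Ob"
    and f: "f \<in> H W X" and g: "g \<in> H X Y" and h: "h \<in> H Y Z"
  note f' = subsetD[OF sub[OF W X] f] and g' = subsetD[OF sub[OF X Y] g] and h' = subsetD[OF sub[OF Y Z] h]
  note W' = obj[OF W] and X' = obj[OF X]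
  show "rep_comp Q W h (rep_comp Q W g f) = rep_comp Q W (rep_comp Q X h g) f"
    by (rule rep_hom_eqI[OF rep_comp_hom[OF W' rep_comp_hom[OF W' f' g'] h']
          rep_comp_hom[OF W' f' rep_comp_hom[OF X' g' h']]])
      (simp add: rep_comp_apply rep_hom_closed[OF f'])
qed

lemma is_idem_rep_iff:
  "is_idem_rep Q N \<longleftrightarrow> is_rep Q N \<and> (\<forall>x\<in>verts Q. grading (space N x) (idem N x))"
  by (auto simp: is_idem_rep_def grading_def weight_support_def idem_support_def)

lemma Mod_Idem_category_on:
  assumes "Ob \<subseteq> {N. is_idem_rep Q N}"
  shows "is_category \<lparr>obj = Ob, Hom = idem_rep_hom Q, idn = rep_id Q, cmp = (\<lambda>X Y Z \<psi> \<phi>. rep_comp Q X \<psi> \<phi>)\<rparr>"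
proof (rule rep_category)
  have Ob: "is_idem_rep Q M" if "M \<in> Ob" for M using assms that by auto
  show rep: "is_rep Q M" if "M \<in> Ob" for M using Ob[OF that] by (simp add: is_idem_rep_iff)
  have gr: "grading (space M x) (idem M x)" if "M \<in> Ob" "x \<in> verts Q" for M x
    using Ob[OF that(1)] that(2) by (simp add: is_idem_rep_iff)
  show "idem_rep_hom Q M N \<subseteq> rep_hom Q M N" for M N by (auto simp: idem_rep_hom_def)
  show "rep_id Q M \<in> idem_rep_hom Q M M" if "M \<in> Ob" for M
    using rep_id_hom[OF rep[OF that] refl refl] grading_closed[OF gr[OF that]]
    by (auto simp: idem_rep_hom_def rep_id_apply)
  show "rep_comp Q L \<psi> \<phi> \<in> idem_rep_hom Q L N"
    if L: "L \<in> Ob" and M: "M \<in> Ob" and N: "N \<in> Ob" and f: "\<phi> \<in> idem_rep_hom Q L M" and g: "\<psi> \<in> idem_rep_hom Q M N"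
    for L M N \<phi> \<psi>
  proof -
    have f': "\<phi> \<in> rep_hom Q L M" and g': "\<psi> \<in> rep_hom Q M N" using f g by (auto simp: idem_rep_hom_def)
    then show ?thesis using rep_comp_hom[OF rep[OF L] f' g'] f g grading_closed[OF gr[OF L]]
        rep_hom_closed[OF f']
      by (auto simp: idem_rep_hom_def rep_comp_apply)
  qed
qed

lemma total_coord: "v \<in> carrier (total_space Q M) \<Longrightarrow> x \<in> verts Q \<Longrightarrow> v x \<in> carrier (space M x)"
  by (auto simp: direct_sum_simps)

lemma total_ext:
  "v \<in> carrier (total_space Q M) \<Longrightarrow> w \<in> carrier (total_space Q M) \<Longrightarrow>
    (\<And>x. x \<in> verts Q \<Longrightarrow> v x = w x) \<Longrightarrow> v = w"
  unfolding carrier_direct_sum by (rule PiE_ext)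

lemma total_map_apply: "x \<in> verts Q \<Longrightarrow> total_map Q \<phi> v x = \<phi> x (v x)"
  by (simp add: total_map_def)

lemma total_map_hom:
  assumes "\<phi> \<in> rep_hom Q M N"
  shows "total_map Q \<phi> \<in> module_hom CC (total_space Q M) (total_space Q N)"
proof -
  have h: "\<phi> x \<in> module_hom CC (space M x) (space N x)" if "x \<in> verts Q" for x
    using lin_hom[OF rep_hom_lin[OF assms that]] .
  show ?thesis
  proof (rule homI)
    show "total_map Q \<phi> v \<in> carrier (total_space Q N)" if "v \<in> carrier (total_space Q M)" for v
      using total_coord[OF that] hom_closed[OF h] by (auto simp: total_map_def direct_sum_simps)
    show "total_map Q \<phi> (v \<oplus>\<^bsub>total_space Q M\<^esub> w) = total_map Q \<phi> v \<oplus>\<^bsub>total_space Q N\<^esub> total_map Q \<phi> w"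
      if "v \<in> carrier (total_space Q M)" "w \<in> carrier (total_space Q M)" for v w
      using total_coord[OF that(1)] total_coord[OF that(2)]
      by (auto simp: total_map_def add_direct_sum fun_eq_iff hom_add[OF h])
    show "total_map Q \<phi> (c \<odot>\<^bsub>total_space Q M\<^esub> v) = c \<odot>\<^bsub>total_space Q N\<^esub> total_map Q \<phi> v"
      if "v \<in> carrier (total_space Q M)" for c v
      using total_coord[OF that]
      by (auto simp: total_map_def smult_direct_sum fun_eq_iff hom_smult[OF h])
  qed
qed

lemma C_cat_category: "is_category (C_cat Q :: (('x, 'e, 'v) torus_rep, 'x \<Rightarrow> 'v \<Rightarrow> 'v) category)"
  unfolding C_cat_def
proof (rule rep_category)
  fix M :: "('x, 'e, 'v) torus_rep" assume M: "M \<in> {M. is_torus_rep Q M}"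
  then show rep: "is_rep Q M" by (simp add: is_torus_rep_def)
  have t: "algebraic_hom_GL (total_space Q M) (torus M)" using M by (simp add: is_torus_rep_def)
  have id: "total_map Q (rep_id Q M) v = v" if "v \<in> carrier (total_space Q M)" for v
  proof (rule total_ext[of _ M])
    show "total_map Q (rep_id Q M) v \<in> carrier (total_space Q M)"
      by (rule hom_closed[OF total_map_hom[OF rep_id_hom[OF rep refl refl]] that])
  qed (use that in \<open>simp_all add: total_map_apply rep_id_apply total_coord[OF that]\<close>)
  show "rep_id Q M \<in> torus_rep_hom Q M M"
    using rep_id_hom[OF rep refl refl] hom_closed[OF algebraic_hom[OF t]]
    by (auto simp: torus_rep_hom_def id)
next
  fix L M N :: "('x, 'e, 'v) torus_rep" and \<phi> \<psi>
  assume L: "L \<in> {M. is_torus_rep Q M}" and f: "\<phi> \<in> torus_rep_hom Q L M" and g: "\<psi> \<in> torus_rep_hom Q M N"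
  have rep: "is_rep Q L" and t: "algebraic_hom_GL (total_space Q L) (torus L)"
    using L by (simp_all add: is_torus_rep_def)
  have f': "\<phi> \<in> rep_hom Q L M" and g': "\<psi> \<in> rep_hom Q M N" using f g by (auto simp: torus_rep_hom_def)
  have c: "total_map Q (rep_comp Q L \<psi> \<phi>) v = total_map Q \<psi> (total_map Q \<phi> v)"
    if "v \<in> carrier (total_space Q L)" for v
    using total_coord[OF that] by (auto simp: total_map_def fun_eq_iff rep_comp_apply)
  show "rep_comp Q L \<psi> \<phi> \<in> torus_rep_hom Q L N"
    using rep_comp_hom[OF rep f' g'] f g hom_closed[OF algebraic_hom[OF t]] hom_closed[OF total_map_hom[OF f']]
    by (auto simp: torus_rep_hom_def c)
qed (auto simp: torus_rep_hom_def)

definition total_idem :: "('x, 'e, 'v) idem_rep \<Rightarrow> int \<Rightarrow> ('x \<Rightarrow> 'v) \<Rightarrow> 'x \<Rightarrow> 'v" where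
  "total_idem N i v = (\<lambda>x\<in>verts Q. idem N x i (v x))"

definition with_torus :: "('x, 'e, 'v) idem_rep \<Rightarrow> ('x, 'e, 'v) torus_rep" where
  "with_torus N = \<lparr>space = space N, arrow = arrow N,
     torus = torus_of (total_space Q N) (total_idem N)\<rparr>"

lemma with_torus_simps [simp]:
  "space (with_torus N) = space N" "arrow (with_torus N) = arrow N"
  "torus (with_torus N) = torus_of (total_space Q N) (total_idem N)"
  by (simp_all add: with_torus_def)

lemma total_vs: "is_rep Q M \<Longrightarrow> vectorspace CC (total_space Q M)"
  by (rule direct_sum_vs) (auto dest: rep_fd intro: fd_vs)

lemma total_fd: "is_rep Q M \<Longrightarrow> fd_vectorspace (total_space Q M)"
  by (rule direct_sum_fd[OF _ fin_verts]) (auto dest: rep_fd)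

lemma total_idem_grading:
  assumes "is_idem_rep Q N"
  shows "grading (total_space Q N) (total_idem N)"
  unfolding total_idem_def
  by (rule grading_direct_sum[OF _ fin_verts]) (use assms in \<open>auto simp: is_idem_rep_iff dest: rep_fd\<close>)

text \<open>
  The action defined by a direct sum of gradings is the direct sum of the actions: the projection to
  a summand respects the gradings, hence the actions.
\<close>

lemma torus_of_coord:
  assumes N: "is_idem_rep Q N" and v: "v \<in> carrier (total_space Q N)" and x: "x \<in> verts Q" and z: "z \<noteq> 0"
  shows "torus_of (total_space Q N) (total_idem N) z v x = torus_of (space N x) (idem N x) z (v x)"
proof -
  have rep: "is_rep Q N" and gr: "grading (space N x) (idem N x)" using N x by (auto simp: is_idem_rep_iff)
  have "\<forall>k. total_idem N k v x = idem N x k (v x)" using x by (simp add: total_idem_def)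
  then show ?thesis
    using intertwine0_iff[OF total_vs[OF rep] total_idem_grading[OF N] rep_fd[OF rep x] gr
        coord_hom[OF x] v total_coord[OF v x]] z by blast
qed

lemma with_torus_obj:
  assumes N: "is_idem_rep Q N"
  shows "is_torus_rep Q (with_torus N)"
proof -
  have rep: "is_rep Q N" using N by (simp add: is_idem_rep_iff)
  let ?t = "torus_of (total_space Q N) (total_idem N)"
  have "?t z v \<in> summand (verts Q) (space N) x"
    if z: "z \<noteq> 0" and v: "v \<in> summand (verts Q) (space N) x" for x z v
  proof -
    have vc: "v \<in> carrier (total_space Q N)" using v by (simp add: summand_def)
    have "?t z v y = \<zero>\<^bsub>space N y\<^esub>" if y: "y \<in> verts Q" "y \<noteq> x" for y
    proof -
      have gr: "grading (space N y) (idem N y)" using N y by (auto simp: is_idem_rep_iff)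
      have "v y = \<zero>\<^bsub>space N y\<^esub>" using v y by (simp add: summand_def)
      then show ?thesis
        using torus_of_coord[OF N vc y(1) z]
          hom_zero[OF _ _ torus_of_hom[OF rep_fd[OF rep y(1)] gr]] fd_vs[OF rep_fd[OF rep y(1)]] by simp
    qed
    then show ?thesis
      using torus_of_closed[OF total_vs[OF rep] total_idem_grading[OF N] vc] by (simp add: summand_def)
  qed
  then show ?thesis
    using rep torus_of_algebraic[OF total_fd[OF rep] total_idem_grading[OF N]]
    by (auto simp: is_torus_rep_def is_rep_def)
qed

text \<open>
  Apply \<open>intertwine0_iff\<close> to the map that a morphism induces on total spaces, and test it on vectors
  supported at one vertex.
\<close>

lemma with_torus_hom:
  assumes M: "is_idem_rep Q M" and N: "is_idem_rep Q N"
  shows "torus_rep_hom Q (with_torus M) (with_torus N) = idem_rep_hom Q M N"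
proof -
  have repM: "is_rep Q M" and repN: "is_rep Q N" using M N by (simp_all add: is_idem_rep_iff)
  have "(\<forall>z. z \<noteq> 0 \<longrightarrow> (\<forall>v\<in>carrier (total_space Q M).
          total_map Q \<phi> (torus_of (total_space Q M) (total_idem M) z v) =
          torus_of (total_space Q N) (total_idem N) z (total_map Q \<phi> v))) \<longleftrightarrow>
      (\<forall>x\<in>verts Q. \<forall>i. \<forall>v\<in>carrier (space M x). \<phi> x (idem M x i v) = idem N x i (\<phi> x v))"
    (is "?L \<longleftrightarrow> ?R") if f: "\<phi> \<in> rep_hom Q M N" for \<phi>
  proof -
    let ?T = "\<lambda>v k. total_map Q \<phi> (total_idem M k v) = total_idem N k (total_map Q \<phi> v)"
    have "?L \<longleftrightarrow> (\<forall>v\<in>carrier (total_space Q M). \<forall>k. ?T v k)"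
      using intertwine0_iff[OF total_vs[OF repM] total_idem_grading[OF M] total_fd[OF repN]
          total_idem_grading[OF N] total_map_hom[OF f] _ hom_closed[OF total_map_hom[OF f]]] by blast
    also have "\<dots> \<longleftrightarrow> ?R"
    proof
      assume ?R
      then show "\<forall>v\<in>carrier (total_space Q M). \<forall>k. ?T v k"
        using total_coord[of _ M] by (auto simp: total_map_def total_idem_def fun_eq_iff simp del: direct_sum_simps)
    next
      assume T: "\<forall>v\<in>carrier (total_space Q M). \<forall>k. ?T v k"
      show ?R
      proof (intro ballI allI)
        fix x i v assume x: "x \<in> verts Q" and v: "v \<in> carrier (space M x)"
        let ?u = "coord_inj (verts Q) (space M) x v"
        have u: "?u \<in> carrier (total_space Q M)"
          by (rule hom_closed[OF coord_inj_hom[of "verts Q" "space M"] v])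
            (auto intro: fd_vs[OF rep_fd[OF repM]] x)
        have "total_map Q \<phi> (total_idem M i ?u) x = total_idem N i (total_map Q \<phi> ?u) x"
          using T u by simp
        then show "\<phi> x (idem M x i v) = idem N x i (\<phi> x v)"
          using x by (simp add: total_map_def total_idem_def coord_inj_apply)
      qed
    qed
    finally show ?thesis .
  qed
  moreover have "rep_hom Q (with_torus M) (with_torus N) = rep_hom Q M N"
    by (simp add: rep_hom_def)
  ultimately show ?thesis by (auto simp: torus_rep_hom_def idem_rep_hom_def)
qed

lemma direct_sum_single:
  assumes M: "is_rep Q M" and W: "vectorspace CC W" and h: "h \<in> module_hom CC (total_space Q M) W"
    and v: "v \<in> carrier (total_space Q M)" and y: "y \<in> verts Q"
    and zero: "\<And>x. x \<in> verts Q \<Longrightarrow> x \<noteq> y \<Longrightarrow> h (coord_inj (verts Q) (space M) x (v x)) = \<zero>\<^bsub>W\<^esub>"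
  shows "h v = h (coord_inj (verts Q) (space M) y (v y))"
proof -
  let ?i = "coord_inj (verts Q) (space M)"
  have Mv: "vectorspace CC (space M x)" if "x \<in> verts Q" for x using fd_vs[OF rep_fd[OF M that]] .
  have i: "?i x (v x) \<in> carrier (total_space Q M)" if "x \<in> verts Q" for x
    using hom_closed[OF coord_inj_hom[of "verts Q" "space M", OF Mv that] total_coord[OF v that]] .
  have "h v = h (\<Oplus>\<^bsub>total_space Q M\<^esub>x\<in>verts Q. ?i x (v x))"
    using direct_sum_decomp[of "verts Q" "space M", OF Mv fin_verts v] by simp
  also have "\<dots> = (\<Oplus>\<^bsub>W\<^esub>x\<in>verts Q. h (?i x (v x)))"
    by (rule hom_finsum[OF total_vs[OF M] W h i])
  also have "\<dots> = h (?i y (v y))"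
    by (rule finsum_single[OF W fin_verts y]) (use zero hom_closed[OF h i[OF y]] in auto)
  finally show ?thesis .
qed

text \<open>
  Stability of the summand at \<open>x\<close> means that for a vector \<open>u\<close> in it the coordinates of \<open>t z u\<close> at the other
  vertices vanish for all \<open>z\<close>. By the pointwise form of \<open>intertwine0_iff\<close> the same coordinates of \<open>P k u\<close> vanish.
  So \<open>P k\<close> is block diagonal, and its blocks are the required idempotents.
\<close>

lemma with_torus_surj:
  assumes M: "is_torus_rep Q M"
  shows "\<exists>N. is_idem_rep Q N \<and> is_isomorphism (C_cat Q) (with_torus N) M (rep_id Q M)"
proof -
  let ?V = "total_space Q M" and ?i = "coord_inj (verts Q) (space M)"
  have rep: "is_rep Q M" and t: "algebraic_hom_GL ?V (torus M)"
    and stable: "\<And>x z v. x \<in> verts Q \<Longrightarrow> z \<noteq> 0 \<Longrightarrow> v \<in> summand (verts Q) (space M) x \<Longrightarrow>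
      torus M z v \<in> summand (verts Q) (space M) x"
    using M by (auto simp: is_torus_rep_def)
  note Vfd = total_fd[OF rep] and Vvs = total_vs[OF rep]
  have Mv: "vectorspace CC (space M x)" if "x \<in> verts Q" for x using fd_vs[OF rep_fd[OF rep that]] .
  obtain P where P: "grading ?V P" and tP: "\<And>z v. z \<noteq> 0 \<Longrightarrow> v \<in> carrier ?V \<Longrightarrow> torus M z v = torus_of ?V P z v"
    using algebraic_grading_exists[OF Vfd t] by blast
  have ih: "?i x \<in> module_hom CC (space M x) ?V" if "x \<in> verts Q" for x
    by (rule coord_inj_hom) (auto intro: Mv that)
  note ic = hom_closed[OF ih]
  have off: "P k (?i x w) y = \<zero>\<^bsub>space M y\<^esub>"
    if x: "x \<in> verts Q" and y: "y \<in> verts Q" and xy: "y \<noteq> x" and w: "w \<in> carrier (space M x)" for x y k w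
  proof -
    let ?e = "\<lambda>v. ?i y (v y)"
    have e: "?e \<in> module_hom CC ?V ?V" by (rule hom_comp[OF coord_hom[where M = "space M", OF y] ih[OF y]])
    have "\<forall>z. z \<noteq> 0 \<longrightarrow> ?e (torus_of ?V P z (?i x w)) = torus_of ?V P z \<zero>\<^bsub>?V\<^esub>"
    proof (intro allI impI)
      fix z :: complex assume z: "z \<noteq> 0"
      have "?i x w \<in> summand (verts Q) (space M) x"
        using ic[OF x w] by (auto simp: summand_def coord_inj_apply)
      then have "torus M z (?i x w) \<in> summand (verts Q) (space M) x" by (rule stable[OF x z])
      then have "torus_of ?V P z (?i x w) y = \<zero>\<^bsub>space M y\<^esub>"
        using y xy unfolding tP[OF z ic[OF x w]] by (simp add: summand_def)
      then show "?e (torus_of ?V P z (?i x w)) = torus_of ?V P z \<zero>\<^bsub>?V\<^esub>"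
        using hom_zero[OF Mv[OF y] Vvs ih[OF y]] hom_zero[OF Vvs Vvs torus_of_hom[OF Vfd P]] by simp
    qed
    then have "?e (P k (?i x w)) = P k \<zero>\<^bsub>?V\<^esub>"
      using intertwine0_iff[OF Vvs P Vfd P e ic[OF x w] vs_zero[OF Vvs]] by blast
    then have "?e (P k (?i x w)) y = \<zero>\<^bsub>space M y\<^esub>"
      using hom_zero[OF Vvs Vvs grading_hom[OF P]] y by (simp add: zero_direct_sum)
    then show ?thesis using y by (simp add: coord_inj_apply)
  qed
  have on: "?i x (P k (?i x w) x) = P k (?i x w)" if x: "x \<in> verts Q" and w: "w \<in> carrier (space M x)" for x k w
  proof (rule total_ext[of _ M])
    show c: "P k (?i x w) \<in> carrier ?V" by (rule grading_closed[OF P ic[OF x w]])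
    show "?i x (P k (?i x w) x) \<in> carrier ?V" by (rule ic[OF x total_coord[OF c x]])
    show "?i x (P k (?i x w) x) y = P k (?i x w) y" if "y \<in> verts Q" for y
      using off[OF x that _ w] that by (simp add: coord_inj_apply)
  qed
  define N where "N = \<lparr>space = space M, arrow = arrow M, idem = (\<lambda>x k w. P k (?i x w) x)\<rparr>"
  have N: "is_idem_rep Q N"
  proof -
    have "grading (space M x) (\<lambda>k w. P k (?i x w) x)" if x: "x \<in> verts Q" for x
      by (rule grading_split[OF Vvs P rep_fd[OF rep x] ih[OF x] coord_hom[OF x]])
        (use x on[OF x] in \<open>auto simp: coord_inj_apply\<close>)
    then show ?thesis using rep by (auto simp: is_idem_rep_iff is_rep_def N_def)
  qed
  have PN: "P k v = total_idem N k v" if v: "v \<in> carrier ?V" for k v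
  proof (rule total_ext[of _ M])
    show c: "P k v \<in> carrier ?V" by (rule grading_closed[OF P v])
    show "total_idem N k v \<in> carrier ?V"
      using grading_closed[OF total_idem_grading[OF N]] v by (simp add: N_def)
    fix y assume y: "y \<in> verts Q"
    show "P k v y = total_idem N k v y"
      using direct_sum_single[OF rep Mv[OF y] hom_comp[OF grading_hom[OF P] coord_hom[OF y]] v y,
          of k] off y total_coord[OF v]
      by (simp add: total_idem_def N_def)
  qed
  have torus: "torus M z v = torus (with_torus N) z v" if z: "z \<noteq> 0" and v: "v \<in> carrier ?V" for z v
  proof -
    have sp: "space N = space M" by (simp add: N_def)
    have h: "(\<lambda>v. v) \<in> module_hom CC ?V ?V" by (rule homI) auto
    have "grading ?V (total_idem N)" using total_idem_grading[OF N] by (simp add: sp)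
    then have "torus_of ?V P z v = torus_of ?V (total_idem N) z v"
      using intertwine0_iff[OF Vvs P Vfd _ h v v] PN[OF v] z by blast
    then show ?thesis using tP[OF z v] by (simp add: sp)
  qed
  have idv: "total_map Q (rep_id Q M) v = v" if "v \<in> carrier ?V" for v
  proof (rule total_ext[of _ M])
    show "total_map Q (rep_id Q M) v \<in> carrier (total_space Q M)"
      by (rule hom_closed[OF total_map_hom[OF rep_id_hom[OF rep refl refl]] that])
  qed (use that in \<open>simp_all add: total_map_apply rep_id_apply total_coord[OF that]\<close>)
  have tc: "torus M z v \<in> carrier ?V" if "z \<noteq> 0" "v \<in> carrier ?V" for z v
    using hom_closed[OF algebraic_hom[OF t that(1)] that(2)] .
  have sp: "space (with_torus N) = space M" "arrow (with_torus N) = arrow M" by (simp_all add: N_def)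
  have ids: "rep_id Q (with_torus N) = rep_id Q M" by (simp only: rep_id_def sp)
  have "is_rep Q (with_torus N)" using rep by (simp add: is_rep_def sp del: with_torus_simps)
  then have r1: "rep_id Q M \<in> rep_hom Q (with_torus N) M"
    using rep_id_hom[of "with_torus N" M] by (simp only: ids sp)
  have r2: "rep_id Q M \<in> rep_hom Q M (with_torus N)" by (rule rep_id_hom[OF rep sp])
  have h1: "rep_id Q M \<in> torus_rep_hom Q (with_torus N) M"
    using r1 torus tc idv by (simp add: torus_rep_hom_def sp del: with_torus_simps)
  have h2: "rep_id Q M \<in> torus_rep_hom Q M (with_torus N)"
    using r2 torus tc idv by (simp add: torus_rep_hom_def sp del: with_torus_simps)
  have cc: "rep_comp Q M (rep_id Q M) (rep_id Q M) = rep_id Q M"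
    by (auto simp: rep_comp_def rep_id_def compose_def fun_eq_iff)
  have "is_isomorphism (C_cat Q) (with_torus N) M (rep_id Q M)"
    unfolding is_isomorphism_def C_cat_def
    using h1 h2 cc by (auto simp: ids rep_comp_def sp simp del: with_torus_simps intro!: bexI[of _ "rep_id Q M"])
  then show ?thesis using N by blast
qed

theorem Mod_Idem_equivalent_C_cat:
  "equivalent_categories
     (Mod_Idem Q :: (('x, 'e, 'v) idem_rep, 'x \<Rightarrow> 'v \<Rightarrow> 'v) category)
     (C_cat Q :: (('x, 'e, 'v) torus_rep, 'x \<Rightarrow> 'v \<Rightarrow> 'v) category)"
proof (rule equivalent_categoriesI)
  let ?C = "Mod_Idem Q :: (('x, 'e, 'v) idem_rep, 'x \<Rightarrow> 'v \<Rightarrow> 'v) category"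
  let ?D = "C_cat Q :: (('x, 'e, 'v) torus_rep, 'x \<Rightarrow> 'v \<Rightarrow> 'v) category"
  let ?F = "\<lparr>on_obj = with_torus, on_hom = (\<lambda>X Y f. f)\<rparr>"
  show "is_category ?C" unfolding Mod_Idem_def by (rule Mod_Idem_category_on) simp
  show "is_category ?D" by (rule C_cat_category)
  show "is_functor ?C ?D ?F"
    by (auto simp: is_functor_def Mod_Idem_def C_cat_def with_torus_obj with_torus_hom
        rep_id_def rep_comp_def)
  show "\<exists>f\<in>Hom ?C X Y. on_hom ?F X Y f = g"
    if "X \<in> obj ?C" "Y \<in> obj ?C" "g \<in> Hom ?D (on_obj ?F X) (on_obj ?F Y)" for X Y g
    using that by (simp add: Mod_Idem_def C_cat_def with_torus_hom)
  show "\<exists>X\<in>obj ?C. \<exists>e. is_isomorphism ?D (on_obj ?F X) Y e" if "Y \<in> obj ?D" for Y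
    using that with_torus_surj[of Y] by (auto simp: Mod_Idem_def C_cat_def)
qed simp

section \<open>Generators of the path algebra and its modules\<close>

abbreviation (input) A :: "(complex, ('x, 'e) path_elt) module" where "A \<equiv> path_algebra Q"

lemma quiver_paths_iff: "(u, p) \<in> quiver_paths Q \<longleftrightarrow> (\<exists>v. Q.awalk u p v)"
  by (simp add: quiver_paths_def)

lemma trivial_path_closed: "x \<in> verts Q \<Longrightarrow> trivial_path x \<in> carrier A"
  by (simp add: path_algebra_simps trivial_path_def quiver_paths_iff Q.awalk_Nil_iff)

lemma awalk_arrow: "a \<in> arcs Q \<Longrightarrow> Q.awalk (tail Q a) [a] v \<longleftrightarrow> v = head Q a"
  by (auto simp: Q.awalk_simps)

lemma arrow_path_closed: "a \<in> arcs Q \<Longrightarrow> arrow_path Q a \<in> carrier A"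
  using awalk_arrow by (auto simp: path_algebra_simps arrow_path_def quiver_paths_iff)

text \<open>
  Closure under products uses that a walk from \<open>u\<close> to \<open>v\<close> followed by one from \<open>v\<close> is a walk from \<open>u\<close>.
\<close>

lemma path_algebra_closed:
  shows path_add_closed: "f \<in> carrier A \<Longrightarrow> g \<in> carrier A \<Longrightarrow> f + g \<in> carrier A"
    and path_smult_closed: "f \<in> carrier A \<Longrightarrow> c \<odot>\<^bsub>A\<^esub> f \<in> carrier A"
    and path_sum_closed: "(\<And>i. i \<in> I \<Longrightarrow> F i \<in> carrier A) \<Longrightarrow> sum F I \<in> carrier A"
    and path_mult_closed: "f \<in> carrier A \<Longrightarrow> g \<in> carrier A \<Longrightarrow> f \<otimes>\<^bsub>A\<^esub> g \<in> carrier A"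
proof -
  show "f \<in> carrier A \<Longrightarrow> g \<in> carrier A \<Longrightarrow> f + g \<in> carrier A"
    using Poly_Mapping.keys_add[of f g] by (auto simp: path_algebra_simps)
  show "c \<odot>\<^bsub>A\<^esub> f \<in> carrier A" if f: "f \<in> carrier A"
  proof -
    have "p \<in> Poly_Mapping.keys f" if "p \<in> Poly_Mapping.keys (c \<odot>\<^bsub>A\<^esub> f)" for p
      using that unfolding in_keys_iff lookup_smult by simp
    then show ?thesis using f by (auto simp: path_algebra_simps)
  qed
  show sum: "sum F I \<in> carrier A" if "\<And>i. i \<in> I \<Longrightarrow> F i \<in> carrier A" for F :: "'i \<Rightarrow> _" and I
    using that keys_sum[of F I] by (fastforce simp: path_algebra_simps)
  have "path_product Q q p c \<in> carrier A"
    if qp: "q \<in> quiver_paths Q" "p \<in> quiver_paths Q" for q p c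
  proof (cases q; cases p)
    fix v s u r assume q: "q = (v, s)" and p: "p = (u, r)"
    obtain w where w: "Q.awalk v s w" using qp q by (auto simp: quiver_paths_iff)
    show ?thesis
    proof (cases "Q.awalk u r v")
      case True
      then have "Q.awalk u (r @ s) w" using w by (rule Q.awalk_appendI)
      then show ?thesis
        using True by (auto simp: p q path_product_def path_algebra_simps quiver_paths_iff)
    qed (simp add: p q path_product_def path_algebra_simps)
  qed
  then have "path_product Q q p c \<in> carrier A"
    if "f \<in> carrier A" "g \<in> carrier A" "q \<in> Poly_Mapping.keys f" "p \<in> Poly_Mapping.keys g" for q p c
    using that unfolding path_algebra_simps(1) by blast
  then show "f \<in> carrier A \<Longrightarrow> g \<in> carrier A \<Longrightarrow> f \<otimes>\<^bsub>A\<^esub> g \<in> carrier A"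
    unfolding path_algebra_mult by (intro sum)
qed

lemma trivial_mult_trivial:
  "x \<in> verts Q \<Longrightarrow> trivial_path x \<otimes>\<^bsub>A\<^esub> trivial_path y = (if x = y then trivial_path x else 0)"
  by (auto simp: trivial_path_def mult_single path_product_def Q.awalk_Nil_iff)

lemma trivial_mult_arrow:
  "a \<in> arcs Q \<Longrightarrow> trivial_path x \<otimes>\<^bsub>A\<^esub> arrow_path Q a = (if x = head Q a then arrow_path Q a else 0)"
  by (simp add: trivial_path_def arrow_path_def mult_single path_product_def awalk_arrow)

lemma arrow_mult_trivial:
  "a \<in> arcs Q \<Longrightarrow> arrow_path Q a \<otimes>\<^bsub>A\<^esub> trivial_path x = (if x = tail Q a then arrow_path Q a else 0)"
  by (simp add: trivial_path_def arrow_path_def mult_single path_product_def Q.awalk_Nil_iff Q.tail_in_verts)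

lemma arrow_mult_path:
  "Q.awalk u p (tail Q a) \<Longrightarrow> arrow_path Q a \<otimes>\<^bsub>A\<^esub> single (u, p) 1 = single (u, p @ [a]) 1"
  by (simp add: arrow_path_def mult_single path_product_def)

text \<open>
  Trivial paths and arrows generate the path algebra: a nontrivial path is the product of its last arrow
  with a shorter path.
\<close>

lemma path_algebra_induct [consumes 1]:
  assumes f: "f \<in> carrier A" and zero: "P 0"
    and add: "\<And>f g. f \<in> carrier A \<Longrightarrow> g \<in> carrier A \<Longrightarrow> P f \<Longrightarrow> P g \<Longrightarrow> P (f + g)"
    and smult: "\<And>c f. f \<in> carrier A \<Longrightarrow> P f \<Longrightarrow> P (c \<odot>\<^bsub>A\<^esub> f)"
    and triv: "\<And>x. x \<in> verts Q \<Longrightarrow> P (trivial_path x)"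
    and mult: "\<And>a f. a \<in> arcs Q \<Longrightarrow> f \<in> carrier A \<Longrightarrow> P f \<Longrightarrow> P (arrow_path Q a \<otimes>\<^bsub>A\<^esub> f)"
  shows "P f"
proof -
  have path: "P (single (u, p) 1)" if "Q.awalk u p v" for u p v
    using that
  proof (induction p arbitrary: v rule: rev_induct)
    case Nil
    then show ?case using triv[of u] by (auto simp: Q.awalk_Nil_iff trivial_path_def)
  next
    case (snoc a p)
    then have p: "Q.awalk u p (tail Q a)" and a: "a \<in> arcs Q" by (auto simp: Q.awalk_simps)
    have "single (u, p) 1 \<in> carrier A" using p by (auto simp: path_algebra_simps quiver_paths_iff)
    then have "P (arrow_path Q a \<otimes>\<^bsub>A\<^esub> single (u, p) 1)" by (rule mult[OF a _ snoc.IH[OF p]])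
    then show ?case by (simp add: arrow_mult_path[OF p])
  qed
  have mono: "single p c \<in> carrier A \<and> P (single p c)" if p: "p \<in> quiver_paths Q" for p c
  proof (cases p)
    case (Pair u q)
    then obtain v where v: "Q.awalk u q v" using p by (auto simp: quiver_paths_iff)
    have 1: "single p 1 \<in> carrier A" and c: "single p c \<in> carrier A"
      using p by (simp_all add: path_algebra_simps)
    have "P (c \<odot>\<^bsub>A\<^esub> single p 1)" using smult[OF 1] path[OF v] Pair by simp
    then show ?thesis using c by (simp add: smult_single)
  qed
  have "(\<Sum>p\<in>K. single p (Poly_Mapping.lookup f p)) \<in> carrier A \<and>
      P (\<Sum>p\<in>K. single p (Poly_Mapping.lookup f p))"
    if "finite K" "K \<subseteq> quiver_paths Q" for K
    using that
  proof induction
    case (insert p K)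
    then show ?case using mono[of p "Poly_Mapping.lookup f p"] by (auto intro: add path_add_closed)
  qed (simp_all add: zero path_algebra_simps)
  moreover have "f = (\<Sum>p\<in>Poly_Mapping.keys f. single p (Poly_Mapping.lookup f p))"
    by (rule poly_mapping_eqI) (simp add: lookup_sum lookup_single when_def in_keys_iff)
  ultimately show ?thesis using f by (metis (no_types, lifting) finite_keys mem_Collect_eq path_algebra_simps(1))
qed

text \<open>
  The linear extension of an action of paths, where \<open>\<pi> p\<close> is the operator of the path \<open>p\<close>.
\<close>

definition path_action :: "(complex, 'v) module \<Rightarrow> ('x \<times> 'e list \<Rightarrow> 'v \<Rightarrow> 'v) \<Rightarrow> ('x, 'e) path_elt \<Rightarrow> 'v \<Rightarrow> 'v" where
  "path_action V \<pi> f v = (\<Oplus>\<^bsub>V\<^esub>p\<in>Poly_Mapping.keys f. Poly_Mapping.lookup f p \<odot>\<^bsub>V\<^esub> \<pi> p v)"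

text \<open>
  The module laws follow from the corresponding laws for paths by bilinearity. To avoid rearranging sums
  in \<open>V\<close>, a functional \<open>g\<close> is fixed: \<open>f \<mapsto> L g x f\<close> is the linear form on the path algebra with value
  \<open>g (\<pi> p x)\<close> at the path \<open>p\<close>.
\<close>

lemma path_action_module:
  assumes V: "fd_vectorspace V" and hom: "\<And>p. p \<in> quiver_paths Q \<Longrightarrow> \<pi> p \<in> module_hom CC V V"
    and mult: "\<And>u p v q x. (u, p) \<in> quiver_paths Q \<Longrightarrow> (v, q) \<in> quiver_paths Q \<Longrightarrow> x \<in> carrier V \<Longrightarrow>
        \<pi> (v, q) (\<pi> (u, p) x) = (if Q.awalk u p v then \<pi> (u, p @ q) x else \<zero>\<^bsub>V\<^esub>)"
    and one: "\<And>x. x \<in> carrier V \<Longrightarrow> (\<Oplus>\<^bsub>V\<^esub>u\<in>verts Q. \<pi> (u, []) x) = x"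
  shows "is_fd_module A V (path_action V \<pi>)"
    and "p \<in> quiver_paths Q \<Longrightarrow> x \<in> carrier V \<Longrightarrow> path_action V \<pi> (single p 1) x = \<pi> p x"
proof -
  note Vv = fd_vs[OF V]
  have pc: "\<pi> p x \<in> carrier V" if "p \<in> quiver_paths Q" "x \<in> carrier V" for p x
    using hom_closed[OF hom[OF that(1)] that(2)] .
  have keys: "p \<in> quiver_paths Q" if "f \<in> carrier A" "p \<in> Poly_Mapping.keys f" for f p
    using that by (auto simp: path_algebra_simps)
  have closed: "path_action V \<pi> f x \<in> carrier V" if "f \<in> carrier A" "x \<in> carrier V" for f x
    unfolding path_action_def using that keys by (intro vs_finsum[OF Vv] vs_smult[OF Vv] pc) auto
  define L where "L g x f = (\<Sum>p\<in>Poly_Mapping.keys f. Poly_Mapping.lookup f p * g (\<pi> p x))" for g :: "_ \<Rightarrow> complex" and x f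
  have L_superset: "L g x f = (\<Sum>p\<in>S. Poly_Mapping.lookup f p * g (\<pi> p x))"
    if "finite S" "Poly_Mapping.keys f \<subseteq> S" for g x f S
    unfolding L_def using that by (intro sum.mono_neutral_left) (auto simp: in_keys_iff)
  have dual: "g (path_action V \<pi> f x) = L g x f" if g: "g \<in> dual V" and f: "f \<in> carrier A" and x: "x \<in> carrier V" for g f x
  proof -
    have "g (path_action V \<pi> f x) = (\<Sum>p\<in>Poly_Mapping.keys f. g (Poly_Mapping.lookup f p \<odot>\<^bsub>V\<^esub> \<pi> p x))"
      unfolding path_action_def using keys[OF f] x by (intro dual_finsum[OF Vv g] vs_smult[OF Vv] pc)
    also have "\<dots> = L g x f"
      unfolding L_def using keys[OF f] x by (intro sum.cong refl dual_smult[OF g] pc)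
    finally show ?thesis .
  qed
  have L_add: "L g x (f + h) = L g x f + L g x h" for g x f h
  proof -
    let ?S = "Poly_Mapping.keys f \<union> Poly_Mapping.keys h"
    show ?thesis
      using L_superset[of ?S f g x] L_superset[of ?S h g x] L_superset[of ?S "f + h" g x]
        Poly_Mapping.keys_add[of f h]
      by (simp add: lookup_add algebra_simps sum.distrib)
  qed
  have L_zero: "L g x 0 = 0" for g x by (simp add: L_def)
  have L_sum: "L g x (sum F I) = (\<Sum>i\<in>I. L g x (F i))" for g x and F :: "'i \<Rightarrow> _" and I
    by (induction I rule: infinite_finite_induct) (simp_all add: L_zero L_add)
  have L_single: "L g x (single p c) = c * g (\<pi> p x)" for g x p c
    by (cases "c = 0") (simp_all add: L_def)
  have L_smult: "L g x (c \<odot>\<^bsub>A\<^esub> f) = c * L g x f" for g x c f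
  proof -
    have "Poly_Mapping.keys (c \<odot>\<^bsub>A\<^esub> f) \<subseteq> Poly_Mapping.keys f"
      by (auto simp: in_keys_iff lookup_smult)
    then show ?thesis
      using L_superset[of "Poly_Mapping.keys f" "c \<odot>\<^bsub>A\<^esub> f" g x]
      by (simp add: lookup_smult L_def sum_distrib_left mult.assoc)
  qed
  have L_prod: "L g x (path_product Q q p c) = c * g (\<pi> q (\<pi> p x))"
    if "g \<in> dual V" "q \<in> quiver_paths Q" "p \<in> quiver_paths Q" "x \<in> carrier V" for g x q p c
    using that mult by (cases q; cases p)
      (auto simp: path_product_def L_single L_zero dual_zero[OF Vv])
  show single: "path_action V \<pi> (single p 1) x = \<pi> p x" if p: "p \<in> quiver_paths Q" and x: "x \<in> carrier V" for p x
  proof (rule dual_ext[OF V])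
    have s: "single p 1 \<in> carrier A" using p by (simp add: path_algebra_simps)
    show "path_action V \<pi> (single p 1) x \<in> carrier V" by (rule closed[OF s x])
    show "\<pi> p x \<in> carrier V" by (rule pc[OF p x])
    show "g (path_action V \<pi> (single p 1) x) = g (\<pi> p x)" if "g \<in> dual V" for g
      using dual[OF that s x] by (simp add: L_single)
  qed
  show "is_fd_module A V (path_action V \<pi>)"
    unfolding is_fd_module_def
  proof (intro conjI ballI allI V)
    fix f assume f: "f \<in> carrier A"
    show "path_action V \<pi> f \<in> module_hom CC V V"
    proof (rule homI)
      show "path_action V \<pi> f x \<in> carrier V" if "x \<in> carrier V" for x by (rule closed[OF f that])
      show "path_action V \<pi> f (x \<oplus>\<^bsub>V\<^esub> y) = path_action V \<pi> f x \<oplus>\<^bsub>V\<^esub> path_action V \<pi> f y"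
        if x: "x \<in> carrier V" and y: "y \<in> carrier V" for x y
      proof (rule dual_ext[OF V])
        fix g assume g: "g \<in> dual V"
        have "L g (x \<oplus>\<^bsub>V\<^esub> y) f = L g x f + L g y f"
          unfolding L_def sum.distrib[symmetric]
          by (rule sum.cong) (simp_all add: hom_add[OF hom[OF keys[OF f]] x y]
              dual_add[OF g pc[OF keys[OF f] x] pc[OF keys[OF f] y]] algebra_simps)
        then show "g (path_action V \<pi> f (x \<oplus>\<^bsub>V\<^esub> y)) = g (path_action V \<pi> f x \<oplus>\<^bsub>V\<^esub> path_action V \<pi> f y)"
          using dual[OF g f] x y by (simp add: vs_add[OF Vv] dual_add[OF g] closed[OF f])
      qed (auto intro!: closed[OF f] vs_add[OF Vv] x y)
      show "path_action V \<pi> f (c \<odot>\<^bsub>V\<^esub> x) = c \<odot>\<^bsub>V\<^esub> path_action V \<pi> f x" if x: "x \<in> carrier V" for c x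
      proof (rule dual_ext[OF V])
        fix g assume g: "g \<in> dual V"
        have "L g (c \<odot>\<^bsub>V\<^esub> x) f = c * L g x f"
          unfolding L_def sum_distrib_left
          by (rule sum.cong) (simp_all add: hom_smult[OF hom[OF keys[OF f]] x]
              dual_smult[OF g pc[OF keys[OF f] x]])
        then show "g (path_action V \<pi> f (c \<odot>\<^bsub>V\<^esub> x)) = g (c \<odot>\<^bsub>V\<^esub> path_action V \<pi> f x)"
          using dual[OF g f] x by (simp add: vs_smult[OF Vv] dual_smult[OF g] closed[OF f])
      qed (auto intro!: closed[OF f] vs_smult[OF Vv] x)
    qed
  next
    fix f h x assume f: "f \<in> carrier A" and h: "h \<in> carrier A" and x: "x \<in> carrier V"
    have fh: "f + h \<in> carrier A" by (rule path_add_closed[OF f h])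
    show "path_action V \<pi> (f \<oplus>\<^bsub>A\<^esub> h) x = path_action V \<pi> f x \<oplus>\<^bsub>V\<^esub> path_action V \<pi> h x"
      unfolding path_algebra_simps
    proof (rule dual_ext[OF V])
      fix g assume g: "g \<in> dual V"
      show "g (path_action V \<pi> (f + h) x) = g (path_action V \<pi> f x \<oplus>\<^bsub>V\<^esub> path_action V \<pi> h x)"
        by (simp add: dual_add[OF g closed[OF f x] closed[OF h x]] dual[OF g _ x] f h fh L_add)
    qed (auto intro!: closed vs_add[OF Vv] x f h fh)
    have m: "f \<otimes>\<^bsub>A\<^esub> h \<in> carrier A" by (rule path_mult_closed[OF f h])
    show "path_action V \<pi> (f \<otimes>\<^bsub>A\<^esub> h) x = path_action V \<pi> f (path_action V \<pi> h x)"
    proof (rule dual_ext[OF V])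
      fix g assume g: "g \<in> dual V"
      have "g (path_action V \<pi> (f \<otimes>\<^bsub>A\<^esub> h) x) = L g x (f \<otimes>\<^bsub>A\<^esub> h)" by (rule dual[OF g m x])
      also have "\<dots> = (\<Sum>q\<in>Poly_Mapping.keys f. \<Sum>p\<in>Poly_Mapping.keys h.
          (Poly_Mapping.lookup f q * Poly_Mapping.lookup h p) * g (\<pi> q (\<pi> p x)))"
        unfolding path_algebra_mult L_sum using keys[OF f] keys[OF h] x g
        by (intro sum.cong refl L_prod) auto
      also have "\<dots> = (\<Sum>q\<in>Poly_Mapping.keys f. Poly_Mapping.lookup f q * g (\<pi> q (path_action V \<pi> h x)))"
      proof (rule sum.cong[OF refl])
        fix q assume q: "q \<in> Poly_Mapping.keys f"
        have "g (\<pi> q (path_action V \<pi> h x)) = L (\<lambda>v. g (\<pi> q v)) x h"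
          by (rule dual[OF hom_comp[OF hom[OF keys[OF f q]] g] h x])
        then show "(\<Sum>p\<in>Poly_Mapping.keys h. (Poly_Mapping.lookup f q * Poly_Mapping.lookup h p) * g (\<pi> q (\<pi> p x))) =
            Poly_Mapping.lookup f q * g (\<pi> q (path_action V \<pi> h x))"
          by (simp add: L_def sum_distrib_left mult.assoc)
      qed
      also have "\<dots> = L g (path_action V \<pi> h x) f" by (simp add: L_def)
      also have "\<dots> = g (path_action V \<pi> f (path_action V \<pi> h x))"
        by (rule dual[OF g f closed[OF h x], symmetric])
      finally show "g (path_action V \<pi> (f \<otimes>\<^bsub>A\<^esub> h) x) = g (path_action V \<pi> f (path_action V \<pi> h x))" .
    qed (intro closed x f h m)+
  next
    fix c f x assume f: "f \<in> carrier A" and x: "x \<in> carrier V"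
    have cf: "c \<odot>\<^bsub>A\<^esub> f \<in> carrier A" by (rule path_smult_closed[OF f])
    show "path_action V \<pi> (c \<odot>\<^bsub>A\<^esub> f) x = c \<odot>\<^bsub>V\<^esub> path_action V \<pi> f x"
    proof (rule dual_ext[OF V])
      fix g assume g: "g \<in> dual V"
      show "g (path_action V \<pi> (c \<odot>\<^bsub>A\<^esub> f) x) = g (c \<odot>\<^bsub>V\<^esub> path_action V \<pi> f x)"
        by (simp only: dual_smult[OF g closed[OF f x]] dual[OF g cf x] dual[OF g f x] L_smult)
    qed (intro closed vs_smult[OF Vv] x f cf)+
  next
    fix x assume x: "x \<in> carrier V"
    have o: "\<one>\<^bsub>A\<^esub> \<in> carrier A"
      unfolding path_algebra_simps(4) by (intro path_sum_closed trivial_path_closed)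
    have tp: "(u, []) \<in> quiver_paths Q" if "u \<in> verts Q" for u
      using that by (simp add: quiver_paths_iff Q.awalk_Nil_iff)
    show "path_action V \<pi> \<one>\<^bsub>A\<^esub> x = x"
    proof (rule dual_ext[OF V closed[OF o x] x])
      fix g assume g: "g \<in> dual V"
      have "g (path_action V \<pi> \<one>\<^bsub>A\<^esub> x) = (\<Sum>u\<in>verts Q. g (\<pi> (u, []) x))"
        unfolding dual[OF g o x] by (simp add: path_algebra_simps L_sum trivial_path_def L_single)
      also have "\<dots> = g (\<Oplus>\<^bsub>V\<^esub>u\<in>verts Q. \<pi> (u, []) x)"
        using dual_finsum[OF Vv g, of "verts Q" "\<lambda>u. \<pi> (u, []) x"] pc[OF tp x] by simp
      finally show "g (path_action V \<pi> \<one>\<^bsub>A\<^esub> x) = g x" using one[OF x] by simp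
    qed
  qed
qed

section \<open>Equivariant modules and graded representations\<close>

lemma path_smult_zero: "0 \<odot>\<^bsub>A\<^esub> f = 0"
  by (rule poly_mapping_eqI) (simp add: lookup_smult)

lemma act_zero:
  assumes "is_fd_module A V \<rho>" "v \<in> carrier V"
  shows "\<rho> 0 v = \<zero>\<^bsub>V\<^esub>"
proof -
  have z: "0 \<in> carrier A" by (simp add: path_algebra_simps)
  have "\<rho> (0 \<odot>\<^bsub>A\<^esub> 0) v = 0 \<odot>\<^bsub>V\<^esub> \<rho> 0 v" by (rule fdm_smult[OF assms(1) z assms(2)])
  then show ?thesis
    using vs_smult_zero[OF fd_vs[OF fdm_fd[OF assms(1)]] hom_closed[OF fdm_hom[OF assms(1) z] assms(2)]]
    by (simp add: path_smult_zero)
qed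

lemma act_sum:
  assumes M: "is_fd_module A V \<rho>" and v: "v \<in> carrier V" and I: "finite I"
    and F: "\<And>i. i \<in> I \<Longrightarrow> F i \<in> carrier A"
  shows "\<rho> (sum F I) v = (\<Oplus>\<^bsub>V\<^esub>i\<in>I. \<rho> (F i) v)"
proof -
  interpret V: vectorspace CC V by (rule fd_vs[OF fdm_fd[OF M]])
  show ?thesis
    using I F
  proof induction
    case empty
    then show ?case by (simp add: act_zero[OF M v])
  next
    case (insert i I)
    have c: "\<rho> (F j) v \<in> carrier V" if "j \<in> insert i I" for j
      using hom_closed[OF fdm_hom[OF M insert.prems[OF that]] v] .
    have "\<rho> (sum F (insert i I)) v = \<rho> (F i \<oplus>\<^bsub>A\<^esub> sum F I) v"
      using insert.hyps by (simp add: path_algebra_simps(2))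
    also have "\<dots> = \<rho> (F i) v \<oplus>\<^bsub>V\<^esub> \<rho> (sum F I) v"
      using insert.prems by (intro fdm_add[OF M _ path_sum_closed v]) auto
    also have "\<dots> = (\<Oplus>\<^bsub>V\<^esub>j\<in>insert i I. \<rho> (F j) v)"
      using insert.IH insert.prems insert.hyps c by (subst V.M.finsum_insert) auto
    finally show ?case .
  qed
qed

text \<open>
  The trivial paths are orthogonal idempotents with sum the unit.
\<close>

lemma vertex_decomp:
  assumes M: "is_fd_module A V \<rho>" and v: "v \<in> carrier V"
  shows "(\<Oplus>\<^bsub>V\<^esub>x\<in>verts Q. \<rho> (trivial_path x) v) = v"
  using act_sum[OF M v fin_verts trivial_path_closed] fdm_one[OF M v]
  by (simp add: path_algebra_simps)

lemma act_trivial_trivial: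
  assumes M: "is_fd_module A V \<rho>" and v: "v \<in> carrier V" and x: "x \<in> verts Q" and y: "y \<in> verts Q"
  shows "\<rho> (trivial_path x) (\<rho> (trivial_path y) v) = (if x = y then \<rho> (trivial_path x) v else \<zero>\<^bsub>V\<^esub>)"
  using fdm_mult[OF M trivial_path_closed[OF x] trivial_path_closed[OF y] v]
    trivial_mult_trivial[OF x, of y] act_zero[OF M v] by auto

lemma act_arrow_trivial:
  assumes M: "is_fd_module A V \<rho>" and v: "v \<in> carrier V" and a: "a \<in> arcs Q" and x: "x \<in> verts Q"
  shows "\<rho> (arrow_path Q a) (\<rho> (trivial_path x) v) = (if x = tail Q a then \<rho> (arrow_path Q a) v else \<zero>\<^bsub>V\<^esub>)"
    and "\<rho> (trivial_path x) (\<rho> (arrow_path Q a) v) = (if x = head Q a then \<rho> (arrow_path Q a) v else \<zero>\<^bsub>V\<^esub>)"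
  using fdm_mult[OF M arrow_path_closed[OF a] trivial_path_closed[OF x] v]
    fdm_mult[OF M trivial_path_closed[OF x] arrow_path_closed[OF a] v]
    arrow_mult_trivial[OF a, of x] trivial_mult_arrow[OF a, of x] act_zero[OF M v] by auto

text \<open>
  The direct summand \<open>e\<^sub>x M\<close> of a module.
\<close>

definition vertex_space :: "(('x, 'e) path_elt, 'v) equiv_module \<Rightarrow> 'x \<Rightarrow> (complex, 'v) module" where
  "vertex_space M x = (vspace M)\<lparr>carrier := act M (trivial_path x) ` carrier (vspace M)\<rparr>"

text \<open>
  On \<open>e\<^sub>x M\<close> the idempotents are the weight projections of \<open>M\<close> (\<open>rep_of_idem\<close>). The composition with
  \<open>e\<^sub>x\<close> is the form in which \<open>grading_split\<close> yields a grading of \<open>e\<^sub>x M\<close>.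
\<close>

definition rep_of :: "(('x, 'e) path_elt, 'v) equiv_module \<Rightarrow> ('x, 'e, 'v) idem_rep" where
  "rep_of M = \<lparr>space = vertex_space M, arrow = (\<lambda>a. act M (arrow_path Q a)),
     idem = (\<lambda>x i w. act M (trivial_path x) (weights (vspace M) (gm_act M) i w))\<rparr>"

definition rep_of_hom :: "(('x, 'e) path_elt, 'v) equiv_module \<Rightarrow> ('v \<Rightarrow> 'v) \<Rightarrow> 'x \<Rightarrow> 'v \<Rightarrow> 'v" where
  "rep_of_hom M f = (\<lambda>x\<in>verts Q. restrict f (carrier (vertex_space M x)))"

lemma vertex_space_iff:
  assumes M: "is_fd_module A (vspace M) (act M)" and x: "x \<in> verts Q"
  shows "w \<in> carrier (vertex_space M x) \<longleftrightarrow> w \<in> carrier (vspace M) \<and> act M (trivial_path x) w = w"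
  using act_trivial_trivial[OF M _ x x] hom_closed[OF fdm_hom[OF M trivial_path_closed[OF x]]]
  by (force simp: vertex_space_def)

lemma vertex_space_ops [simp]:
  "\<zero>\<^bsub>vertex_space M x\<^esub> = \<zero>\<^bsub>vspace M\<^esub>" "v \<oplus>\<^bsub>vertex_space M x\<^esub> w = v \<oplus>\<^bsub>vspace M\<^esub> w"
  "c \<odot>\<^bsub>vertex_space M x\<^esub> v = c \<odot>\<^bsub>vspace M\<^esub> v"
  by (simp_all add: vertex_space_def)

context
  fixes T :: "'e \<Rightarrow> int" and \<alpha> :: "complex \<Rightarrow> ('x, 'e) path_elt \<Rightarrow> ('x, 'e) path_elt"
  assumes \<alpha>: "\<alpha> \<in> hom (mult_of CC) (algebra_Aut A)"
    and \<alpha>_trivial: "\<And>z x. z \<noteq> 0 \<Longrightarrow> x \<in> verts Q \<Longrightarrow> \<alpha> z (trivial_path x) = trivial_path x"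
    and \<alpha>_arrow: "\<And>z a. z \<noteq> 0 \<Longrightarrow> a \<in> arcs Q \<Longrightarrow>
      \<alpha> z (arrow_path Q a) = z powi T a \<odot>\<^bsub>A\<^esub> arrow_path Q a"
begin

lemma \<alpha>_hom:
  assumes "z \<noteq> 0"
  shows "\<alpha> z \<in> module_hom CC A A"
    and "f \<in> carrier A \<Longrightarrow> g \<in> carrier A \<Longrightarrow>
      \<alpha> z (f \<otimes>\<^bsub>A\<^esub> g) = \<alpha> z f \<otimes>\<^bsub>A\<^esub> \<alpha> z g"
proof -
  have "\<alpha> z \<in> Ring.ring_hom A A \<inter>
      module_hom CC A A"
    using \<alpha> assms by (auto simp: hom_def algebra_Aut_def)
  then show "\<alpha> z \<in> module_hom CC A A"
    "f \<in> carrier A \<Longrightarrow> g \<in> carrier A \<Longrightarrow>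
      \<alpha> z (f \<otimes>\<^bsub>A\<^esub> g) = \<alpha> z f \<otimes>\<^bsub>A\<^esub> \<alpha> z g"
    by (auto simp: ring_hom_mult)
qed

text \<open>
  The elements \<open>f\<close> for which the left-hand side is true form a subalgebra, because \<open>\<alpha> z\<close> is an algebra
  homomorphism and \<open>\<rho>\<close> is a module structure. So it is enough that trivial paths and arrows belong to it;
  for these \<open>\<alpha> z\<close> is known and \<open>intertwine_iff\<close> applies with shift \<open>0\<close> and \<open>T a\<close>.
\<close>

lemma equivariance_iff:
  assumes M: "is_fd_module A V \<rho>" and P: "grading V P"
  shows "(\<forall>z f m. z \<noteq> 0 \<longrightarrow> f \<in> carrier A \<longrightarrow> m \<in> carrier V \<longrightarrow>
            \<rho> (\<alpha> z f) (torus_of V P z m) = torus_of V P z (\<rho> f m)) \<longleftrightarrow>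
         (\<forall>x\<in>verts Q. \<forall>m\<in>carrier V. \<forall>k. \<rho> (trivial_path x) (P k m) = P k (\<rho> (trivial_path x) m)) \<and>
         (\<forall>a\<in>arcs Q. \<forall>m\<in>carrier V. \<forall>k. \<rho> (arrow_path Q a) (P k m) = P (k + T a) (\<rho> (arrow_path Q a) m))"
    (is "?L \<longleftrightarrow> ?R")
proof -
  note V = fdm_fd[OF M] and Vv = fd_vs[OF fdm_fd[OF M]]
  let ?t = "torus_of V P"
  note tc = torus_of_closed[OF Vv P]
  note th = trivial_path_closed and ah = arrow_path_closed
  have triv: "(\<forall>k. \<rho> (trivial_path x) (P k m) = P k (\<rho> (trivial_path x) m)) \<longleftrightarrow>
      (\<forall>z. z \<noteq> 0 \<longrightarrow> \<rho> (\<alpha> z (trivial_path x)) (?t z m) = ?t z (\<rho> (trivial_path x) m))"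
    if x: "x \<in> verts Q" and m: "m \<in> carrier V" for x m
    using intertwine0_iff[OF Vv P V P fdm_hom[OF M th[OF x]] m hom_closed[OF fdm_hom[OF M th[OF x]] m]]
    by (simp add: \<alpha>_trivial x)
  have arr: "(\<forall>k. \<rho> (arrow_path Q a) (P k m) = P (k + T a) (\<rho> (arrow_path Q a) m)) \<longleftrightarrow>
      (\<forall>z. z \<noteq> 0 \<longrightarrow> \<rho> (\<alpha> z (arrow_path Q a)) (?t z m) = ?t z (\<rho> (arrow_path Q a) m))"
    if a: "a \<in> arcs Q" and m: "m \<in> carrier V" for a m
    using intertwine_iff[OF Vv P V P fdm_hom[OF M ah[OF a]] m hom_closed[OF fdm_hom[OF M ah[OF a]] m], of "T a"]
    by (simp add: \<alpha>_arrow a fdm_smult[OF M ah[OF a] tc[OF m]])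
  show ?thesis
  proof
    assume ?L
    then show ?R using triv arr th ah by blast
  next
    assume R: ?R
    have rt: "\<rho> (\<alpha> z (trivial_path x)) (?t z m) = ?t z (\<rho> (trivial_path x) m)"
      if "z \<noteq> 0" "x \<in> verts Q" "m \<in> carrier V" for z x m using R triv that by blast
    have ra: "\<rho> (\<alpha> z (arrow_path Q a)) (?t z m) = ?t z (\<rho> (arrow_path Q a) m)"
      if "z \<noteq> 0" "a \<in> arcs Q" "m \<in> carrier V" for z a m using R arr that by blast
    show ?L
    proof (intro allI impI)
      fix z :: complex and f m assume z: "z \<noteq> 0" and f: "f \<in> carrier A" and m: "m \<in> carrier V"
      note ah' = \<alpha>_hom[OF z]
      note ac = hom_closed[OF ah'(1)]
      note thom = torus_of_hom[OF V P, of z]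
      show "\<rho> (\<alpha> z f) (?t z m) = ?t z (\<rho> f m)"
        using f m
      proof (induction f arbitrary: m rule: path_algebra_induct)
        case 1
        have z0: "0 \<in> carrier A" by (simp add: path_algebra_simps)
        have "\<alpha> z (0 \<odot>\<^bsub>A\<^esub> 0) = 0 \<odot>\<^bsub>A\<^esub> \<alpha> z 0" by (rule hom_smult[OF ah'(1) z0])
        then have "\<alpha> z 0 = 0" by (simp add: path_smult_zero)
        then show ?case
          using 1 by (simp add: act_zero[OF M] tc hom_zero[OF Vv Vv thom])
      next
        case (2 f g)
        have fg: "\<alpha> z (f + g) = \<alpha> z f + \<alpha> z g"
          using hom_add[OF ah'(1) 2(1,2)] by (simp add: path_algebra_simps)
        note rc = hom_closed[OF fdm_hom[OF M]]
        note add = fdm_add[OF M, unfolded path_algebra_simps(2)]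
        show ?case
          using 2 by (simp add: fg add ac tc hom_add[OF thom] rc)
      next
        case (3 c f)
        note rc = hom_closed[OF fdm_hom[OF M]]
        show ?case
          using 3 by (simp add: hom_smult[OF ah'(1)] fdm_smult[OF M] ac tc hom_smult[OF thom] rc)
      next
        case (4 x)
        then show ?case using rt[OF z] by blast
      next
        case (5 a f)
        note rc = hom_closed[OF fdm_hom[OF M]]
        show ?case
          using 5 ra[OF z 5(1)] by (simp add: ah'(2) ah fdm_mult[OF M] ac tc rc)
      qed
    qed
  qed
qed

lemma equiv_module_weights:
  assumes M: "is_equiv_module A \<alpha> M"
  shows module_grading: "grading (vspace M) (weights (vspace M) (gm_act M))"
    and weights_trivial: "x \<in> verts Q \<Longrightarrow> m \<in> carrier (vspace M) \<Longrightarrow>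
      act M (trivial_path x) (weights (vspace M) (gm_act M) k m) =
      weights (vspace M) (gm_act M) k (act M (trivial_path x) m)"
    and weights_arrow: "a \<in> arcs Q \<Longrightarrow> m \<in> carrier (vspace M) \<Longrightarrow>
      act M (arrow_path Q a) (weights (vspace M) (gm_act M) k m) =
      weights (vspace M) (gm_act M) (k + T a) (act M (arrow_path Q a) m)"
proof -
  note Md = eqm_module[OF M] and V = fdm_fd[OF eqm_module[OF M]]
  let ?P = "weights (vspace M) (gm_act M)"
  show P: "grading (vspace M) ?P" by (rule weights_grading[OF V eqm_algebraic[OF M]])
  have "act M (\<alpha> z f) (torus_of (vspace M) ?P z m) = torus_of (vspace M) ?P z (act M f m)"
    if "z \<noteq> 0" "f \<in> carrier A" "m \<in> carrier (vspace M)" for z f m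
    using eqm_equivariant[OF M that] that
    by (simp add: weights_torus[OF V eqm_algebraic[OF M]] hom_closed[OF fdm_hom[OF Md]])
  then show "x \<in> verts Q \<Longrightarrow> m \<in> carrier (vspace M) \<Longrightarrow>
      act M (trivial_path x) (?P k m) = ?P k (act M (trivial_path x) m)"
    "a \<in> arcs Q \<Longrightarrow> m \<in> carrier (vspace M) \<Longrightarrow>
      act M (arrow_path Q a) (?P k m) = ?P (k + T a) (act M (arrow_path Q a) m)"
    using equivariance_iff[OF Md P] by blast+
qed

lemma rep_of_idem:
  assumes M: "is_equiv_module A \<alpha> M" and x: "x \<in> verts Q" and w: "w \<in> carrier (vertex_space M x)"
  shows "idem (rep_of M) x k w = weights (vspace M) (gm_act M) k w"
  using w weights_trivial[OF M x, of w k] by (simp add: rep_of_def vertex_space_iff[OF eqm_module[OF M] x])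

text \<open>
  The projections commute with the \<open>e\<^sub>x\<close>, so they restrict to gradings of the spaces \<open>e\<^sub>x M\<close>.
\<close>

lemma rep_of_is_idem_rep:
  assumes M: "is_equiv_module A \<alpha> M"
  shows "is_idem_rep Q (rep_of M)"
proof -
  note Md = eqm_module[OF M] and V = fdm_fd[OF eqm_module[OF M]]
  note P = module_grading[OF M]
  have th: "act M (trivial_path x) \<in> module_hom CC (vspace M) (vspace M)" if "x \<in> verts Q" for x
    by (rule fdm_hom[OF Md trivial_path_closed[OF that]])
  have fd: "fd_vectorspace (vertex_space M x)" if "x \<in> verts Q" for x
    unfolding vertex_space_def by (rule image_fd[OF V th[OF that]])
  have inc: "(\<lambda>w. w) \<in> module_hom CC (vertex_space M x) (vspace M)" if "x \<in> verts Q" for x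
    unfolding vertex_space_def by (rule image_inclusion[OF V th[OF that]])
  have proj: "act M (trivial_path x) \<in> module_hom CC (vspace M) (vertex_space M x)" if "x \<in> verts Q" for x
    unfolding vertex_space_def by (rule image_hom[OF V th[OF that]])
  have "act M (arrow_path Q a) \<in> module_hom CC (vertex_space M (tail Q a)) (vertex_space M (head Q a))"
    if a: "a \<in> arcs Q" for a
  proof -
    note ah = fdm_hom[OF Md arrow_path_closed[OF a]]
    have c: "w \<in> carrier (vspace M)" if "w \<in> carrier (vertex_space M (tail Q a))" for w
      using that vertex_space_iff[OF Md Q.tail_in_verts[OF a]] by blast
    show ?thesis
    proof (rule homI)
      show "act M (arrow_path Q a) w \<in> carrier (vertex_space M (head Q a))"
        if "w \<in> carrier (vertex_space M (tail Q a))" for w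
        using act_arrow_trivial(2)[OF Md c[OF that] a Q.head_in_verts[OF a]] hom_closed[OF ah c[OF that]]
        by (simp add: vertex_space_iff[OF Md Q.head_in_verts[OF a]])
    qed (simp_all add: hom_add[OF ah] hom_smult[OF ah] c)
  qed
  moreover have "grading (vertex_space M x) (\<lambda>i w. act M (trivial_path x) (weights (vspace M) (gm_act M) i w))"
    if x: "x \<in> verts Q" for x
    by (rule grading_split[OF fd_vs[OF V] P fd[OF x] inc[OF x] proj[OF x]])
      (simp_all add: vertex_space_iff[OF Md x] weights_trivial[OF M x])
  ultimately show ?thesis
    using fd by (simp add: is_idem_rep_iff is_rep_def rep_of_def)
qed

text \<open>
  Since an arrow raises weights by \<open>T a\<close>, its block from weight \<open>k\<close> to any weight other than \<open>k + T a\<close> is zero.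
\<close>

lemma rep_of_obj:
  assumes M: "is_equiv_module A \<alpha> M"
  shows "rep_of M \<in> obj (Mod_Idem_T Q T)"
proof -
  note Md = eqm_module[OF M] and V = fdm_fd[OF eqm_module[OF M]] and P = module_grading[OF M]
  note Vv = fd_vs[OF V]
  note rep = rep_of_is_idem_rep[OF M]
  have "idem (rep_of M) (head Q a) i (arrow (rep_of M) a (idem (rep_of M) (tail Q a) k w)) = \<zero>\<^bsub>vspace M\<^esub>"
    if a: "a \<in> arcs Q" and ik: "i - k \<noteq> T a" and w: "w \<in> carrier (vertex_space M (tail Q a))" for a i k w
  proof -
    have wV: "w \<in> carrier (vspace M)" using w vertex_space_iff[OF Md Q.tail_in_verts[OF a]] by blast
    have aw: "act M (arrow_path Q a) w \<in> carrier (vspace M)"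
      by (rule hom_closed[OF fdm_hom[OF Md arrow_path_closed[OF a]] wV])
    have "i \<noteq> k + T a" using ik by simp
    then show ?thesis
      using grading_orth[OF P _ aw, of i "k + T a"]
      by (simp add: rep_of_idem[OF M Q.tail_in_verts[OF a] w])
        (simp add: rep_of_def weights_arrow[OF M a wV]
          hom_zero[OF Vv Vv fdm_hom[OF Md trivial_path_closed[OF Q.head_in_verts[OF a]]]])
  qed
  then show ?thesis
    using rep by (auto simp: Mod_Idem_T_def Mod_Idem_def rep_of_def)
qed

lemma rep_of_hom_hom:
  assumes M: "is_equiv_module A \<alpha> M" and N: "is_equiv_module A \<alpha> N"
    and f: "f \<in> equiv_module_hom A M N"
  shows "rep_of_hom M f \<in> idem_rep_hom Q (rep_of M) (rep_of N)"
proof -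
  note Md = eqm_module[OF M] and Nd = eqm_module[OF N]
  note V = fdm_fd[OF Md] and W = fdm_fd[OF Nd]
  note fh = lin_hom[OF eqh_lin[OF f]] and fa = eqh_act[OF f]
  note rM = rep_of_is_idem_rep[OF M] and rN = rep_of_is_idem_rep[OF N]
  have sp: "space (rep_of M) = vertex_space M" "space (rep_of N) = vertex_space N" by (simp_all add: rep_of_def)
  have memV: "w \<in> carrier (vspace M)" if "x \<in> verts Q" "w \<in> carrier (vertex_space M x)" for x w
    using that vertex_space_iff[OF Md that(1)] by blast
  have fx: "f w \<in> carrier (vertex_space N x)" if "x \<in> verts Q" "w \<in> carrier (vertex_space M x)" for x w
    using that fa[OF trivial_path_closed[OF that(1)] memV[OF that]] hom_closed[OF fh memV[OF that]]
    by (simp add: vertex_space_iff[OF Md that(1)] vertex_space_iff[OF Nd that(1)])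
  have lin: "restrict f (carrier (vertex_space M x)) \<in> lin (vertex_space M x) (vertex_space N x)" if x: "x \<in> verts Q" for x
  proof (rule restrict_lin)
    show "vectorspace CC (vertex_space M x)"
      using rM x fd_vs[OF rep_fd[of Q "rep_of M" x]] by (simp add: is_idem_rep_iff sp)
    show "f \<in> module_hom CC (vertex_space M x) (vertex_space N x)"
      by (rule homI) (simp_all add: fx x memV[OF x] hom_add[OF fh] hom_smult[OF fh])
  qed
  have arr: "arrow (rep_of M) a w \<in> carrier (vertex_space M (head Q a))"
    if "a \<in> arcs Q" "w \<in> carrier (vertex_space M (tail Q a))" for a w
    using rM hom_closed[OF rep_arrow[of Q "rep_of M" a]] that by (simp add: is_idem_rep_iff sp)
  have "f (act M (arrow_path Q a) w) = act N (arrow_path Q a) (f w)"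
    if "a \<in> arcs Q" "w \<in> carrier (vertex_space M (tail Q a))" for a w
    using fa[OF arrow_path_closed[OF that(1)] memV[OF Q.tail_in_verts that(2)]] that by simp
  then have "rep_of_hom M f \<in> rep_hom Q (rep_of M) (rep_of N)"
    using lin arr
    by (auto simp: rep_hom_def rep_of_hom_def sp) (simp add: rep_of_def)
  moreover have "rep_of_hom M f x (idem (rep_of M) x i w) = idem (rep_of N) x i (rep_of_hom M f x w)"
    if x: "x \<in> verts Q" and w: "w \<in> carrier (vertex_space M x)" for x i w
  proof -
    let ?P = "weights (vspace M) (gm_act M)" and ?R = "weights (vspace N) (gm_act N)"
    have "\<forall>z. z \<noteq> 0 \<longrightarrow> f (torus_of (vspace M) ?P z w) = torus_of (vspace N) ?R z (f w)"
      using eqh_gm[OF f _ memV[OF x w]] weights_torus[OF V eqm_algebraic[OF M] _ memV[OF x w]]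
        weights_torus[OF W eqm_algebraic[OF N] _ hom_closed[OF fh memV[OF x w]]] by simp
    then have "f (?P i w) = ?R i (f w)"
      using intertwine0_iff[OF fd_vs[OF V] module_grading[OF M] W module_grading[OF N] fh memV[OF x w]
          hom_closed[OF fh memV[OF x w]]] by blast
    moreover have "idem (rep_of M) x i w \<in> carrier (vertex_space M x)"
      using rM grading_closed[of "vertex_space M x" "idem (rep_of M) x" w i] x w
      by (simp add: is_idem_rep_iff sp)
    ultimately show ?thesis
      using x w fx[OF x w] rep_of_idem[OF M x w, of i] rep_of_idem[OF N x fx[OF x w], of i]
      by (simp add: rep_of_hom_def)
  qed
  ultimately show ?thesis by (simp add: idem_rep_hom_def sp)
qed

text \<open>
  A vector \<open>v\<close> is the sum of the \<open>e\<^sub>x v\<close>, so a morphism is determined by its restrictions.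
\<close>

lemma rep_of_faithful:
  assumes M: "is_equiv_module A \<alpha> M" and N: "is_equiv_module A \<alpha> N"
    and f: "f \<in> equiv_module_hom A M N" and g: "g \<in> equiv_module_hom A M N"
    and eq: "rep_of_hom M f = rep_of_hom M g"
  shows "f = g"
proof (rule extensionalityI[OF lin_ext[OF eqh_lin[OF f]] lin_ext[OF eqh_lin[OF g]]])
  note Md = eqm_module[OF M] and Nd = eqm_module[OF N]
  note Vv = fd_vs[OF fdm_fd[OF Md]] and Wv = fd_vs[OF fdm_fd[OF Nd]]
  interpret W: vectorspace CC "vspace N" by (rule Wv)
  fix v assume v: "v \<in> carrier (vspace M)"
  have c: "act M (trivial_path x) v \<in> carrier (vspace M)" if "x \<in> verts Q" for x
    by (rule hom_closed[OF fdm_hom[OF Md trivial_path_closed[OF that]] v])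
  have fg: "f (act M (trivial_path x) v) = g (act M (trivial_path x) v)" if x: "x \<in> verts Q" for x
  proof -
    have m: "act M (trivial_path x) v \<in> carrier (vertex_space M x)"
      using act_trivial_trivial[OF Md v x x] c[OF x] by (simp add: vertex_space_iff[OF Md x])
    show ?thesis using fun_cong[OF fun_cong[OF eq, of x], of "act M (trivial_path x) v"] x m
      by (simp add: rep_of_hom_def)
  qed
  have ex: "h v = (\<Oplus>\<^bsub>vspace N\<^esub>x\<in>verts Q. h (act M (trivial_path x) v))"
    if h: "h \<in> equiv_module_hom A M N" for h
    using hom_finsum[OF Vv Wv lin_hom[OF eqh_lin[OF h]], of "verts Q" "\<lambda>x. act M (trivial_path x) v"] c
    by (simp add: vertex_decomp[OF Md v])
  show "f v = g v"
    unfolding ex[OF f] ex[OF g]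
    using fg hom_closed[OF lin_hom[OF eqh_lin[OF g]] c] by (intro W.M.finsum_cong') auto
qed

text \<open>
  The extension of \<open>\<phi>\<close> is \<open>h v = (\<Sum>x. \<phi> x (e\<^sub>x v))\<close>. It commutes with trivial paths and arrows, hence with the
  path algebra. It commutes with the projections because \<open>\<phi>\<close> does so at each vertex, hence with the torus.
\<close>

lemma rep_of_full:
  assumes M: "is_equiv_module A \<alpha> M" and N: "is_equiv_module A \<alpha> N"
    and \<phi>: "\<phi> \<in> idem_rep_hom Q (rep_of M) (rep_of N)"
  shows "\<exists>f\<in>equiv_module_hom A M N. rep_of_hom M f = \<phi>"
proof -
  note Md = eqm_module[OF M] and Nd = eqm_module[OF N]
  note V = fdm_fd[OF Md] and W = fdm_fd[OF Nd]
  note Vv = fd_vs[OF V] and Wv = fd_vs[OF W]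
  interpret W: vectorspace CC "vspace N" by (rule Wv)
  note th = trivial_path_closed and ah = arrow_path_closed
  note actM = fdm_hom[OF Md] and actN = fdm_hom[OF Nd]
  note aMc = hom_closed[OF actM] and aNc = hom_closed[OF actN]
  let ?e = "\<lambda>x. act M (trivial_path x)" and ?e' = "\<lambda>x. act N (trivial_path x)"
  have sp: "space (rep_of M) = vertex_space M" "space (rep_of N) = vertex_space N" by (simp_all add: rep_of_def)
  have \<phi>r: "\<phi> \<in> rep_hom Q (rep_of M) (rep_of N)" using \<phi> by (simp add: idem_rep_hom_def)
  have memM: "?e x v \<in> carrier (vertex_space M x)" if "x \<in> verts Q" "v \<in> carrier (vspace M)" for x v
    using act_trivial_trivial[OF Md that(2) that(1) that(1)] aMc[OF th[OF that(1)] that(2)]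
    by (simp add: vertex_space_iff[OF Md that(1)])
  have \<phi>h: "\<phi> x \<in> module_hom CC (vertex_space M x) (vertex_space N x)" if "x \<in> verts Q" for x
    using lin_hom[OF rep_hom_lin[OF \<phi>r that]] by (simp add: sp)
  have \<phi>c: "\<phi> x w \<in> carrier (vspace N)" "?e' x (\<phi> x w) = \<phi> x w"
    if "x \<in> verts Q" "w \<in> carrier (vertex_space M x)" for x w
    using hom_closed[OF \<phi>h[OF that(1)] that(2)] vertex_space_iff[OF Nd that(1)] by auto
  have \<phi>0: "\<phi> x \<zero>\<^bsub>vspace M\<^esub> = \<zero>\<^bsub>vspace N\<^esub>" if x: "x \<in> verts Q" for x
  proof -
    have "\<zero>\<^bsub>vspace M\<^esub> \<in> carrier (vertex_space M x)"
      using hom_zero[OF Vv Vv actM[OF th[OF x]]] vs_zero[OF Vv] by (simp add: vertex_space_iff[OF Md x])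
    then show ?thesis
      using hom_smult[OF \<phi>h[OF x], of "\<zero>\<^bsub>vspace M\<^esub>" 0] \<phi>c(1)[OF x]
      by (simp add: vs_smult_of_zero[OF Vv] vs_smult_zero[OF Wv])
  qed
  define h where "h v = (\<Oplus>\<^bsub>vspace N\<^esub>x\<in>verts Q. \<phi> x (?e x v))" for v
  have term_c: "\<phi> x (?e x v) \<in> carrier (vspace N)" if "x \<in> verts Q" "v \<in> carrier (vspace M)" for x v
    by (rule \<phi>c(1)[OF that(1) memM[OF that]])
  have hc: "h v \<in> carrier (vspace N)" if "v \<in> carrier (vspace M)" for v
    unfolding h_def using term_c that by (intro vs_finsum[OF Wv])
  have dual_h: "g (h v) = (\<Sum>x\<in>verts Q. g (\<phi> x (?e x v)))" if "g \<in> dual (vspace N)" "v \<in> carrier (vspace M)" for g v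
    unfolding h_def using term_c that(2) by (intro dual_finsum[OF Wv that(1)])
  have hh: "h \<in> module_hom CC (vspace M) (vspace N)"
  proof (rule homI)
    show "h v \<in> carrier (vspace N)" if "v \<in> carrier (vspace M)" for v by (rule hc[OF that])
    show "h (v \<oplus>\<^bsub>vspace M\<^esub> w) = h v \<oplus>\<^bsub>vspace N\<^esub> h w" if v: "v \<in> carrier (vspace M)" and w: "w \<in> carrier (vspace M)" for v w
    proof (rule dual_ext[OF W])
      fix g assume g: "g \<in> dual (vspace N)"
      have "g (\<phi> x (?e x (v \<oplus>\<^bsub>vspace M\<^esub> w))) = g (\<phi> x (?e x v)) + g (\<phi> x (?e x w))" if x: "x \<in> verts Q" for x
        using hom_add[OF \<phi>h[OF x] memM[OF x v] memM[OF x w]]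
        by (simp add: hom_add[OF actM[OF th[OF x]] v w] dual_add[OF g term_c[OF x v] term_c[OF x w]])
      then show "g (h (v \<oplus>\<^bsub>vspace M\<^esub> w)) = g (h v \<oplus>\<^bsub>vspace N\<^esub> h w)"
        by (simp add: dual_add[OF g hc[OF v] hc[OF w]] dual_h[OF g] v w vs_add[OF Vv] sum.distrib)
    qed (auto intro!: hc vs_add[OF Vv] vs_add[OF Wv] v w)
    show "h (c \<odot>\<^bsub>vspace M\<^esub> v) = c \<odot>\<^bsub>vspace N\<^esub> h v" if v: "v \<in> carrier (vspace M)" for c v
    proof (rule dual_ext[OF W])
      fix g assume g: "g \<in> dual (vspace N)"
      have "g (\<phi> x (?e x (c \<odot>\<^bsub>vspace M\<^esub> v))) = c * g (\<phi> x (?e x v))" if x: "x \<in> verts Q" for x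
        using hom_smult[OF \<phi>h[OF x] memM[OF x v]]
        by (simp add: hom_smult[OF actM[OF th[OF x]] v] dual_smult[OF g term_c[OF x v]])
      then show "g (h (c \<odot>\<^bsub>vspace M\<^esub> v)) = g (c \<odot>\<^bsub>vspace N\<^esub> h v)"
        by (simp add: dual_smult[OF g hc[OF v]] dual_h[OF g] v vs_smult[OF Vv] sum_distrib_left)
    qed (auto intro!: hc vs_smult[OF Vv] vs_smult[OF Wv] v)
  qed
  have h_e: "h (?e y v) = \<phi> y (?e y v)" if y: "y \<in> verts Q" and v: "v \<in> carrier (vspace M)" for y v
  proof -
    have "h (?e y v) = \<phi> y (?e y (?e y v))"
      unfolding h_def
    proof (rule finsum_single[OF Wv fin_verts y])
      show "\<phi> y (?e y (?e y v)) \<in> carrier (vspace N)" by (rule term_c[OF y aMc[OF th[OF y] v]])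
      show "\<phi> x (?e x (?e y v)) = \<zero>\<^bsub>vspace N\<^esub>" if "x \<in> verts Q" "x \<noteq> y" for x
        using act_trivial_trivial[OF Md v that(1) y] that \<phi>0 by simp
    qed
    then show ?thesis using act_trivial_trivial[OF Md v y y] by simp
  qed
  have e_h: "?e' y (h v) = \<phi> y (?e y v)" if y: "y \<in> verts Q" and v: "v \<in> carrier (vspace M)" for y v
  proof -
    have "?e' y (h v) = (\<Oplus>\<^bsub>vspace N\<^esub>x\<in>verts Q. ?e' y (\<phi> x (?e x v)))"
      unfolding h_def using term_c[OF _ v] by (intro hom_finsum[OF Wv Wv actN[OF th[OF y]]])
    also have "\<dots> = ?e' y (\<phi> y (?e y v))"
    proof (rule finsum_single[OF Wv fin_verts y])
      show "?e' y (\<phi> y (?e y v)) \<in> carrier (vspace N)" by (rule aNc[OF th[OF y] term_c[OF y v]])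
    next
      fix x assume x: "x \<in> verts Q" "x \<noteq> y"
      show "?e' y (\<phi> x (?e x v)) = \<zero>\<^bsub>vspace N\<^esub>"
        using act_trivial_trivial[OF Nd term_c[OF x(1) v] y x(1)] \<phi>c(2)[OF x(1) memM[OF x(1) v]] x by simp
    qed
    also have "\<dots> = \<phi> y (?e y v)" by (rule \<phi>c(2)[OF y memM[OF y v]])
    finally show ?thesis .
  qed
  have h_triv: "h (?e y v) = ?e' y (h v)" if "y \<in> verts Q" "v \<in> carrier (vspace M)" for y v
    using h_e[OF that] e_h[OF that] by simp
  have h_arr: "h (act M (arrow_path Q a) v) = act N (arrow_path Q a) (h v)"
    if a: "a \<in> arcs Q" and v: "v \<in> carrier (vspace M)" for a v
  proof -
    let ?t = "tail Q a" and ?h = "head Q a"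
    note t = Q.tail_in_verts[OF a] and hd = Q.head_in_verts[OF a]
    let ?av = "act M (arrow_path Q a) v"
    have av: "?av \<in> carrier (vspace M)" by (rule aMc[OF ah[OF a] v])
    have "h ?av = h (?e ?h ?av)" using act_arrow_trivial(2)[OF Md v a hd] by simp
    also have "\<dots> = \<phi> ?h (?e ?h ?av)" by (rule h_e[OF hd av])
    also have "\<dots> = \<phi> ?h (act M (arrow_path Q a) (?e ?t v))"
      using act_arrow_trivial(2)[OF Md v a hd] act_arrow_trivial(1)[OF Md v a t] by simp
    also have "\<dots> = act N (arrow_path Q a) (\<phi> ?t (?e ?t v))"
      using rep_hom_arrow[OF \<phi>r a, of "?e ?t v"] memM[OF t v] by (simp add: sp) (simp add: rep_of_def)
    also have "\<dots> = act N (arrow_path Q a) (?e' ?t (h v))" by (simp add: e_h[OF t v])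
    also have "\<dots> = act N (arrow_path Q a) (h v)"
      using act_arrow_trivial(1)[OF Nd hc[OF v] a t] by simp
    finally show ?thesis .
  qed
  have h_act: "h (act M b v) = act N b (h v)" if "b \<in> carrier A" "v \<in> carrier (vspace M)" for b v
    using that
  proof (induction b arbitrary: v rule: path_algebra_induct)
    case 1
    then show ?case by (simp add: act_zero[OF Md] act_zero[OF Nd hc] hom_zero[OF Vv Wv hh])
  next
    case (2 f g)
    note addM = fdm_add[OF Md, unfolded path_algebra_simps(2)] and addN = fdm_add[OF Nd, unfolded path_algebra_simps(2)]
    show ?case using 2 by (simp add: addM addN hc hom_add[OF hh] aMc)
  next
    case (3 c f)
    then show ?case by (simp add: fdm_smult[OF Md] fdm_smult[OF Nd] hc hom_smult[OF hh] aMc)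
  next
    case (4 x)
    then show ?case by (rule h_triv)
  next
    case (5 a f)
    then show ?case by (simp add: fdm_mult[OF Md] fdm_mult[OF Nd] ah hc aMc h_arr)
  qed
  let ?P = "weights (vspace M) (gm_act M)" and ?R = "weights (vspace N) (gm_act N)"
  note P = module_grading[OF M] and R = module_grading[OF N]
  have h_P: "h (?P k v) = ?R k (h v)" if v: "v \<in> carrier (vspace M)" for k v
  proof -
    have "?e' x (h (?P k v)) = ?e' x (?R k (h v))" if x: "x \<in> verts Q" for x
    proof -
      let ?w = "?e x v"
      have w: "?w \<in> carrier (vertex_space M x)" by (rule memM[OF x v])
      have \<phi>w: "\<phi> x ?w \<in> carrier (vertex_space N x)" by (rule hom_closed[OF \<phi>h[OF x] w])
      have "\<phi> x (idem (rep_of M) x k ?w) = idem (rep_of N) x k (\<phi> x ?w)"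
        using \<phi> x w by (simp add: idem_rep_hom_def sp)
      then have "\<phi> x (?P k ?w) = ?R k (\<phi> x ?w)"
        by (simp add: rep_of_idem[OF M x w] rep_of_idem[OF N x \<phi>w])
      then show ?thesis
        using e_h[OF x grading_closed[OF P v]] weights_trivial[OF M x v] weights_trivial[OF N x hc[OF v]]
          e_h[OF x v] by simp
    qed
    then have "(\<Oplus>\<^bsub>vspace N\<^esub>x\<in>verts Q. ?e' x (h (?P k v))) = (\<Oplus>\<^bsub>vspace N\<^esub>x\<in>verts Q. ?e' x (?R k (h v)))"
      using aNc[OF th grading_closed[OF R hc[OF v]]] by (intro W.M.finsum_cong') auto
    then show ?thesis
      by (simp add: vertex_decomp[OF Nd] hc grading_closed[OF P] grading_closed[OF R] v)
  qed
  have h_gm: "h (gm_act M z v) = gm_act N z (h v)" if z: "z \<noteq> 0" and v: "v \<in> carrier (vspace M)" for z v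
    using intertwine0_iff[OF Vv P W R hh v hc[OF v]] h_P[OF v] z
    by (simp add: weights_torus[OF V eqm_algebraic[OF M] z v] weights_torus[OF W eqm_algebraic[OF N] z hc[OF v]])
  let ?f = "restrict h (carrier (vspace M))"
  have "?f \<in> equiv_module_hom A M N"
    using restrict_lin[OF Vv hh] h_act h_gm aMc hom_closed[OF algebraic_hom[OF eqm_algebraic[OF M]]]
    by (simp add: equiv_module_hom_def)
  moreover have "rep_of_hom M ?f = \<phi>"
  proof (rule rep_hom_eqI[OF _ \<phi>r])
    show "rep_of_hom M ?f \<in> rep_hom Q (rep_of M) (rep_of N)"
      using rep_of_hom_hom[OF M N calculation] by (simp add: idem_rep_hom_def)
    fix x w assume x: "x \<in> verts Q" and w: "w \<in> carrier (space (rep_of M) x)"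
    then show "rep_of_hom M ?f x w = \<phi> x w"
      using h_e[OF x, of w] vertex_space_iff[OF Md x, of w] by (simp add: rep_of_hom_def sp)
  qed
  ultimately show ?thesis by blast
qed

lemma Mod_Idem_T_obj_iff:
  "N \<in> obj (Mod_Idem_T Q T) \<longleftrightarrow> is_idem_rep Q N \<and>
     (\<forall>a\<in>arcs Q. \<forall>i k. i - k \<noteq> T a \<longrightarrow> (\<forall>v\<in>carrier (space N (tail Q a)).
        idem N (head Q a) i (arrow N a (idem N (tail Q a) k v)) = \<zero>\<^bsub>space N (head Q a)\<^esub>))"
  by (simp add: Mod_Idem_T_def Mod_Idem_def)

lemma Hom_Mod_Idem_T [simp]:
  "Hom (Mod_Idem_T Q T) = idem_rep_hom Q" "idn (Mod_Idem_T Q T) = rep_id Q"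
  "cmp (Mod_Idem_T Q T) X Y Z \<psi> \<phi> = rep_comp Q X \<psi> \<phi>"
  by (simp_all add: Mod_Idem_T_def Mod_Idem_def)

text \<open>
  Every vector of \<open>N\<close> is of the form \<open>\<phi> x m\<close>, so the laws of a morphism pass from \<open>\<phi>\<close> to its inverse.
\<close>

lemma idem_rep_isomorphismI:
  assumes M: "is_idem_rep Q M" and N: "is_idem_rep Q N" and \<phi>: "\<phi> \<in> idem_rep_hom Q M N"
    and \<psi>c: "\<And>x n. x \<in> verts Q \<Longrightarrow> n \<in> carrier (space N x) \<Longrightarrow> \<psi> x n \<in> carrier (space M x)"
    and \<phi>\<psi>: "\<And>x n. x \<in> verts Q \<Longrightarrow> n \<in> carrier (space N x) \<Longrightarrow> \<phi> x (\<psi> x n) = n"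
    and \<psi>\<phi>: "\<And>x m. x \<in> verts Q \<Longrightarrow> m \<in> carrier (space M x) \<Longrightarrow> \<psi> x (\<phi> x m) = m"
  shows "is_isomorphism (Mod_Idem_T Q T) M N \<phi>"
proof -
  have rM: "is_rep Q M" and rN: "is_rep Q N"
    and gM: "\<And>x. x \<in> verts Q \<Longrightarrow> grading (space M x) (idem M x)"
    and gN: "\<And>x. x \<in> verts Q \<Longrightarrow> grading (space N x) (idem N x)"
    using M N by (auto simp: is_idem_rep_iff)
  have \<phi>r: "\<phi> \<in> rep_hom Q M N" using \<phi> by (simp add: idem_rep_hom_def)
  note vM = fd_vs[OF rep_fd[OF rM]] and vN = fd_vs[OF rep_fd[OF rN]]
  have \<phi>h: "\<phi> x \<in> module_hom CC (space M x) (space N x)" if "x \<in> verts Q" for x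
    by (rule lin_hom[OF rep_hom_lin[OF \<phi>r that]])
  have eqI: "\<psi> x n = m" if "x \<in> verts Q" "m \<in> carrier (space M x)" "n = \<phi> x m" for x n m
    using \<psi>\<phi> that by simp
  let ?\<psi> = "\<lambda>x\<in>verts Q. restrict (\<psi> x) (carrier (space N x))"
  have \<psi>h: "\<psi> x \<in> module_hom CC (space N x) (space M x)" if x: "x \<in> verts Q" for x
  proof (rule homI)
    show "\<psi> x (n \<oplus>\<^bsub>space N x\<^esub> n') = \<psi> x n \<oplus>\<^bsub>space M x\<^esub> \<psi> x n'"
      if "n \<in> carrier (space N x)" "n' \<in> carrier (space N x)" for n n'
      using that x by (intro eqI) (simp_all add: \<psi>c \<phi>\<psi> vs_add[OF vM] hom_add[OF \<phi>h])
    show "\<psi> x (c \<odot>\<^bsub>space N x\<^esub> n) = c \<odot>\<^bsub>space M x\<^esub> \<psi> x n" if "n \<in> carrier (space N x)" for c n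
      using that x by (intro eqI) (simp_all add: \<psi>c \<phi>\<psi> vs_smult[OF vM] hom_smult[OF \<phi>h])
  qed (rule \<psi>c[OF x])
  have arr: "\<psi> (head Q a) (arrow N a n) = arrow M a (\<psi> (tail Q a) n)"
    if a: "a \<in> arcs Q" and n: "n \<in> carrier (space N (tail Q a))" for a n
    by (rule eqI[OF Q.head_in_verts[OF a]])
      (simp_all add: rep_hom_arrow[OF \<phi>r a] \<phi>\<psi> \<psi>c Q.tail_in_verts[OF a] n hom_closed[OF rep_arrow[OF rM a]])
  have "?\<psi> \<in> rep_hom Q N M"
    using restrict_lin[OF vN \<psi>h] hom_closed[OF rep_arrow[OF rN]] Q.tail_in_verts Q.head_in_verts
    by (auto simp: rep_hom_def arr)
  moreover have "\<psi> x (idem N x i n) = idem M x i (\<psi> x n)"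
    if x: "x \<in> verts Q" and n: "n \<in> carrier (space N x)" for x i n
  proof (rule eqI[OF x])
    show "idem M x i (\<psi> x n) \<in> carrier (space M x)" by (rule grading_closed[OF gM[OF x] \<psi>c[OF x n]])
    have "\<phi> x (idem M x i (\<psi> x n)) = idem N x i (\<phi> x (\<psi> x n))"
      using \<phi> x \<psi>c[OF x n] by (simp add: idem_rep_hom_def)
    then show "idem N x i n = \<phi> x (idem M x i (\<psi> x n))" by (simp add: \<phi>\<psi> x n)
  qed
  ultimately have \<psi>: "?\<psi> \<in> idem_rep_hom Q N M"
    using grading_closed[OF gN] by (simp add: idem_rep_hom_def)
  have "rep_comp Q M ?\<psi> \<phi> = rep_id Q M"
    using rep_hom_closed[OF \<phi>r] \<psi>\<phi> by (auto simp: rep_comp_def rep_id_def compose_def fun_eq_iff)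
  moreover have "rep_comp Q N \<phi> ?\<psi> = rep_id Q N"
    using \<phi>\<psi> by (auto simp: rep_comp_def rep_id_def compose_def fun_eq_iff)
  ultimately show ?thesis
    using \<phi> \<psi> by (auto simp: is_isomorphism_def)
qed

lemma path_fold_hom:
  assumes N: "is_rep Q N" and p: "Q.awalk u p v"
  shows "fold (arrow N) p \<in> module_hom CC (space N u) (space N v)"
  using p
proof (induction p arbitrary: u)
  case Nil
  then show ?case by (auto simp: Q.awalk_Nil_iff intro!: homI)
next
  case (Cons a p)
  then have a: "a \<in> arcs Q" "u = tail Q a" and p: "Q.awalk (head Q a) p v"
    by (auto simp: Q.awalk_Cons_iff)
  show ?case
    using hom_comp[OF rep_arrow[OF N a(1)] Cons.IH[OF p]] a(2) by (simp add: comp_def)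
qed

text \<open>
  The operator by which a path acts on the direct sum of the spaces of a representation.
\<close>

definition walk_map :: "('x, 'e, 'v) idem_rep \<Rightarrow> 'x \<times> 'e list \<Rightarrow> ('x \<Rightarrow> 'v) \<Rightarrow> 'x \<Rightarrow> 'v" where
  "walk_map N p d = coord_inj (verts Q) (space N) (Q.awlast (fst p) (snd p)) (fold (arrow N) (snd p) (d (fst p)))"

lemma awalk_last: "Q.awalk u p v \<Longrightarrow> Q.awalk u p w \<Longrightarrow> v = w"
  by (metis Q.awalkE)

lemma walk_map_awalk:
  "Q.awalk u p v \<Longrightarrow> walk_map N (u, p) d = coord_inj (verts Q) (space N) v (fold (arrow N) p (d u))"
  by (erule Q.awalkE) (simp add: walk_map_def)

lemma walk_map_hom:
  assumes N: "is_rep Q N" and p: "p \<in> quiver_paths Q"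
  shows "walk_map N p \<in> module_hom CC (total_space Q N) (total_space Q N)"
proof -
  obtain u q v where pq: "p = (u, q)" and w: "Q.awalk u q v" using p by (auto simp: quiver_paths_def)
  have u: "u \<in> verts Q" and v: "v \<in> verts Q"
    using Q.awalk_hd_in_verts[OF w] Q.awalk_last_in_verts[OF w] by simp_all
  have i: "coord_inj (verts Q) (space N) v \<in> module_hom CC (space N v) (total_space Q N)"
    by (rule coord_inj_hom[OF fd_vs[OF rep_fd[OF N]] v])
  show ?thesis
    unfolding pq walk_map_awalk[OF w]
    using hom_comp[OF hom_comp[OF coord_hom[OF u, of "space N"] path_fold_hom[OF N w]] i] .
qed

text \<open>
  If the walk \<open>p\<close> does not end at \<open>v\<close>, then \<open>walk_map N (u, p) d\<close> has coordinate zero at \<open>v\<close>, where the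
  path \<open>(v, q)\<close> starts.
\<close>

lemma walk_map_mult:
  assumes N: "is_rep Q N" and p: "(u, p) \<in> quiver_paths Q" and q: "(v, q) \<in> quiver_paths Q"
    and d: "d \<in> carrier (total_space Q N)"
  shows "walk_map N (v, q) (walk_map N (u, p) d) =
    (if Q.awalk u p v then walk_map N (u, p @ q) d else \<zero>\<^bsub>total_space Q N\<^esub>)"
proof -
  obtain v' where p': "Q.awalk u p v'" using p by (auto simp: quiver_paths_def)
  obtain w where q': "Q.awalk v q w" using q by (auto simp: quiver_paths_def)
  have v: "v \<in> verts Q" and w: "w \<in> verts Q"
    using Q.awalk_hd_in_verts[OF q'] Q.awalk_last_in_verts[OF q'] by simp_all
  have v': "Q.awalk u p v \<longleftrightarrow> v = v'"
    using p' awalk_last by blast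
  have i: "coord_inj (verts Q) (space N) w \<in> module_hom CC (space N w) (total_space Q N)"
    by (rule coord_inj_hom[OF fd_vs[OF rep_fd[OF N]] w])
  note Nv = fd_vs[OF rep_fd[OF N]]
  show ?thesis
  proof (cases "v = v'")
    case True
    then have pv: "Q.awalk u p v" using p' by simp
    show ?thesis
      unfolding walk_map_awalk[OF q'] walk_map_awalk[OF pv] walk_map_awalk[OF Q.awalk_appendI[OF pv q']]
      using pv v by (simp add: coord_inj_apply)
  next
    case False
    then show ?thesis
      unfolding v' walk_map_awalk[OF q'] walk_map_awalk[OF p']
      using v by (simp add: coord_inj_apply hom_zero[OF Nv[OF v] Nv[OF w] path_fold_hom[OF N q']]
          hom_zero[OF Nv[OF w] total_vs[OF N] i])
  qed
qed

text \<open>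
  The module is the direct sum \<open>D\<close> of the spaces \<open>N x\<close>, transported along an injection \<open>\<beta>\<close> of \<open>D\<close> into the type
  of vectors, with \<open>r\<close> the inverse of \<open>\<beta>\<close>. Paths act by \<open>walk_map\<close>, and the torus acts through the direct sum of
  the gradings. Equivariance is \<open>equivariance_iff\<close>, the condition on arrows being provided by
  \<open>shift_intertwine\<close>. The space \<open>e\<^sub>x M\<close> is the copy of \<open>N x\<close> inside the direct sum.
\<close>

lemma rep_of_surj:
  fixes N :: "('x, 'e, 'v) idem_rep"
  assumes N: "N \<in> obj (Mod_Idem_T Q T)"
  shows "\<exists>M e. is_equiv_module A \<alpha> M \<and> is_isomorphism (Mod_Idem_T Q T) (rep_of M) N e"
proof -
  have Ni: "is_idem_rep Q N" using N by (simp add: Mod_Idem_T_obj_iff)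
  then have rep: "is_rep Q N" and gr: "\<And>x. x \<in> verts Q \<Longrightarrow> grading (space N x) (idem N x)"
    by (auto simp: is_idem_rep_iff)
  have shift: "arrow N a (idem N (tail Q a) k v) = idem N (head Q a) (k + T a) (arrow N a v)"
    if a: "a \<in> arcs Q" and v: "v \<in> carrier (space N (tail Q a))" for a k v
    using shift_intertwine[OF fd_vs[OF rep_fd[OF rep Q.tail_in_verts[OF a]]] gr[OF Q.tail_in_verts[OF a]]
        rep_fd[OF rep Q.head_in_verts[OF a]] gr[OF Q.head_in_verts[OF a]] rep_arrow[OF rep a] v, of "T a" k]
      N a by (simp add: Mod_Idem_T_obj_iff)
  let ?D = "total_space Q N" and ?i = "coord_inj (verts Q) (space N)"
  note Nv = fd_vs[OF rep_fd[OF rep]]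
  have D: "fd_vectorspace ?D" by (rule total_fd[OF rep])
  note Dv = fd_vs[OF D]
  have ih: "?i x \<in> module_hom CC (space N x) ?D" if "x \<in> verts Q" for x by (rule coord_inj_hom[OF Nv that])
  note ic = hom_closed[OF ih]
  obtain \<beta> :: "('x \<Rightarrow> 'v) \<Rightarrow> 'v" where inj: "inj_on \<beta> (carrier ?D)"
    using direct_sum_inj[of "verts Q" "space N", OF Nv fin_verts] by blast
  define V where "V = transport ?D \<beta>"
  define r where "r = inv_into (carrier ?D) \<beta>"
  have Vv: "vectorspace CC V" and \<beta>: "\<beta> \<in> module_hom CC ?D V" and r: "r \<in> module_hom CC V ?D"
    unfolding V_def r_def by (rule transport_vs[OF Dv inj])+
  have Vcar: "carrier V = \<beta> ` carrier ?D" by (simp add: V_def transport_def Let_def)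
  have r\<beta>: "r (\<beta> d) = d" if "d \<in> carrier ?D" for d using inj that by (simp add: r_def)
  have \<beta>r: "\<beta> (r w) = w" if "w \<in> carrier V" for w using that by (simp add: Vcar r_def f_inv_into_f)
  have V: "fd_vectorspace V" by (rule fd_surj[OF D Vv \<beta>]) (simp add: Vcar)
  note \<beta>c = hom_closed[OF \<beta>] and rc = hom_closed[OF r]
  have rx: "r w x \<in> carrier (space N x)" if "w \<in> carrier V" "x \<in> verts Q" for w x
    by (rule total_coord[OF rc[OF that(1)] that(2)])
  define \<pi> where "\<pi> p w = \<beta> (walk_map N p (r w))" for p w
  have wc: "walk_map N p (r w) \<in> carrier ?D" if "p \<in> quiver_paths Q" "w \<in> carrier V" for p w
    by (rule hom_closed[OF walk_map_hom[OF rep that(1)] rc[OF that(2)]])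
  have \<pi>h: "\<pi> p \<in> module_hom CC V V" if "p \<in> quiver_paths Q" for p
    unfolding \<pi>_def by (rule hom_comp[OF hom_comp[OF r walk_map_hom[OF rep that]] \<beta>])
  have \<pi>m: "\<pi> (v, q) (\<pi> (u, p) w) = (if Q.awalk u p v then \<pi> (u, p @ q) w else \<zero>\<^bsub>V\<^esub>)"
    if "(u, p) \<in> quiver_paths Q" "(v, q) \<in> quiver_paths Q" "w \<in> carrier V" for u p v q w
    using walk_map_mult[OF rep that(1,2) rc[OF that(3)]]
    by (simp add: \<pi>_def r\<beta>[OF wc[OF that(1,3)]] hom_zero[OF Dv Vv \<beta>])
  have triv: "walk_map N (x, []) d = ?i x (d x)" if "x \<in> verts Q" for x d
    using walk_map_awalk[of x "[]" x N d] that by (simp add: Q.awalk_Nil_iff)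
  have arr: "walk_map N (tail Q a, [a]) d = ?i (head Q a) (arrow N a (d (tail Q a)))" if "a \<in> arcs Q" for a d
    using walk_map_awalk[of "tail Q a" "[a]" "head Q a" N d] awalk_arrow[OF that] by simp
  have \<pi>1: "(\<Oplus>\<^bsub>V\<^esub>x\<in>verts Q. \<pi> (x, []) w) = w" if w: "w \<in> carrier V" for w
  proof -
    interpret V: vectorspace CC V by (rule Vv)
    have "(\<Oplus>\<^bsub>V\<^esub>x\<in>verts Q. \<pi> (x, []) w) = (\<Oplus>\<^bsub>V\<^esub>x\<in>verts Q. \<beta> (?i x (r w x)))"
      using rx[OF w] by (intro V.M.finsum_cong') (auto simp: \<pi>_def triv intro!: \<beta>c ic)
    also have "\<dots> = \<beta> (\<Oplus>\<^bsub>?D\<^esub>x\<in>verts Q. ?i x (r w x))"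
      by (intro hom_finsum[OF Dv Vv \<beta>, symmetric] ic rx[OF w])
    also have "\<dots> = w" using direct_sum_decomp[of "verts Q" "space N", OF Nv fin_verts rc[OF w]] \<beta>r[OF w] by simp
    finally show ?thesis .
  qed
  let ?\<rho> = "path_action V \<pi>"
  note pam = path_action_module[OF V \<pi>h \<pi>m \<pi>1]
  have \<rho>: "is_fd_module A V ?\<rho>" by (rule pam(1))
  have \<rho>_path: "?\<rho> (single p 1) w = \<pi> p w" if "p \<in> quiver_paths Q" "w \<in> carrier V" for p w
    by (rule pam(2)) (use that in auto)
  have \<rho>_triv: "?\<rho> (trivial_path x) w = \<beta> (?i x (r w x))" if x: "x \<in> verts Q" and w: "w \<in> carrier V" for x w
  proof -
    have "(x, []) \<in> quiver_paths Q" using x by (simp add: quiver_paths_iff Q.awalk_Nil_iff)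
    from \<rho>_path[OF this w] show ?thesis by (simp add: trivial_path_def) (simp add: \<pi>_def triv x)
  qed
  have \<rho>_arr: "?\<rho> (arrow_path Q a) w = \<beta> (?i (head Q a) (arrow N a (r w (tail Q a))))"
    if a: "a \<in> arcs Q" and w: "w \<in> carrier V" for a w
  proof -
    have "(tail Q a, [a]) \<in> quiver_paths Q" using a by (simp add: quiver_paths_iff awalk_arrow)
    from \<rho>_path[OF this w] show ?thesis by (simp add: arrow_path_def) (simp add: \<pi>_def arr a)
  qed
  let ?E = "total_idem N"
  have E: "grading ?D ?E" by (rule total_idem_grading[OF Ni])
  define P where "P i w = \<beta> (?E i (r w))" for i w
  have Ec: "?E i (r w) \<in> carrier ?D" if "w \<in> carrier V" for i w by (rule grading_closed[OF E rc[OF that]])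
  have P: "grading V P"
    unfolding P_def by (rule grading_split[OF Dv E V r \<beta>]) (simp_all add: \<beta>r r\<beta> Ec)
  have E_inj: "?E k (?i x n) = ?i x (idem N x k n)" if x: "x \<in> verts Q" for x k n
    using hom_zero[OF Nv Nv grading_hom[OF gr]]
    by (auto simp: total_idem_def coord_inj_def fun_eq_iff)
  have P_\<beta>: "P k (\<beta> (?i x n)) = \<beta> (?i x (idem N x k n))" if "x \<in> verts Q" "n \<in> carrier (space N x)" for k x n
    by (simp add: P_def r\<beta> ic that E_inj)
  have r_P: "r (P k w) x = idem N x k (r w x)" if "w \<in> carrier V" "x \<in> verts Q" for k w x
    using that by (simp add: P_def r\<beta> Ec) (simp add: total_idem_def)
  have Pc: "P k w \<in> carrier V" if "w \<in> carrier V" for k w by (rule grading_closed[OF P that])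
  have "?\<rho> (trivial_path x) (P k w) = P k (?\<rho> (trivial_path x) w)"
    if "x \<in> verts Q" "w \<in> carrier V" for x k w
    using that by (simp add: \<rho>_triv Pc P_\<beta> r_P rx)
  moreover have "?\<rho> (arrow_path Q a) (P k w) = P (k + T a) (?\<rho> (arrow_path Q a) w)"
    if "a \<in> arcs Q" "w \<in> carrier V" for a k w
    using that by (simp add: \<rho>_arr Pc P_\<beta> r_P rx shift hom_closed[OF rep_arrow[OF rep]])
  ultimately have eq: "?\<rho> (\<alpha> z f) (torus_of V P z m) = torus_of V P z (?\<rho> f m)"
    if "z \<noteq> 0" "f \<in> carrier A" "m \<in> carrier V" for z f m
    using equivariance_iff[OF \<rho> P] that by blast
  define M where "M = \<lparr>vspace = V, act = ?\<rho>, gm_act = torus_of V P\<rparr>"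
  have M: "is_equiv_module A \<alpha> M"
    using \<rho> torus_of_algebraic[OF V P] eq by (simp add: is_equiv_module_def M_def)
  note Md = eqm_module[OF M]
  have sp: "space (rep_of M) = vertex_space M" by (simp add: rep_of_def)
  have mem: "w \<in> carrier (vertex_space M x) \<longleftrightarrow> w \<in> carrier V \<and> \<beta> (?i x (r w x)) = w" if "x \<in> verts Q" for x w
    using vertex_space_iff[OF Md that, of w] \<rho>_triv[OF that, of w]
    by (cases "w \<in> carrier V") (simp_all add: M_def)
  have rM: "is_idem_rep Q (rep_of M)" by (rule rep_of_is_idem_rep[OF M])
  let ?\<phi> = "\<lambda>x\<in>verts Q. restrict (\<lambda>w. r w x) (carrier (vertex_space M x))"
  have lin: "restrict (\<lambda>w. r w x) (carrier (vertex_space M x)) \<in> lin (vertex_space M x) (space N x)"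
    if x: "x \<in> verts Q" for x
  proof (rule restrict_lin)
    show "vectorspace CC (vertex_space M x)"
      using rM x fd_vs[OF rep_fd[of Q "rep_of M" x]] by (simp add: is_idem_rep_iff sp)
    show "(\<lambda>w. r w x) \<in> module_hom CC (vertex_space M x) (space N x)"
      using hom_comp[OF r coord_hom[OF x, of "space N"]] mem[OF x]
      by (auto simp: module_hom_def M_def)
  qed
  have arrow_M: "arrow (rep_of M) a w = \<beta> (?i (head Q a) (arrow N a (r w (tail Q a))))"
    if "a \<in> arcs Q" "w \<in> carrier V" for a w
    using \<rho>_arr[OF that] by (simp add: rep_of_def M_def)
  have arrow_Mc: "arrow (rep_of M) a w \<in> carrier (vertex_space M (head Q a))"
    if "a \<in> arcs Q" "w \<in> carrier (vertex_space M (tail Q a))" for a w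
    using rM hom_closed[OF rep_arrow[of Q "rep_of M" a]] that by (simp add: is_idem_rep_iff sp)
  have idem_Mc: "idem (rep_of M) x k w \<in> carrier (vertex_space M x)"
    if "x \<in> verts Q" "w \<in> carrier (vertex_space M x)" for x k w
    using rM grading_closed[of "vertex_space M x" "idem (rep_of M) x" w k] that
    by (simp add: is_idem_rep_iff sp)
  have idem_M: "idem (rep_of M) x k w = P k w" if "x \<in> verts Q" "w \<in> carrier (vertex_space M x)" for x k w
    using rep_of_idem[OF M that] weights_torus_of[OF V P, of w k] that mem by (simp add: M_def)
  have arrow_comm: "r (arrow (rep_of M) a w) (head Q a) = arrow N a (r w (tail Q a))"
    if a: "a \<in> arcs Q" and w: "w \<in> carrier (vertex_space M (tail Q a))" for a w
  proof -
    have wV: "w \<in> carrier V" using w mem[OF Q.tail_in_verts[OF a]] by blast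
    have c: "arrow N a (r w (tail Q a)) \<in> carrier (space N (head Q a))"
      by (rule hom_closed[OF rep_arrow[OF rep a] rx[OF wV Q.tail_in_verts[OF a]]])
    show ?thesis
      by (simp add: arrow_M[OF a wV] r\<beta>[OF ic[OF Q.head_in_verts[OF a] c]] coord_inj_apply Q.head_in_verts[OF a])
  qed
  have "?\<phi> \<in> rep_hom Q (rep_of M) N"
    using lin arrow_Mc arrow_comm Q.tail_in_verts Q.head_in_verts by (auto simp: rep_hom_def sp)
  then have \<phi>: "?\<phi> \<in> idem_rep_hom Q (rep_of M) N"
    using idem_Mc idem_M r_P mem by (simp add: idem_rep_hom_def sp)
  have inverse: "\<beta> (?i x n) \<in> carrier (vertex_space M x)" "r (\<beta> (?i x n)) x = n"
    if x: "x \<in> verts Q" and n: "n \<in> carrier (space N x)" for x n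
    using mem[OF x] \<beta>c[OF ic[OF x n]] r\<beta>[OF ic[OF x n]] x by (simp_all add: coord_inj_apply)
  have "is_isomorphism (Mod_Idem_T Q T) (rep_of M) N ?\<phi>"
    by (rule idem_rep_isomorphismI[OF rM Ni \<phi>, where \<psi> = "\<lambda>x n. \<beta> (?i x n)"])
      (simp_all add: sp inverse mem \<beta>c ic)
  then show ?thesis using M by blast
qed

theorem Equiv_Mod_equivalent_Mod_Idem_T:
  "equivalent_categories
     (Equiv_Mod A \<alpha> :: ((('x, 'e) path_elt, 'v) equiv_module, 'v \<Rightarrow> 'v) category)
     (Mod_Idem_T Q T :: (('x, 'e, 'v) idem_rep, 'x \<Rightarrow> 'v \<Rightarrow> 'v) category)"
proof (rule equivalent_categoriesI)
  let ?C = "Equiv_Mod A \<alpha> :: ((('x, 'e) path_elt, 'v) equiv_module, 'v \<Rightarrow> 'v) category"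
  let ?D = "Mod_Idem_T Q T :: (('x, 'e, 'v) idem_rep, 'x \<Rightarrow> 'v \<Rightarrow> 'v) category"
  let ?F = "\<lparr>on_obj = rep_of, on_hom = (\<lambda>X Y f. rep_of_hom X f)\<rparr>"
  have objC: "X \<in> obj ?C \<longleftrightarrow> is_equiv_module A \<alpha> X" for X by (simp add: Equiv_Mod_def)
  have C: "Hom ?C = equiv_module_hom A" "idn ?C = (\<lambda>M. \<lambda>v\<in>carrier (vspace M). v)"
    "cmp ?C = (\<lambda>X Y Z g f. compose (carrier (vspace X)) g f)" by (simp_all add: Equiv_Mod_def)
  show "is_category ?C" by (rule Equiv_Mod_category)
  show "is_category ?D"
    using Mod_Idem_category_on[of "obj ?D"] Mod_Idem_T_obj_iff
    by (auto simp: Mod_Idem_T_def Mod_Idem_def)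
  have sub: "w \<in> carrier (vspace X)"
    if "is_equiv_module A \<alpha> X" "x \<in> verts Q" "w \<in> carrier (vertex_space X x)" for X x w
    using vertex_space_iff[OF eqm_module[OF that(1)] that(2)] that(3) by blast
  show "is_functor ?C ?D ?F"
    unfolding is_functor_def
  proof (intro conjI ballI)
    fix X assume X: "X \<in> obj ?C"
    show "on_obj ?F X \<in> obj ?D" using X rep_of_obj by (simp add: objC)
    show "on_hom ?F X X (idn ?C X) = idn ?D (on_obj ?F X)"
      using sub[of X] X by (auto simp: objC C rep_of_hom_def rep_id_def rep_of_def fun_eq_iff)
  next
    fix X Y f assume "X \<in> obj ?C" "Y \<in> obj ?C" "f \<in> Hom ?C X Y"
    then show "on_hom ?F X Y f \<in> Hom ?D (on_obj ?F X) (on_obj ?F Y)"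
      using rep_of_hom_hom by (simp add: objC C)
  next
    fix X Y Z f g assume X: "X \<in> obj ?C" and Y: "Y \<in> obj ?C" and f: "f \<in> Hom ?C X Y"
    have "rep_of_hom X f \<in> rep_hom Q (rep_of X) (rep_of Y)"
      using rep_of_hom_hom[of X Y f] X Y f by (simp add: objC C idem_rep_hom_def)
    from rep_hom_closed[OF this]
    have "f w \<in> carrier (vertex_space Y x)" if "x \<in> verts Q" "w \<in> carrier (vertex_space X x)" for x w
      using that by (auto simp: rep_of_hom_def rep_of_def)
    then show "on_hom ?F X Z (cmp ?C X Y Z g f) =
        cmp ?D (on_obj ?F X) (on_obj ?F Y) (on_obj ?F Z) (on_hom ?F Y Z g) (on_hom ?F X Y f)"
      using sub[of X] X
      by (auto simp: objC C rep_of_hom_def rep_comp_def rep_of_def compose_def fun_eq_iff)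
  qed
  show "\<exists>f\<in>Hom ?C X Y. on_hom ?F X Y f = g"
    if "X \<in> obj ?C" "Y \<in> obj ?C" "g \<in> Hom ?D (on_obj ?F X) (on_obj ?F Y)" for X Y g
    using rep_of_full that by (simp add: objC C)
  show "f = g" if "X \<in> obj ?C" "Y \<in> obj ?C" "f \<in> Hom ?C X Y" "g \<in> Hom ?C X Y"
    "on_hom ?F X Y f = on_hom ?F X Y g" for X Y f g
    using rep_of_faithful that by (simp add: objC C)
  show "\<exists>X\<in>obj ?C. \<exists>e. is_isomorphism ?D (on_obj ?F X) Y e" if "Y \<in> obj ?D" for Y
    using rep_of_surj[OF that] by (auto simp: objC)
qed

end

end

theorem theorem4p4:
  fixes Q :: "('x, 'e) pre_digraph"
  assumes "fin_digraph Q"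
  shows
    "equivalent_categories
       (Mod_Idem Q :: (('x, 'e, 'v) idem_rep, 'x \<Rightarrow> 'v \<Rightarrow> 'v) category)
       (C_cat Q :: (('x, 'e, 'v) torus_rep, 'x \<Rightarrow> 'v \<Rightarrow> 'v) category)
     \<and>
     (\<forall>(T :: 'e \<Rightarrow> int) (\<alpha> :: complex \<Rightarrow> ('x, 'e) path_elt \<Rightarrow> ('x, 'e) path_elt).
        \<alpha> \<in> hom (mult_of CC) (algebra_Aut (path_algebra Q)) \<longrightarrow>
        (\<forall>z. z \<noteq> 0 \<longrightarrow> (\<forall>x\<in>verts Q. \<alpha> z (trivial_path x) = trivial_path x)) \<longrightarrow>
        (\<forall>z. z \<noteq> 0 \<longrightarrow> (\<forall>a\<in>arcs Q.
           \<alpha> z (arrow_path Q a) = z powi T a \<odot>\<^bsub>path_algebra Q\<^esub> arrow_path Q a)) \<longrightarrow>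
        equivalent_categories
          (Equiv_Mod (path_algebra Q) \<alpha> :: ((('x, 'e) path_elt, 'v) equiv_module, 'v \<Rightarrow> 'v) category)
          (Mod_Idem_T Q T :: (('x, 'e, 'v) idem_rep, 'x \<Rightarrow> 'v \<Rightarrow> 'v) category))"
proof (intro conjI allI impI)
  show "equivalent_categories
       (Mod_Idem Q :: (('x, 'e, 'v) idem_rep, 'x \<Rightarrow> 'v \<Rightarrow> 'v) category)
       (C_cat Q :: (('x, 'e, 'v) torus_rep, 'x \<Rightarrow> 'v \<Rightarrow> 'v) category)"
    by (rule Mod_Idem_equivalent_C_cat[OF assms])
next
  fix T :: "'e \<Rightarrow> int" and \<alpha> :: "complex \<Rightarrow> ('x, 'e) path_elt \<Rightarrow> ('x, 'e) path_elt"
  assume "\<alpha> \<in> hom (mult_of CC) (algebra_Aut (path_algebra Q))"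
    and "\<forall>z. z \<noteq> 0 \<longrightarrow> (\<forall>x\<in>verts Q. \<alpha> z (trivial_path x) = trivial_path x)"
    and "\<forall>z. z \<noteq> 0 \<longrightarrow> (\<forall>a\<in>arcs Q.
           \<alpha> z (arrow_path Q a) = z powi T a \<odot>\<^bsub>path_algebra Q\<^esub> arrow_path Q a)"
  then show "equivalent_categories
          (Equiv_Mod (path_algebra Q) \<alpha> :: ((('x, 'e) path_elt, 'v) equiv_module, 'v \<Rightarrow> 'v) category)
          (Mod_Idem_T Q T :: (('x, 'e, 'v) idem_rep, 'x \<Rightarrow> 'v \<Rightarrow> 'v) category)"
    by (intro Equiv_Mod_equivalent_Mod_Idem_T[OF assms]) auto
qed

end
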